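(* Let $X=X(\Delta)$ be a projective toric variety over an algebraically closed field $k$ of characteristic $0$, and let $\mathcal E$ be a toric vector bundle on $X$. Let $\epsilon(X,\operatorname{Sym}^p\mathcal E)$, $p>0$, be a family of finite sets as specified in the context, and let $\alpha(p,X,\mathcal E)$ be the numbers defined in the context from this family. Then the following are equivalent: 1. $\mathcal E$ is big; 2. there is an integer $p>0$ such that $\alpha(p,X,\mathcal E)>0$.
   Context: **Toric setup.** $k$ is an algebraically closed field of characteristic $0$, $T=(k^* )^r$ is a torus with character lattice $M=M(T)\cong\mathbb Z^r$ and cocharacter lattice $N=M^\vee$, with pairing $(m,n)=n(m)\in\mathbb Z$. $\Delta$ is a fan in $N$ such that the toric variety $X=X(\Delta)$ is projective. $P$ is the set of rays of $\Delta$, and $v_\rho\in N$ is the primitive generator of $\rho\in P$, i.e. $|\rho|\cap N=\mathbb Z_{\ge0}v_\rho$. For $\sigma\in\Delta$, $T_\sigma\subset T$ is the stabilizer of a point of the orbit corresponding to $\sigma$, so $M(T_\sigma)=M/(\sigma^\perp\cap M)$. Vector spaces and bundles written as $E$, $\mathcal E$ have finite rank. **Toric vector bundles.** A toric vector bundle $\mathcal E$ is a $T$-equivariant vector bundle on $X$. Let $E=\mathcal E_o$ be its fiber over $o=(1,\dots,1)\in T\subset X$. By Klyachko, $\mathcal E$ is determined up to isomorphism by decreasing $\mathbb Z$-filtrations $E\supseteq\cdots\supseteq\mathcal E^\rho(j)\supseteq\mathcal E^\rho(j+1)\supseteq\cdots\supseteq(0)$, $\rho\in P$ (complete: equal to $E$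 for $j\ll0$ and to $0$ for $j\gg0$), satisfying the compatibility condition: for each $\sigma\in\Delta$ there is a grading $E=\bigoplus_{\chi\in M(T_\sigma)}E^\sigma_\chi$ with $\mathcal E^\rho(j)=\bigoplus_{(\chi,v_\rho)\ge j}E^\sigma_\chi$ for all rays $\rho$ of $\sigma$ and all $j\in\mathbb Z$. For $e\in E\setminus\{0\}$ put $\phi_e(v_\rho)=\max\{j\mid e\in\mathcal E^\rho(j)\}$ and $$\Delta_e=\{u\in M\otimes_{\mathbb Z}\mathbb Q\mid (u,v_\rho)\le\phi_e(v_\rho)\ \text{for all }\rho\in P\}$$ (a possibly empty convex polytope). The normalization is such that $$H^0(X,\mathcal E)=\bigoplus_{u\in M}\operatorname{Span}\{\chi^{-u}\otimes e\mid e\in E\setminus\{0\},\ u\in\Delta_e\}\subset k[M]\otimes_kE.$$ For $p>0$, $\operatorname{Sym}^p\mathcal E$ has fiber $\operatorname{Sym}^pE$ over $o$ and filtrations $(\operatorname{Sym}^p\mathcal E)^\rho(j)=\sum_{j_1+\cdots+j_p=j}\mathcal E^\rho(j_1)\cdots\mathcal E^\rho(j_p)$. For $f\in\operatorname{Sym}^pE\setminus\{0\}$, put $\phi_f(v_\rho)=\max\{j\mid f\in(\operatorname{Sym}^p\mathcal E)^\rho(j)\}$ for $\rho\in P$ and $$\Delta_f=\{u\in M\otimes_{\mathbb Z}\mathbb Q\mid (u,v_\rho)\le\phi_f(v_\rho)\ \text{for all }\rho\in P\}.$$ **Bigness.** $\mathcal E$ is big if $\mathcal O(1)$ on the projective bundle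 $\mathbb P(\mathcal E)$ of rank-one quotients is big, i.e. $\limsup_{l\to\infty}\dim H^0(X,\operatorname{Sym}^l\mathcal E)/l^d>0$, where $d=\dim X+\operatorname{rk}\mathcal E-1$. **The sets $\epsilon$.** For every $p>0$ fix a finite subset $\epsilon(X,\operatorname{Sym}^p\mathcal E)\subset\operatorname{Sym}^pE\setminus\{0\}$ such that $$H^0(X,\operatorname{Sym}^p\mathcal E)=\operatorname{Span}\{\chi^{-u}\otimes f\mid f\in\epsilon(X,\operatorname{Sym}^p\mathcal E),\ u\in\Delta_f\cap M\}.$$ It is assumed that $\bigcup_{p>0}\epsilon(X,\operatorname{Sym}^p\mathcal E)\subset\operatorname{Sym}E=\bigoplus_{p\ge0}\operatorname{Sym}^pE$ is closed under multiplication and that, for each $p>0$, $\epsilon(X,\operatorname{Sym}^p\mathcal E)$ contains a ground set of the matroid of $\operatorname{Sym}^p\mathcal E$ constructed by Di Rocco, Jabbusch and Smith. For a toric vector bundle $\mathcal F$ with fiber $F$ over $o$, such a ground set $G\subset F\setminus\{0\}$ is obtained as follows: let $\mathcal L$ be the (finite) set of nonzero subspaces of $F$ of the form $\bigcap_{\rho\in P}\mathcal F^\rho(j_\rho)$, $j_\rho\in\mathbb Z$. Start with $G=\varnothing$ and go through the subspaces $V\in\mathcal L$ in order of increasing dimension; whenever $G\cap V$ does not span $V$, add to $G$ vectors of $V$ whose images form a basis of $V/\operatorname{Span}(G\cap V)$. In particular every $V\in\mathcal L$ is spanned by $G\cap V$. Put $\overline\epsilon(X,\operatorname{Sym}^p\mathcal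 E)=\{f\in\epsilon(X,\operatorname{Sym}^p\mathcal E)\mid\Delta_f\cap M\ne\varnothing\}$. **The number $\alpha(p,X,\mathcal E)$.** Let $$L(X,\mathcal E)=\operatorname{Span}\{a-b\mid a,b\in\Delta_f,\ f\in\operatorname{Sym}^pE\setminus\{0\},\ p>0\}\subset M\otimes_{\mathbb Z}\mathbb Q,$$ and let $w:M\otimes_{\mathbb Z}\mathbb Q\to(M\otimes_{\mathbb Z}\mathbb Q)/L(X,\mathcal E)$ be the natural projection. If $\Delta_f\neq\varnothing$, then $w(\Delta_f)$ is a single point, denoted $w_f$. Let $\Lambda=\{w(\Delta_f)\mid f\in\operatorname{Sym}^pE\setminus\{0\},\ p>0,\ \Delta_f\ne\varnothing\}$, a subsemigroup of $(M\otimes_{\mathbb Z}\mathbb Q)/L(X,\mathcal E)$. For $p>0$ let $W_p=\{w_f\mid f\in\overline\epsilon(X,\operatorname{Sym}^p\mathcal E)\}$, and let $\Lambda_p\subset\Lambda\times\mathbb Z$ be the subsemigroup generated by $W_p\times\{1\}$. Write $\overline\epsilon(X,\operatorname{Sym}^p\mathcal E)=\{f_1,\dots,f_q\}$. For $(w,l)\in\Lambda_p$ let $$\mathcal A_{(w,l)}(p,X,\mathcal E)=\operatorname{Span}\{f_1^{c_1}\cdots f_q^{c_q}\mid c_i\in\mathbb Z_{\ge0},\ c_1w_{f_1}+\cdots+c_qw_{f_q}=w,\ c_1+\cdots+c_q=l\}\subset\operatorname{Sym}^{pl}E,$$ and define $$\alpha(p,X,\mathcal E)=\limsup_{l\to\infty}\frac{\sum_{w\in\Lambda,\,(w,l)\in\Lambda_p}\dim\mathcal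 A_{(w,l)}(p,X,\mathcal E)}{l^{\dim X-\dim L(X,\mathcal E)+\operatorname{rk}\mathcal E-1}}.$$ *)

theory Defs
  imports
    Complex_Main
    "HOL-Library.Function_Algebras"
    "HOL-Library.Set_Algebras"
    "HOL-Library.Product_Plus"
    "HOL-Library.Poly_Mapping"
    "HOL-Library.Extended_Real"
    "HOL-Library.Liminf_Limsup"
    "HOL-Computational_Algebra.Polynomial"
begin

section \<open>Lattices and fans\<close>

text \<open>
  In coordinates \<open>M = N = \<int>\<^sup>r\<close>, viewed inside \<open>\<rat>\<^sup>r\<close>; a vector of \<open>\<rat>\<^sup>r\<close> is a function
  \<open>nat \<Rightarrow> rat\<close> vanishing at all indices \<open>\<ge> r\<close> (so that \<open>r = 0\<close> is allowed).
  The same sets serve for \<open>M\<close> and \<open>N\<close>; the pairing is the standard one.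
\<close>

type_synonym qvec = "nat \<Rightarrow> rat"

definition qscale :: "rat \<Rightarrow> qvec \<Rightarrow> qvec" where
  "qscale c v = (\<lambda>i. c * v i)"

interpretation qv: vector_space qscale
  by unfold_locales (auto simp: qscale_def fun_eq_iff algebra_simps)

definition qspace :: "nat \<Rightarrow> qvec set" where
  "qspace r = {v. \<forall>i\<ge>r. v i = 0}"

definition lattice_pts :: "nat \<Rightarrow> qvec set" where
  "lattice_pts r = {v \<in> qspace r. \<forall>i. v i \<in> \<int>}"

definition pairing :: "nat \<Rightarrow> qvec \<Rightarrow> qvec \<Rightarrow> rat" where
  "pairing r u v = (\<Sum>i<r. u i * v i)"

definition rational_cone :: "nat \<Rightarrow> qvec set \<Rightarrow> bool" where
  "rational_cone r \<sigma> \<longleftrightarrow>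
     (\<exists>S. finite S \<and> S \<subseteq> lattice_pts r \<and>
          \<sigma> = {\<Sum>s\<in>S. qscale (c s) s | c. \<forall>s\<in>S. c s \<ge> 0})"

definition strongly_convex :: "qvec set \<Rightarrow> bool" where
  "strongly_convex \<sigma> \<longleftrightarrow> (\<forall>v. v \<in> \<sigma> \<and> - v \<in> \<sigma> \<longrightarrow> v = 0)"

definition cone_face :: "nat \<Rightarrow> qvec set \<Rightarrow> qvec set \<Rightarrow> bool" where
  "cone_face r \<tau> \<sigma> \<longleftrightarrow>
     (\<exists>u\<in>qspace r. (\<forall>v\<in>\<sigma>. pairing r u v \<ge> 0) \<and> \<tau> = {v\<in>\<sigma>. pairing r u v = 0})"

definition fan :: "nat \<Rightarrow> qvec set set \<Rightarrow> bool" where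
  "fan r \<Delta> \<longleftrightarrow>
     finite \<Delta> \<and>
     (\<forall>\<sigma>\<in>\<Delta>. rational_cone r \<sigma> \<and> strongly_convex \<sigma>) \<and>
     (\<forall>\<sigma>\<in>\<Delta>. \<forall>\<tau>. cone_face r \<tau> \<sigma> \<longrightarrow> \<tau> \<in> \<Delta>) \<and>
     (\<forall>\<sigma>\<in>\<Delta>. \<forall>\<tau>\<in>\<Delta>. cone_face r (\<sigma> \<inter> \<tau>) \<sigma> \<and> cone_face r (\<sigma> \<inter> \<tau>) \<tau>)"

text \<open>
  \<open>X(\<Delta>)\<close> is projective iff \<open>\<Delta>\<close> is complete and \<open>X(\<Delta>)\<close> carries an ample torus-invariant Cartier
  divisor.  Such a divisor is a support function \<open>\<psi>\<close> that is given by some \<open>m \<in> M\<close> on every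
  maximal cone, and it is ample iff \<open>\<psi>\<close> is strictly convex.
\<close>

definition projective_fan :: "nat \<Rightarrow> qvec set set \<Rightarrow> bool" where
  "projective_fan r \<Delta> \<longleftrightarrow>
     fan r \<Delta> \<and> \<Union>\<Delta> = qspace r \<and>
     (\<exists>\<psi> :: qvec \<Rightarrow> rat. \<forall>\<sigma>\<in>\<Delta>. qv.dim \<sigma> = r \<longrightarrow>
        (\<exists>m\<in>lattice_pts r. (\<forall>v\<in>\<sigma>. \<psi> v = pairing r m v) \<and>
                       (\<forall>v\<in>qspace r - \<sigma>. \<psi> v < pairing r m v)))"

definition rays :: "qvec set set \<Rightarrow> qvec set set" where
  "rays \<Delta> = {\<rho>\<in>\<Delta>. qv.dim \<rho> = 1}"

definition ray_gen :: "nat \<Rightarrow> qvec set \<Rightarrow> qvec" where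
  "ray_gen r \<rho> = (THE v. v \<in> lattice_pts r \<and> \<rho> \<inter> lattice_pts r = {qscale (of_nat j) v | j :: nat. True})"

definition orth_lattice :: "nat \<Rightarrow> qvec set \<Rightarrow> qvec set" where
  "orth_lattice r \<sigma> = {u \<in> lattice_pts r. \<forall>v\<in>\<sigma>. pairing r u v = 0}"

text \<open>\<open>M(T\<^sub>\<sigma>) = M/(\<sigma>\<^sup>\<bottom> \<inter> M)\<close>, as a set of cosets.\<close>

definition stab_chars :: "nat \<Rightarrow> qvec set \<Rightarrow> qvec set set" where
  "stab_chars r \<sigma> = {m +o orth_lattice r \<sigma> | m. m \<in> lattice_pts r}"


section \<open>Symmetric algebra of the fibre\<close>

text \<open>
  After choosing a basis \<open>x\<^sub>0, \<dots>, x\<^bsub>n-1\<^esub>\<close> of the fibre \<open>E\<close>, \<open>Sym E\<close> is the polynomial ring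
  \<open>k[x\<^sub>0, \<dots>, x\<^bsub>n-1\<^esub>]\<close>, \<open>Sym\<^sup>p E\<close> its space of forms of degree \<open>p\<close>, and \<open>E = Sym\<^sup>1 E\<close>.
\<close>

type_synonym 'k symalg = "(nat \<Rightarrow>\<^sub>0 nat) \<Rightarrow>\<^sub>0 'k"

definition sscale :: "'k::field \<Rightarrow> 'k symalg \<Rightarrow> 'k symalg" where
  "sscale c f = Poly_Mapping.map ((*) c) f"

lemma lookup_sscale: "Poly_Mapping.lookup (sscale c f) m = c * Poly_Mapping.lookup f m"
  by (simp add: sscale_def Poly_Mapping.map.rep_eq when_def)

interpretation sv: vector_space "sscale :: 'k::field \<Rightarrow> 'k symalg \<Rightarrow> 'k symalg"
  by unfold_locales (auto intro!: poly_mapping_eqI simp: lookup_sscale lookup_add algebra_simps)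

definition sym_pow :: "nat \<Rightarrow> nat \<Rightarrow> 'k::field symalg set" where
  "sym_pow n p =
     {f. \<forall>m\<in>Poly_Mapping.keys f.
           Poly_Mapping.keys m \<subseteq> {..<n} \<and>
           (\<Sum>i\<in>Poly_Mapping.keys m. Poly_Mapping.lookup m i) = p}"

definition direct_sum_of :: "'k::field symalg set \<Rightarrow> 'i set \<Rightarrow> ('i \<Rightarrow> 'k symalg set) \<Rightarrow> bool" where
  "direct_sum_of V I W \<longleftrightarrow>
     (\<forall>i\<in>I. sv.subspace (W i)) \<and>
     V = sv.span (\<Union>i\<in>I. W i) \<and>
     (\<forall>i\<in>I. W i \<inter> sv.span (\<Union>j\<in>I - {i}. W j) = {0})"


section \<open>Toric vector bundles\<close>

text \<open>
  A toric vector bundle is given by its fibre \<open>V\<close> over the unit of the torus together with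
  Klyachko's filtrations, \<open>F \<rho> j\<close> being the step \<open>j\<close> of the filtration of the ray \<open>\<rho>\<close>.
  Only the values of \<open>F\<close> at rays matter.
\<close>

type_synonym 'k filts = "qvec set \<Rightarrow> int \<Rightarrow> 'k symalg set"

text \<open>
  For a ray \<open>\<rho>\<close> of \<open>\<sigma>\<close> all members \<open>u\<close> of a coset \<open>\<chi> \<in> M(T\<^sub>\<sigma>)\<close> have the same pairing with
  \<open>v\<^sub>\<rho>\<close>, so \<open>\<forall>u\<in>\<chi>\<close> expresses \<open>(\<chi>, v\<^sub>\<rho>) \<ge> j\<close>.
\<close>

definition toric_bundle ::
    "nat \<Rightarrow> qvec set set \<Rightarrow> 'k::field symalg set \<Rightarrow> 'k filts \<Rightarrow> bool" where
  "toric_bundle r \<Delta> V F \<longleftrightarrow>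
     (\<forall>\<rho>\<in>rays \<Delta>.
        (\<forall>j. sv.subspace (F \<rho> j) \<and> F \<rho> j \<subseteq> V) \<and>
        (\<forall>i j. i \<le> j \<longrightarrow> F \<rho> j \<subseteq> F \<rho> i) \<and>
        (\<forall>\<^sub>F j in at_bot. F \<rho> j = V) \<and>
        (\<forall>\<^sub>F j in at_top. F \<rho> j = {0})) \<and>
     (\<forall>\<sigma>\<in>\<Delta>. \<exists>W.
        direct_sum_of V (stab_chars r \<sigma>) W \<and>
        (\<forall>\<rho>\<in>rays \<Delta>. cone_face r \<rho> \<sigma> \<longrightarrow>
           (\<forall>j. F \<rho> j =
              sv.span (\<Union>\<chi>\<in>{\<chi> \<in> stab_chars r \<sigma>. \<forall>u\<in>\<chi>. pairing r u (ray_gen r \<rho>) \<ge> of_int j}. W \<chi>))))"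

text \<open>The filtrations of \<open>Sym\<^sup>p\<close> of a bundle, for \<open>p > 0\<close>; its fibre is \<^term>\<open>sym_pow n p\<close>.\<close>

definition sym_filt :: "'k::field filts \<Rightarrow> nat \<Rightarrow> 'k filts" where
  "sym_filt F p \<rho> j =
     sv.span {\<Prod>i<p. e i | e js. (\<Sum>i<p. js i) = j \<and> (\<forall>i<p. e i \<in> F \<rho> (js i))}"

definition phi :: "'k::field filts \<Rightarrow> 'k symalg \<Rightarrow> qvec set \<Rightarrow> int" where
  "phi F f \<rho> = (GREATEST j. f \<in> F \<rho> j)"

definition polytope_of :: "nat \<Rightarrow> qvec set set \<Rightarrow> 'k::field filts \<Rightarrow> 'k symalg \<Rightarrow> qvec set" where
  "polytope_of r \<Delta> F f =
     {u \<in> qspace r. \<forall>\<rho>\<in>rays \<Delta>. pairing r u (ray_gen r \<rho>) \<le> of_int (phi F f \<rho>)}"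

text \<open>
  \<open>k[M] \<otimes> Sym E\<close> consists of the finitely supported functions \<open>M \<rightarrow> Sym E\<close>, the tensor
  \<open>\<chi>\<^sup>u \<otimes> f\<close> being \<^term>\<open>Poly_Mapping.single u f\<close>.
\<close>

definition tscale :: "'k::field \<Rightarrow> (qvec \<Rightarrow>\<^sub>0 'k symalg) \<Rightarrow> (qvec \<Rightarrow>\<^sub>0 'k symalg)" where
  "tscale c s = Poly_Mapping.map (sscale c) s"

lemma lookup_tscale: "Poly_Mapping.lookup (tscale c s) u = sscale c (Poly_Mapping.lookup s u)"
  by (simp add: tscale_def Poly_Mapping.map.rep_eq when_def)

interpretation tv: vector_space "tscale :: 'k::field \<Rightarrow> (qvec \<Rightarrow>\<^sub>0 'k symalg) \<Rightarrow> _"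
  by unfold_locales
    (auto intro!: poly_mapping_eqI
       simp: lookup_tscale lookup_add sv.scale_right_distrib sv.scale_left_distrib)

definition global_sections ::
    "nat \<Rightarrow> qvec set set \<Rightarrow> 'k::field symalg set \<Rightarrow> 'k filts \<Rightarrow> (qvec \<Rightarrow>\<^sub>0 'k symalg) set" where
  "global_sections r \<Delta> V F =
     tv.span {Poly_Mapping.single (- u) e | u e.
                e \<in> V - {0} \<and> u \<in> polytope_of r \<Delta> F e \<inter> lattice_pts r}"

text \<open>The exponent may be negative when \<open>r = n = 0\<close>, whence the integer powers.\<close>

definition big :: "nat \<Rightarrow> nat \<Rightarrow> qvec set set \<Rightarrow> 'k::field filts \<Rightarrow> bool" where
  "big r n \<Delta> F \<longleftrightarrow>
     limsup (\<lambda>l. ereal (real (tv.dim (global_sections r \<Delta> (sym_pow n l) (sym_filt F l)))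
                        / real l powi (int r + int n - 1))) > 0"


section \<open>Ground sets of matroids of toric vector bundles\<close>

definition bundle_flats ::
    "qvec set set \<Rightarrow> 'k::field symalg set \<Rightarrow> 'k filts \<Rightarrow> 'k symalg set set" where
  "bundle_flats \<Delta> V F = {V \<inter> (\<Inter>\<rho>\<in>rays \<Delta>. F \<rho> (j \<rho>)) | j. True} - {{0}}"

text \<open>The images of the elements of \<open>B\<close> form a basis of \<open>V/W\<close>.\<close>

definition basis_modulo :: "'k::field symalg set \<Rightarrow> 'k symalg set \<Rightarrow> 'k symalg set \<Rightarrow> bool" where
  "basis_modulo V W B \<longleftrightarrow>
     B \<subseteq> V \<and> sv.span (W \<union> B) = V \<and> (\<forall>b\<in>B. b \<notin> sv.span (W \<union> (B - {b})))"

text \<open>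
  If \<open>G \<inter> V\<close> already spans \<open>V\<close>, then \<^const>\<open>basis_modulo\<close> forces \<open>B = {}\<close> and nothing is added.
\<close>

inductive ground_run :: "'k::field symalg set list \<Rightarrow> 'k symalg set \<Rightarrow> bool" where
  start: "ground_run [] {}"
| extend: "ground_run Vs G \<Longrightarrow> basis_modulo V (sv.span (G \<inter> V)) B
           \<Longrightarrow> ground_run (Vs @ [V]) (G \<union> B)"

definition ground_set ::
    "qvec set set \<Rightarrow> 'k::field symalg set \<Rightarrow> 'k filts \<Rightarrow> 'k symalg set \<Rightarrow> bool" where
  "ground_set \<Delta> V F G \<longleftrightarrow>
     (\<exists>Vs. distinct Vs \<and> set Vs = bundle_flats \<Delta> V F \<and>
           sorted_wrt (\<lambda>U U'. sv.dim U \<le> sv.dim U') Vs \<and> ground_run Vs G)"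


section \<open>The families \<open>\<epsilon>\<close> and the numbers \<open>\<alpha>\<close>\<close>

definition admissible_family ::
    "nat \<Rightarrow> nat \<Rightarrow> qvec set set \<Rightarrow> 'k::field filts \<Rightarrow> (nat \<Rightarrow> 'k symalg set) \<Rightarrow> bool" where
  "admissible_family r n \<Delta> F eps \<longleftrightarrow>
     (\<forall>p>0. finite (eps p) \<and> eps p \<subseteq> sym_pow n p - {0} \<and>
        global_sections r \<Delta> (sym_pow n p) (sym_filt F p) =
          tv.span {Poly_Mapping.single (- u) f | u f.
                     f \<in> eps p \<and> u \<in> polytope_of r \<Delta> (sym_filt F p) f \<inter> lattice_pts r}) \<and>
     (\<forall>f \<in> (\<Union>p\<in>{0<..}. eps p). \<forall>g \<in> (\<Union>p\<in>{0<..}. eps p). f * g \<in> (\<Union>p\<in>{0<..}. eps p)) \<and>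
     (\<forall>p>0. \<exists>G. ground_set \<Delta> (sym_pow n p) (sym_filt F p) G \<and> G \<subseteq> eps p)"

definition eps_bar ::
    "nat \<Rightarrow> qvec set set \<Rightarrow> 'k::field filts \<Rightarrow> (nat \<Rightarrow> 'k symalg set) \<Rightarrow> nat \<Rightarrow> 'k symalg set" where
  "eps_bar r \<Delta> F eps p = {f \<in> eps p. polytope_of r \<Delta> (sym_filt F p) f \<inter> lattice_pts r \<noteq> {}}"

definition Lspace :: "nat \<Rightarrow> nat \<Rightarrow> qvec set set \<Rightarrow> 'k::field filts \<Rightarrow> qvec set" where
  "Lspace r n \<Delta> F =
     qv.span {a - b | a b f p. p > 0 \<and> f \<in> sym_pow n p - {0} \<and>
                a \<in> polytope_of r \<Delta> (sym_filt F p) f \<and> b \<in> polytope_of r \<Delta> (sym_filt F p) f}"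

text \<open>
  Elements of \<open>(M \<otimes> \<rat>)/L\<close> are cosets \<open>u +o L\<close>; their sum in the quotient is the elementwise
  sum of sets.  \<open>wpt r n \<Delta> F p f\<close> is the point \<open>w\<^sub>f\<close>, for \<open>f \<in> Sym\<^sup>p E\<close>.
\<close>

definition wpt :: "nat \<Rightarrow> nat \<Rightarrow> qvec set set \<Rightarrow> 'k::field filts \<Rightarrow> nat \<Rightarrow> 'k symalg \<Rightarrow> qvec set" where
  "wpt r n \<Delta> F p f =
     the_elem ((\<lambda>u. u +o Lspace r n \<Delta> F) ` polytope_of r \<Delta> (sym_filt F p) f)"

definition Lam :: "nat \<Rightarrow> nat \<Rightarrow> qvec set set \<Rightarrow> 'k::field filts \<Rightarrow> qvec set set" where
  "Lam r n \<Delta> F =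
     {wpt r n \<Delta> F p f | p f. p > 0 \<and> f \<in> sym_pow n p - {0} \<and>
        polytope_of r \<Delta> (sym_filt F p) f \<noteq> {}}"

inductive_set semigroup_gen :: "'a::plus set \<Rightarrow> 'a set" for S :: "'a set" where
  base: "x \<in> S \<Longrightarrow> x \<in> semigroup_gen S"
| plus: "x \<in> semigroup_gen S \<Longrightarrow> y \<in> semigroup_gen S \<Longrightarrow> x + y \<in> semigroup_gen S"

definition Lam_p ::
    "nat \<Rightarrow> nat \<Rightarrow> qvec set set \<Rightarrow> 'k::field filts \<Rightarrow> (nat \<Rightarrow> 'k symalg set) \<Rightarrow> nat
       \<Rightarrow> (qvec set \<times> int) set" where
  "Lam_p r n \<Delta> F eps p = semigroup_gen ((wpt r n \<Delta> F p ` eps_bar r \<Delta> F eps p) \<times> {1})"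

text \<open>
  In the condition \<open>c\<^sub>1 w\<^sub>1 + \<dots> + c\<^sub>q w\<^sub>q = w\<close> the multiple \<open>c w\<close> is the \<open>c\<close>-fold sum of the coset
  \<open>w\<close>.  The empty sum of sets is \<open>{0}\<close> and not the zero coset \<open>L\<close>; the summand \<^const>\<open>Lspace\<close>
  corrects this and changes nothing otherwise.
\<close>

definition A_piece ::
    "nat \<Rightarrow> nat \<Rightarrow> qvec set set \<Rightarrow> 'k::field filts \<Rightarrow> (nat \<Rightarrow> 'k symalg set) \<Rightarrow> nat
       \<Rightarrow> qvec set \<Rightarrow> int \<Rightarrow> 'k symalg set" where
  "A_piece r n \<Delta> F eps p w l =
     sv.span {\<Prod>f\<in>eps_bar r \<Delta> F eps p. f ^ c f | c :: 'k symalg \<Rightarrow> nat.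
        Lspace r n \<Delta> F + (\<Sum>f\<in>eps_bar r \<Delta> F eps p. \<Sum>i<c f. wpt r n \<Delta> F p f) = w \<and>
        int (\<Sum>f\<in>eps_bar r \<Delta> F eps p. c f) = l}"

definition alpha ::
    "nat \<Rightarrow> nat \<Rightarrow> qvec set set \<Rightarrow> 'k::field filts \<Rightarrow> (nat \<Rightarrow> 'k symalg set) \<Rightarrow> nat \<Rightarrow> ereal" where
  "alpha r n \<Delta> F eps p =
     limsup (\<lambda>l. ereal
       ((\<Sum>w\<in>{w \<in> Lam r n \<Delta> F. (w, int l) \<in> Lam_p r n \<Delta> F eps p}.
           real (sv.dim (A_piece r n \<Delta> F eps p w (int l))))
        / real l powi (int r - int (qv.dim (Lspace r n \<Delta> F)) + int n - 1)))"

end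

(*
  A weight of degree l is a pair of a character u and the leading monomial of a form g of degree l
  such that chi^(-u) g is a section.  Their number is dim H^0(Sym^l E), degree by degree they form
  a graded semigroup in Z^(r+n), and they are bounded by O(l) because the fan is complete.

  If E is big, the weights span Q^(r+n): otherwise the weights of degree l satisfy two independent
  linear equations, and there are only O(l^(r+n-2)) of them.  Hence there are r + n - dim L weights
  that are independent modulo L, and passing to powers of the forms they have a common degree p.
  The monomials in these forms lie in the spaces A_(w,l)(p) and are separated by w and the leading
  monomial, so alpha(p) > 0.

  Conversely, multiply A_(w,l)(p) by a form of degree O(l) whose polytope contains a box of side
  O(l) in the direction of L.  All products then have about l^(dim L) lattice points in common in
  their polytopes, and the dimension of H^0 is at least l^(dim L) times the sum of the dim A_(w,l).
*)

theory Submission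
  imports Defs "HOL-Library.FuncSet"
begin

section \<open>Leading monomials\<close>

text \<open>Only the order of growth has to be controlled, so linear spans can replace convex
  bodies: a missing dimension in the span of the weights costs a factor l, while a full set of
  independent weights already supplies enough monomials. Leading monomials are used because they are
  multiplicative and because their number is the dimension. What separates the two conditions is
  that bigness sees all degrees at once, whereas \<open>alpha\<close> fixes one p. Finitely many
  independent weights suffice, and these have powers of one common degree. In the converse, two
  products with the same w may have disjoint polytopes, shifted against each other along L, so their
  sum need not be homogeneous at any common character. The shift is at most linear in l. Hence a box
  of side linear in l absorbs it, at the cost of a constant factor in the degree, which a limsup
  tolerates. The bound O(l) needs a bridge: polytopes are given by ray generators, completeness
  speaks of cones. The bridge is that a strongly convex cone is generated by its one-dimensional
  faces, which rests on Gordan's alternative.\<close>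

definition lead_mon :: "'k::field symalg \<Rightarrow> (nat \<Rightarrow>\<^sub>0 nat)" where
  "lead_mon f = Max (Poly_Mapping.keys f)"

lemma lead_mon_in_keys: "f \<noteq> 0 \<Longrightarrow> lead_mon f \<in> Poly_Mapping.keys f"
  unfolding lead_mon_def by (rule Max_in) auto

lemma lookup_lead_mon: "f \<noteq> 0 \<Longrightarrow> Poly_Mapping.lookup f (lead_mon f) \<noteq> 0"
  using lead_mon_in_keys by (simp add: in_keys_iff)

lemma lead_mon_ge: "m \<in> Poly_Mapping.keys f \<Longrightarrow> m \<le> lead_mon f"
  unfolding lead_mon_def by (rule Max_ge) auto

lemma lookup_gt_lead_mon: "lead_mon f < m \<Longrightarrow> Poly_Mapping.lookup f m = 0"
  using lead_mon_ge[of m f] by (force simp: in_keys_iff)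

lemma lead_mon_eqI:
  "m \<in> Poly_Mapping.keys f \<Longrightarrow> (\<And>m'. m' \<in> Poly_Mapping.keys f \<Longrightarrow> m' \<le> m) \<Longrightarrow> lead_mon f = m"
  unfolding lead_mon_def by (rule Max_eqI) auto

text \<open>Split off both leading terms. The order on exponents is strictly compatible with
  addition, so every other product of monomials lies below \<open>a + b\<close>, and the product of
  the leading coefficients, nonzero in a field, survives there.\<close>

lemma lead_mon_mult:
  fixes f g :: "'k::field symalg"
  assumes "f \<noteq> 0" "g \<noteq> 0"
  shows "lead_mon (f * g) = lead_mon f + lead_mon g"
proof -
  define a b where "a = lead_mon f" and "b = lead_mon g"
  define c d where "c = Poly_Mapping.lookup f a" and "d = Poly_Mapping.lookup g b"
  define f' g' where "f' = f - Poly_Mapping.single a c" and "g' = g - Poly_Mapping.single b d"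
  have cd: "c \<noteq> 0" "d \<noteq> 0"
    using assms lookup_lead_mon by (auto simp: a_def b_def c_def d_def)
  have kf': "m < a" if "m \<in> Poly_Mapping.keys f'" for m
  proof -
    have "Poly_Mapping.lookup f' m \<noteq> 0" using that by (simp add: in_keys_iff)
    then have "m \<noteq> a" "Poly_Mapping.lookup f m \<noteq> 0"
      by (auto simp: f'_def lookup_minus lookup_single c_def when_def split: if_splits)
    then show ?thesis using lead_mon_ge[of m f] by (simp add: a_def in_keys_iff)
  qed
  have kg': "m < b" if "m \<in> Poly_Mapping.keys g'" for m
  proof -
    have "Poly_Mapping.lookup g' m \<noteq> 0" using that by (simp add: in_keys_iff)
    then have "m \<noteq> b" "Poly_Mapping.lookup g m \<noteq> 0"
      by (auto simp: g'_def lookup_minus lookup_single d_def when_def split: if_splits)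
    then show ?thesis using lead_mon_ge[of m g] by (simp add: b_def in_keys_iff)
  qed
  have kg: "m \<le> b" if "m \<in> Poly_Mapping.keys g" for m
    using lead_mon_ge that by (simp add: b_def)
  have kf: "m \<le> a" if "m \<in> Poly_Mapping.keys f" for m
    using lead_mon_ge that by (simp add: a_def)
  have "f * g = Poly_Mapping.single (a + b) (c * d) + Poly_Mapping.single a c * g' + f' * g"
    by (simp add: f'_def g'_def algebra_simps mult_single)
  moreover have "a + b \<notin> Poly_Mapping.keys (Poly_Mapping.single a c * g')"
    using keys_mult[of "Poly_Mapping.single a c" g'] kg' by (auto split: if_splits dest!: subsetD dest: kg')
  moreover have "a + b \<notin> Poly_Mapping.keys (f' * g)"
    using keys_mult[of f' g] kf' kg by (force dest: add_less_le_mono)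
  ultimately have "Poly_Mapping.lookup (f * g) (a + b) = c * d"
    by (simp add: lookup_add in_keys_iff)
  then have "a + b \<in> Poly_Mapping.keys (f * g)" using cd by (simp add: in_keys_iff)
  moreover have "m \<le> a + b" if "m \<in> Poly_Mapping.keys (f * g)" for m
    using that keys_mult[of f g] kf kg by (force intro: add_mono)
  ultimately show ?thesis unfolding a_def b_def by (intro lead_mon_eqI)
qed

lemma lead_mon_one: "lead_mon (1 :: 'k::field symalg) = 0"
  by (simp add: lead_mon_def)

lemma lead_mon_prod:
  "finite A \<Longrightarrow> (\<And>a. a \<in> A \<Longrightarrow> f a \<noteq> 0) \<Longrightarrow> lead_mon (\<Prod>a\<in>A. f a) = (\<Sum>a\<in>A. lead_mon (f a))"
  by (induction A rule: finite_induct) (auto simp: lead_mon_one lead_mon_mult)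

text \<open>Echelon form: one element per leading monomial gives a basis, and elimination stops
  because there are finitely many leading monomials. Zero is removed since \<open>lead_mon 0\<close>
  is the maximum of an empty set.\<close>

lemma lead_mon_basis:
  fixes V :: "'k::field symalg set"
  assumes V: "sv.subspace V" and fin: "finite (lead_mon ` (V - {0}))"
  obtains B where "B \<subseteq> V" "finite B" "sv.independent B" "sv.span B = V"
    "card B = card (lead_mon ` (V - {0}))"
proof -
  define M where "M = lead_mon ` (V - {0})"
  have "\<forall>m\<in>M. \<exists>g. g \<in> V - {0} \<and> lead_mon g = m" by (auto simp: M_def)
  then obtain g where g: "\<And>m. m \<in> M \<Longrightarrow> g m \<in> V \<and> g m \<noteq> 0 \<and> lead_mon (g m) = m"
    by (metis Diff_iff insertI1)
  have finM: "finite M" using fin by (simp add: M_def)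
  have inj: "inj_on g M" using g by (metis inj_onI)
  have sub: "g ` M \<subseteq> V" using g by auto
  have ind: "sv.independent (g ` M)"
  proof (rule sv.independent_if_scalars_zero)
    show "finite (g ` M)" using finM by simp
    fix f x assume s: "(\<Sum>x\<in>g ` M. sscale (f x) x) = 0" and x: "x \<in> g ` M"
    show "f x = 0"
    proof (rule ccontr)
      assume nz: "f x \<noteq> 0"
      \<comment> \<open>At the largest monomial with a nonzero scalar, terms with smaller leading
        monomial have coefficient 0 and terms with larger one have scalar 0.\<close>
      define M' where "M' = {m \<in> M. f (g m) \<noteq> 0}"
      have "M' \<noteq> {}" "finite M'" using x nz finM by (auto simp: M'_def)
      then have mx: "Max M' \<in> M'" "\<And>m. m \<in> M' \<Longrightarrow> m \<le> Max M'" by auto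
      define k where "k = Max M'"
      have k: "k \<in> M" "f (g k) \<noteq> 0" using mx(1) by (auto simp: M'_def k_def)
      have "0 = Poly_Mapping.lookup (\<Sum>x\<in>g ` M. sscale (f x) x) k" using s by simp
      also have "\<dots> = (\<Sum>m\<in>M. f (g m) * Poly_Mapping.lookup (g m) k)"
        by (simp add: sum.reindex[OF inj] lookup_sum lookup_sscale)
      also have "\<dots> = (\<Sum>m\<in>{k}. f (g m) * Poly_Mapping.lookup (g m) k)"
      proof (rule sum.mono_neutral_right[OF finM], use k in simp, intro ballI)
        fix m assume m: "m \<in> M - {k}"
        show "f (g m) * Poly_Mapping.lookup (g m) k = 0"
        proof (cases "m \<in> M'")
          case True
          then have "m < k" using mx(2)[of m] m by (auto simp: k_def order.strict_iff_order)
          then show ?thesis using g[of m] m by (simp add: lookup_gt_lead_mon)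
        next
          case False
          then show ?thesis using m by (auto simp: M'_def)
        qed
      qed
      also have "\<dots> \<noteq> 0" using k g[of k] lookup_lead_mon[of "g k"] by auto
      finally show False by simp
    qed
  qed
  have span: "e \<in> sv.span (g ` M)" if "e \<in> V" for e
    using that
  \<comment> \<open>The measure counts the leading monomials still available for \<open>e\<close>,
    and is 0 for \<open>e = 0\<close>.\<close>
  proof (induction "card {m \<in> M. e \<noteq> 0 \<and> m \<le> lead_mon e}" arbitrary: e rule: less_induct)
    case less
    show ?case
    proof (cases "e = 0")
      case False
      define m where "m = lead_mon e"
      have mM: "m \<in> M" using less.prems False by (auto simp: M_def m_def)
      define c where "c = Poly_Mapping.lookup e m / Poly_Mapping.lookup (g m) m"
      define e' where "e' = e - sscale c (g m)"
      have gm: "g m \<in> V" "g m \<noteq> 0" "lead_mon (g m) = m" using g mM by auto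
      have gm0: "Poly_Mapping.lookup (g m) m \<noteq> 0" using lookup_lead_mon[of "g m"] gm by simp
      have e'V: "e' \<in> V" unfolding e'_def
        by (intro sv.subspace_diff[OF V] sv.subspace_scale[OF V] less.prems gm)
      have lt: "lead_mon e' < m" if "e' \<noteq> 0"
      proof (rule ccontr)
        assume "\<not> lead_mon e' < m"
        moreover have "lead_mon e' \<noteq> m"
          using lookup_lead_mon[OF that] gm0
          by (auto simp: e'_def lookup_minus lookup_sscale c_def)
        ultimately have "m < lead_mon e'" by simp
        then have "Poly_Mapping.lookup e' (lead_mon e') = 0"
          using gm by (simp add: e'_def lookup_minus lookup_sscale lookup_gt_lead_mon m_def)
        then show False using lookup_lead_mon[OF that] by simp
      qed
      have "{k \<in> M. e' \<noteq> 0 \<and> k \<le> lead_mon e'} \<subset> {k \<in> M. e \<noteq> 0 \<and> k \<le> lead_mon e}"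
      proof
        show "{k \<in> M. e' \<noteq> 0 \<and> k \<le> lead_mon e'} \<subseteq> {k \<in> M. e \<noteq> 0 \<and> k \<le> lead_mon e}"
          using lt False by (auto simp: m_def)
        have "m \<notin> {k \<in> M. e' \<noteq> 0 \<and> k \<le> lead_mon e'}" using lt by auto
        then show "{k \<in> M. e' \<noteq> 0 \<and> k \<le> lead_mon e'} \<noteq> {k \<in> M. e \<noteq> 0 \<and> k \<le> lead_mon e}"
          using mM False m_def by blast
      qed
      then have "card {k \<in> M. e' \<noteq> 0 \<and> k \<le> lead_mon e'} < card {k \<in> M. e \<noteq> 0 \<and> k \<le> lead_mon e}"
        using finM by (intro psubset_card_mono) auto
      then have "e' \<in> sv.span (g ` M)" using less.hyps e'V by blast
      moreover have "sscale c (g m) \<in> sv.span (g ` M)"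
        using mM by (intro sv.span_scale sv.span_base) auto
      ultimately have "e' + sscale c (g m) \<in> sv.span (g ` M)" by (rule sv.span_add)
      then show ?thesis by (simp add: e'_def)
    qed (simp add: sv.span_zero)
  qed
  have "sv.span (g ` M) = V"
    using span sv.span_minimal[OF sub V] by blast
  then show thesis
    using that[of "g ` M"] sub ind finM card_image[OF inj] by (simp add: M_def)
qed

lemma dim_eq_card_lead_mon:
  fixes V :: "'k::field symalg set"
  assumes "sv.subspace V" and "finite (lead_mon ` (V - {0}))"
  shows "sv.dim V = card (lead_mon ` (V - {0}))"
proof -
  obtain B where "sv.independent B" "sv.span B = V" "card B = card (lead_mon ` (V - {0}))"
    using lead_mon_basis[OF assms] by blast
  then show ?thesis using sv.dim_span_eq_card_independent by metis
qed

text \<open>The span is graded by the exponent \<open>- u\<close>, so bases of the spaces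
  \<open>V u\<close> combine to a basis. \<open>U\<close> may be infinite; finiteness of the set of
  pairs leaves only finitely many nonzero \<open>V u\<close>.\<close>

lemma tdim_eq_card_lead_mon:
  fixes V :: "qvec \<Rightarrow> 'k::field symalg set"
  assumes V: "\<And>u. sv.subspace (V u)"
    and fin: "finite {(u, lead_mon g) | u g. u \<in> U \<and> g \<in> V u - {0}}"
  shows "tv.dim (tv.span {Poly_Mapping.single (- u) g | u g. u \<in> U \<and> g \<in> V u})
    = card {(u, lead_mon g) | u g. u \<in> U \<and> g \<in> V u - {0}}"
proof -
  define S where "S = {(u, lead_mon g) | u g. u \<in> U \<and> g \<in> V u - {0}}"
  define U' where "U' = fst ` S"
  have finU: "finite U'" using fin by (simp add: U'_def S_def)
  have S: "S = (SIGMA u:U'. lead_mon ` (V u - {0}))"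
    by (force simp: S_def U'_def)
  have finu: "finite (lead_mon ` (V u - {0}))" if "u \<in> U" for u
    by (rule finite_surj[OF fin, of _ snd]) (use that in force)
  have "\<forall>u\<in>U'. \<exists>B. B \<subseteq> V u \<and> finite B \<and> sv.independent B \<and> sv.span B = V u \<and>
      card B = card (lead_mon ` (V u - {0}))"
  proof
    fix u assume "u \<in> U'"
    then have "u \<in> U" by (auto simp: U'_def S_def)
    then show "\<exists>B. B \<subseteq> V u \<and> finite B \<and> sv.independent B \<and> sv.span B = V u \<and>
      card B = card (lead_mon ` (V u - {0}))"
      using lead_mon_basis[OF V finu] by metis
  qed
  then obtain B where B: "\<And>u. u \<in> U' \<Longrightarrow> B u \<subseteq> V u \<and> finite (B u) \<and> sv.independent (B u) \<and>
      sv.span (B u) = V u \<and> card (B u) = card (lead_mon ` (V u - {0}))"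
    by metis
  define T where "T = (\<lambda>(u, b). Poly_Mapping.single (- u) b) ` (SIGMA u:U'. B u)"
  have nz: "b \<noteq> 0" if "u \<in> U'" "b \<in> B u" for u b
    using B[OF that(1)] that(2) sv.dependent_zero by blast
  have inj: "inj_on (\<lambda>(u, b). Poly_Mapping.single (- u) b) (SIGMA u:U'. B u)"
  proof (rule inj_onI, clarsimp)
    fix u b u' b' assume a: "u \<in> U'" "b \<in> B u" "u' \<in> U'" "b' \<in> B u'"
      "Poly_Mapping.single (- u) b = Poly_Mapping.single (- u') b'"
    have "Poly_Mapping.keys (Poly_Mapping.single (- u) b) = Poly_Mapping.keys (Poly_Mapping.single (- u') b')"
      by (simp only: a(5))
    then have "u = u'" using nz[OF a(1,2)] nz[OF a(3,4)] by simp
    moreover have "b = b'" using a(5) \<open>u = u'\<close> by (metis lookup_single_eq)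
    ultimately show "u = u' \<and> b = b'" by simp
  qed
  have finS: "finite (SIGMA u:U'. B u)" using finU B by auto
  have ind: "tv.independent T"
  proof (rule tv.independent_if_scalars_zero)
    show "finite T" using finS by (simp add: T_def)
    fix f x assume s: "(\<Sum>x\<in>T. tscale (f x) x) = 0" and x: "x \<in> T"
    then obtain u0 b0 where ub: "u0 \<in> U'" "b0 \<in> B u0" "x = Poly_Mapping.single (- u0) b0"
      by (auto simp: T_def)
    \<comment> \<open>Reading the relation at the exponent \<open>- u0\<close> leaves a relation
      inside the independent set \<open>B u0\<close>.\<close>
    have "0 = Poly_Mapping.lookup (\<Sum>x\<in>T. tscale (f x) x) (- u0)" using s by simp
    also have "\<dots> = (\<Sum>(u, b)\<in>(SIGMA u:U'. B u).
        sscale (f (Poly_Mapping.single (- u) b)) (b when u = u0))"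
      by (simp add: T_def split_def sum.reindex[OF inj[unfolded split_def]] lookup_sum lookup_tscale lookup_single)
    also have "\<dots> = (\<Sum>u\<in>U'. \<Sum>b\<in>B u. sscale (f (Poly_Mapping.single (- u) b)) (b when u = u0))"
      using finU B by (subst sum.Sigma) auto
    also have "\<dots> = (\<Sum>u\<in>U'. if u = u0 then \<Sum>b\<in>B u0. sscale (f (Poly_Mapping.single (- u0) b)) b else 0)"
      by (intro sum.cong) (auto simp: when_def)
    also have "\<dots> = (\<Sum>b\<in>B u0. sscale (f (Poly_Mapping.single (- u0) b)) b)"
      using finU ub by simp
    finally show "f x = 0"
      using sv.independentD[of "B u0" "B u0" "\<lambda>b. f (Poly_Mapping.single (- u0) b)" b0]
        B[OF ub(1)] ub by simp
  qed
  have sub: "Poly_Mapping.single (- u) g \<in> tv.span T" if "u \<in> U" "g \<in> V u" for u g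
  proof (cases "g = 0")
    case False
    then have u: "u \<in> U'" using that by (force simp: U'_def S_def)
    have "g \<in> sv.span (B u)" using B[OF u] that by simp
    then show ?thesis
    proof (induction rule: sv.span_induct_alt)
      case (step c x y)
      have "Poly_Mapping.single (- u) x \<in> tv.span T"
        using step u by (intro tv.span_base) (force simp: T_def)
      then have "tscale c (Poly_Mapping.single (- u) x) + Poly_Mapping.single (- u) y \<in> tv.span T"
        by (intro tv.span_add tv.span_scale step)
      moreover have "tscale c (Poly_Mapping.single (- u) x) + Poly_Mapping.single (- u) y
        = Poly_Mapping.single (- u) (sscale c x + y)"
        by (rule poly_mapping_eqI) (simp add: lookup_add lookup_tscale lookup_single when_def)
      ultimately show ?case by (simp only:)
    qed (simp add: tv.span_zero)
  qed (simp add: tv.span_zero)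
  have "tv.span {Poly_Mapping.single (- u) g | u g. u \<in> U \<and> g \<in> V u} = tv.span T"
  proof (rule tv.span_eq[THEN iffD2], intro conjI)
    show "{Poly_Mapping.single (- u) g | u g. u \<in> U \<and> g \<in> V u} \<subseteq> tv.span T"
      using sub by auto
    have "T \<subseteq> {Poly_Mapping.single (- u) g | u g. u \<in> U \<and> g \<in> V u}"
      using B by (fastforce simp: T_def U'_def S_def)
    then show "T \<subseteq> tv.span {Poly_Mapping.single (- u) g | u g. u \<in> U \<and> g \<in> V u}"
      using tv.span_superset by blast
  qed
  then have "tv.dim (tv.span {Poly_Mapping.single (- u) g | u g. u \<in> U \<and> g \<in> V u}) = card T"
    using tv.dim_span_eq_card_independent[OF ind] by simp
  also have "\<dots> = (\<Sum>u\<in>U'. card (B u))"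
    unfolding T_def using card_image[OF inj] finU B by simp
  also have "\<dots> = card S" unfolding S
    by (subst card_SigmaI) (use finU B fin finu in \<open>auto simp: U'_def S_def\<close>)
  finally show ?thesis by (simp add: S_def)
qed

section \<open>Cones over the rationals\<close>

lemma pairing_simps:
  "pairing r (u + u') v = pairing r u v + pairing r u' v"
  "pairing r u (v + v') = pairing r u v + pairing r u v'"
  "pairing r (u - u') v = pairing r u v - pairing r u' v"
  "pairing r u (v - v') = pairing r u v - pairing r u v'"
  "pairing r (- u) v = - pairing r u v"
  "pairing r u (- v) = - pairing r u v"
  "pairing r (qscale c u) v = c * pairing r u v"
  "pairing r u (qscale c v) = c * pairing r u v"
  "pairing r 0 v = 0"
  "pairing r u 0 = 0"
  by (simp_all add: pairing_def qscale_def algebra_simps sum.distrib sum_subtractf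
      sum_negf sum_distrib_left)

lemma pairing_sum_right: "pairing r u (\<Sum>a\<in>A. f a) = (\<Sum>a\<in>A. pairing r u (f a))"
  by (induction A rule: infinite_finite_induct)
    (simp_all only: pairing_simps sum.infinite sum.empty sum.insert if_False simp_thms)

lemma subspace_qspace: "qv.subspace (qspace r)"
  by (rule qv.subspaceI) (auto simp: qspace_def qscale_def)

lemma lattice_pts_subset_qspace: "lattice_pts r \<subseteq> qspace r"
  by (auto simp: lattice_pts_def)

text \<open>Neither zero coefficients nor the empty sum: 0 lies in this hull exactly if the vectors
  satisfy a nontrivial relation with nonnegative coefficients, which is the obstruction in Gordan's
  alternative.\<close>

inductive_set pos_hull :: "qvec set \<Rightarrow> qvec set" for T where
  base: "t \<in> T \<Longrightarrow> t \<in> pos_hull T"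
| add: "x \<in> pos_hull T \<Longrightarrow> y \<in> pos_hull T \<Longrightarrow> x + y \<in> pos_hull T"
| scale: "x \<in> pos_hull T \<Longrightarrow> c > 0 \<Longrightarrow> qscale c x \<in> pos_hull T"

lemma pos_hull_minimal:
  assumes "S \<subseteq> pos_hull T" shows "pos_hull S \<subseteq> pos_hull T"
proof
  fix x assume "x \<in> pos_hull S"
  then show "x \<in> pos_hull T"
    using assms by induction (auto intro: pos_hull.intros)
qed

text \<open>The rationals are dense and unbounded. Empty sides have to be allowed, since all last
  coordinates in the elimination may have the same sign.\<close>

lemma finite_sets_separated:
  fixes A B :: "rat set"
  assumes fin: "finite A" "finite B" and lt: "\<And>a b. a \<in> A \<Longrightarrow> b \<in> B \<Longrightarrow> a < b"
  shows "\<exists>x. (\<forall>a\<in>A. a < x) \<and> (\<forall>b\<in>B. x < b)"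
proof (cases "A = {} \<or> B = {}")
  case True
  then show ?thesis
  proof
    assume "A = {}"
    have "\<forall>b\<in>B. Min (insert 0 B) - 1 < b"
    proof
      fix b assume "b \<in> B"
      then have "Min (insert 0 B) \<le> b" using fin by (intro Min_le) auto
      then show "Min (insert 0 B) - 1 < b" by linarith
    qed
    then show ?thesis using \<open>A = {}\<close> by blast
  next
    assume "B = {}"
    have "\<forall>a\<in>A. a < Max (insert 0 A) + 1"
    proof
      fix a assume "a \<in> A"
      then have "a \<le> Max (insert 0 A)" using fin by (intro Max_ge) auto
      then show "a < Max (insert 0 A) + 1" by linarith
    qed
    then show ?thesis using \<open>B = {}\<close> by blast
  qed
next
  case False
  then have "Max A < Min B" using fin lt by (simp add: Max_in Min_in)
  then obtain x where "Max A < x" "x < Min B" using dense by blast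
  then show ?thesis using False fin by auto
qed

text \<open>Gordan's alternative, by Fourier--Motzkin elimination of the last coordinate: the vectors
  combining a positive with a negative last coordinate stay in the cone generated by \<open>T\<close>.\<close>

lemma gordan:
  assumes "finite T" "T \<subseteq> qspace r" "0 \<notin> pos_hull T"
  shows "\<exists>u\<in>qspace r. \<forall>t\<in>T. pairing r u t > 0"
  using assms
proof (induction r arbitrary: T)
  case 0
  then have "t = 0" if "t \<in> T" for t using that by (auto simp: qspace_def fun_eq_iff)
  then have "T = {}" using 0(3) pos_hull.base by blast
  then show ?case by (intro bexI[of _ 0]) (auto simp: qspace_def)
next
  case (Suc r)
  \<comment> \<open>For \<open>t\<close> in \<open>P\<close> and \<open>s\<close> in
    \<open>N\<close> both coefficients are positive, and coordinate \<open>r\<close>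
    cancels.\<close>
  define comb where "comb = (\<lambda>(t :: qvec, s :: qvec). qscale (t r) s + qscale (- s r) t)"
  define P N Z where "P = {t \<in> T. t r > 0}" and "N = {t \<in> T. t r < 0}" and "Z = {t \<in> T. t r = 0}"
  define T' where "T' = Z \<union> comb ` (P \<times> N)"
  have "comb (t, s) \<in> pos_hull T" if "t \<in> P" "s \<in> N" for t s
    unfolding comb_def prod.case
    by (intro pos_hull.add pos_hull.scale pos_hull.base) (use that in \<open>auto simp: P_def N_def\<close>)
  then have "T' \<subseteq> pos_hull T"
    by (auto simp: T'_def Z_def intro: pos_hull.base)
  then have "0 \<notin> pos_hull T'" using pos_hull_minimal Suc.prems(3) by blast
  moreover have "finite T'" using Suc.prems(1) by (auto simp: T'_def P_def N_def Z_def)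
  moreover have "T' \<subseteq> qspace r"
  proof
    fix t assume t: "t \<in> T'"
    then have "t r = 0" by (auto simp: T'_def Z_def comb_def qscale_def)
    moreover have "pos_hull T \<subseteq> qspace (Suc r)"
    proof
      fix x assume "x \<in> pos_hull T"
      then show "x \<in> qspace (Suc r)"
      proof induction
        case (base t)
        then show ?case using Suc.prems(2) by blast
      next
        case (add x y)
        show ?case by (rule qv.subspace_add[OF subspace_qspace add.IH])
      next
        case (scale x c)
        show ?case by (rule qv.subspace_scale[OF subspace_qspace scale.IH])
      qed
    qed
    then have "t \<in> qspace (Suc r)" using t \<open>T' \<subseteq> pos_hull T\<close> by blast
    ultimately have "t i = 0" if "i \<ge> r" for i
      using that unfolding qspace_def by (cases "i = r") auto
    then show "t \<in> qspace r" by (simp add: qspace_def)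
  qed
  ultimately obtain u where u: "u \<in> qspace r" "\<And>t. t \<in> T' \<Longrightarrow> pairing r u t > 0"
    using Suc.IH[of T'] by blast
  \<comment> \<open>\<open>h t\<close> is the value of the new coordinate at which the pairing with
    \<open>t\<close> vanishes: a lower bound for \<open>t\<close> in \<open>P\<close>, an upper
    bound for \<open>t\<close> in \<open>N\<close>. Positivity on \<open>comb (t, s)\<close> says
    that these bounds are compatible.\<close>
  define h where "h = (\<lambda>t. - pairing r u t / t r)"
  have "\<exists>x. (\<forall>a\<in>h ` P. a < x) \<and> (\<forall>b\<in>h ` N. x < b)"
  proof (rule finite_sets_separated)
    show "finite (h ` P)" "finite (h ` N)" using Suc.prems(1) by (auto simp: P_def N_def)
    fix a b assume "a \<in> h ` P" "b \<in> h ` N"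
    then obtain t s where ts: "t \<in> P" "s \<in> N" "a = h t" "b = h s" by auto
    then have "comb (t, s) \<in> T'" by (auto simp: T'_def)
    then have "t r * pairing r u s - s r * pairing r u t > 0"
      using u(2) by (force simp: comb_def pairing_simps)
    then have "- pairing r u s * t r < - pairing r u t * s r" by (simp add: mult.commute)
    then have "- pairing r u t < - pairing r u s * t r / s r"
      using ts by (subst neg_less_divide_eq) (auto simp: N_def)
    then have "- pairing r u t / t r < - pairing r u s / s r"
      using ts by (subst pos_divide_less_eq) (auto simp: P_def)
    then show "a < b" using ts by (simp add: h_def)
  qed
  then obtain x where "\<forall>a\<in>h ` P. a < x" "\<forall>b\<in>h ` N. x < b" by (elim exE conjE)
  then have x: "\<And>t. t \<in> P \<Longrightarrow> h t < x" "\<And>t. t \<in> N \<Longrightarrow> x < h t" by simp_all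
  define u' where "u' = u(r := x)"
  have p: "pairing (Suc r) u' t = pairing r u t + x * t r" for t
    by (simp add: pairing_def u'_def)
  have "pairing (Suc r) u' t > 0" if t: "t \<in> T" for t
  proof -
    consider "t \<in> P" | "t \<in> N" | "t \<in> Z" using t linorder_less_linear[of "t r" 0] unfolding P_def N_def Z_def by blast
    then show ?thesis
    proof cases
      case 1
      then show ?thesis using x(1)[OF 1] by (simp add: p h_def P_def field_simps)
    next
      case 2
      then show ?thesis using x(2)[OF 2] by (simp add: p h_def N_def field_simps)
    next
      case 3
      then have "t \<in> T'" "t r = 0" by (auto simp: T'_def Z_def)
      then show ?thesis using u(2) by (simp add: p)
    qed
  qed
  moreover have "u' \<in> qspace (Suc r)" using u(1) by (auto simp: qspace_def u'_def)
  ultimately show ?case by blast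
qed

section \<open>Finitely generated cones and their one-dimensional faces\<close>

definition cone_of :: "qvec set \<Rightarrow> qvec set" where
  "cone_of S = {\<Sum>s\<in>S. qscale (c s) s | c. \<forall>s\<in>S. c s \<ge> 0}"

lemma cone_ofI: "(\<And>s. s \<in> S \<Longrightarrow> c s \<ge> 0) \<Longrightarrow> (\<Sum>s\<in>S. qscale (c s) s) \<in> cone_of S"
  by (auto simp: cone_of_def)

lemma cone_of_add: "x \<in> cone_of S \<Longrightarrow> y \<in> cone_of S \<Longrightarrow> x + y \<in> cone_of S"
proof -
  assume "x \<in> cone_of S" "y \<in> cone_of S"
  then obtain c d where "x = (\<Sum>s\<in>S. qscale (c s) s)" "y = (\<Sum>s\<in>S. qscale (d s) s)"
    "\<forall>s\<in>S. c s \<ge> 0" "\<forall>s\<in>S. d s \<ge> 0" by (auto simp: cone_of_def)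
  then have "x + y = (\<Sum>s\<in>S. qscale (c s + d s) s)" "\<forall>s\<in>S. c s + d s \<ge> 0"
    by (auto simp: qv.scale_left_distrib sum.distrib)
  then show ?thesis using cone_ofI[of S "\<lambda>s. c s + d s"] by simp
qed

lemma cone_of_scale: "x \<in> cone_of S \<Longrightarrow> c \<ge> 0 \<Longrightarrow> qscale c x \<in> cone_of S"
proof -
  assume "x \<in> cone_of S" "c \<ge> 0"
  then obtain d where "x = (\<Sum>s\<in>S. qscale (d s) s)" "\<forall>s\<in>S. d s \<ge> 0" by (auto simp: cone_of_def)
  then show ?thesis using cone_ofI[of S "\<lambda>s. c * d s"] \<open>c \<ge> 0\<close>
    by (simp add: qv.scale_sum_right)
qed

lemma cone_of_0: "0 \<in> cone_of S"
  using cone_ofI[of S "\<lambda>_. 0"] by simp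

lemma cone_of_base: "finite S \<Longrightarrow> s \<in> S \<Longrightarrow> s \<in> cone_of S"
  using cone_ofI[of S "\<lambda>t. if t = s then 1 else 0"]
  by (simp add: if_distrib[of "\<lambda>c. qscale c _"] cong: if_cong)

lemma cone_of_minimal:
  assumes "S \<subseteq> cone_of T" shows "cone_of S \<subseteq> cone_of T"
proof
  fix x assume "x \<in> cone_of S"
  then obtain c where x: "x = (\<Sum>s\<in>S. qscale (c s) s)" and c: "\<forall>s\<in>S. c s \<ge> 0"
    by (auto simp: cone_of_def)
  have "(\<Sum>s\<in>S'. qscale (c s) s) \<in> cone_of T" if "S' \<subseteq> S" for S'
    using that by (induction S' rule: infinite_finite_induct)
      (use assms c in \<open>auto intro!: cone_of_0 cone_of_add cone_of_scale\<close>)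
  then show "x \<in> cone_of T" using x by blast
qed

lemma pos_hull_subset_cone_of: "finite S \<Longrightarrow> pos_hull S \<subseteq> cone_of S"
proof
  fix x assume "finite S" "x \<in> pos_hull S"
  from this(2,1) show "x \<in> cone_of S"
    by induction (auto intro: cone_of_base cone_of_add cone_of_scale)
qed

text \<open>A generating set of least cardinality works, as a generator in the cone of the others
  could be dropped.\<close>

lemma minimal_generators:
  assumes "rational_cone r \<sigma>"
  obtains S where "finite S" "S \<subseteq> lattice_pts r" "\<sigma> = cone_of S"
    "\<And>s. s \<in> S \<Longrightarrow> s \<notin> cone_of (S - {s})"
proof -
  define Q where "Q = (\<lambda>S. finite S \<and> S \<subseteq> lattice_pts r \<and> \<sigma> = cone_of S)"
  have "\<exists>S. Q S" using assms unfolding rational_cone_def cone_of_def Q_def by blast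
  then obtain S where S: "Q S" "\<And>S'. Q S' \<Longrightarrow> card S \<le> card S'"
    using ex_has_least_nat[of Q _ card] by blast
  have fin: "finite S" using S(1) by (simp add: Q_def)
  have "s \<notin> cone_of (S - {s})" if "s \<in> S" for s
  proof
    assume s: "s \<in> cone_of (S - {s})"
    have "S \<subseteq> cone_of (S - {s})" "S - {s} \<subseteq> cone_of S"
      using s fin cone_of_base[of "S - {s}"] cone_of_base[of S] by blast+
    then have "cone_of S = cone_of (S - {s})"
      using cone_of_minimal by (metis subset_antisym)
    then have "Q (S - {s})" using S(1) by (auto simp: Q_def)
    then have "card S \<le> card (S - {s})" using S(2) by blast
    then show False using that fin card_Diff1_less by (metis not_le)
  qed
  then show thesis using that S(1) by (auto simp: Q_def)
qed

text \<open>
  A minimal generator spans an exposed ray: apply Gordan's alternative to the other generators,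
  projected along \<open>s\<close>.
\<close>

lemma minimal_generator_face:
  assumes fin: "finite S" and S: "S \<subseteq> qspace r" and sc: "strongly_convex (cone_of S)"
    and s: "s \<in> S" and min: "\<And>s. s \<in> S \<Longrightarrow> s \<notin> cone_of (S - {s})"
  shows "cone_face r {qscale c s | c. c \<ge> 0} (cone_of S)"
proof -
  have nz: "0 \<notin> S" using min[of 0] cone_of_0 by blast
  then have "s \<noteq> 0" using s by auto
  then obtain i where i: "s i \<noteq> 0" by (auto simp: fun_eq_iff)
  have "s \<in> qspace r" using s S by blast
  then have ir: "i < r" using i unfolding qspace_def by (metis (mono_tags) mem_Collect_eq not_less)
  \<comment> \<open>Projection along \<open>s\<close> onto the vectors whose coordinate
    \<open>i\<close> vanishes.\<close>
  define pr where "pr = (\<lambda>t :: qvec. t - qscale (t i / s i) s)"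
  define R where "R = S - {s}"
  have pri: "pr t i = 0" for t using i by (simp add: pr_def qscale_def)
  have RS: "cone_of R \<subseteq> cone_of S"
    using cone_of_base[OF fin] by (intro cone_of_minimal) (auto simp: R_def)
  have pos0: "0 \<notin> pos_hull R"
  proof
    \<comment> \<open>One generator with a positive coefficient is split off. If the sum were 0, the
      cone would contain a positive multiple of \<open>t\<close> and its negative, against strong
      convexity.\<close>
    have *: "\<exists>t y. t \<in> R \<and> y \<in> cone_of S \<and> (\<exists>c>0. x = qscale c t + y)" if "x \<in> pos_hull R" for x
      using that
    proof induction
      case (base t)
      have "t = qscale 1 t + 0" by simp
      then show ?case using base cone_of_0[of S] zero_less_one by blast
    next
      case (add x y)
      then obtain t z c where "t \<in> R" "z \<in> cone_of S" "c > 0" "x = qscale c t + z" by blast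
      moreover have "y \<in> cone_of S"
        using add.hyps pos_hull_subset_cone_of[of R] fin RS by (auto simp: R_def)
      moreover have "x + y = qscale c t + (z + y)" using \<open>x = qscale c t + z\<close> by (simp only: add.assoc)
      ultimately show ?case using cone_of_add by blast
    next
      case (scale x c)
      then obtain t z d where "t \<in> R" "z \<in> cone_of S" "d > 0" "x = qscale d t + z" by blast
      moreover have "qscale c x = qscale (c * d) t + qscale c z"
        unfolding \<open>x = qscale d t + z\<close> by (simp only: qv.scale_right_distrib qv.scale_scale)
      ultimately show ?case using scale.hyps cone_of_scale[of z S c]
        by (metis less_imp_le mult_pos_pos)
    qed
    assume "0 \<in> pos_hull R"
    then obtain t y c where t: "t \<in> R" "y \<in> cone_of S" "c > 0" "0 = qscale c t + y"
      using * by blast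
    have "qscale c t \<in> cone_of S"
      using t fin by (intro cone_of_scale cone_of_base) (auto simp: R_def)
    moreover have "- qscale c t = y" using t(4) by (metis add_eq_0_iff add.inverse_inverse)
    ultimately have "qscale c t = 0" using sc t(2) unfolding strongly_convex_def by metis
    then show False using t nz by (auto simp: R_def)
  qed
  have "0 \<notin> pos_hull (pr ` R)"
  proof
    \<comment> \<open>Lifted back, a vanishing combination of projections reads
      \<open>y + a s = 0\<close>. For \<open>a\<close> nonnegative this contradicts strong
      convexity, for negative \<open>a\<close> it puts \<open>s\<close> into the cone of the other
      generators.\<close>
    have *: "\<exists>y\<in>pos_hull R. \<exists>a. x = y + qscale a s" if "x \<in> pos_hull (pr ` R)" for x
      using that
    proof induction
      case (base t)
      then obtain t' where t': "t' \<in> R" "t = pr t'" by auto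
      have "pr t' = t' + qscale (- (t' i / s i)) s" unfolding pr_def qv.scale_minus_left by simp
      then show ?case using pos_hull.base[OF t'(1)] t'(2) by blast
    next
      case (add x x')
      then obtain y y' a a' where "y \<in> pos_hull R" "y' \<in> pos_hull R" "x = y + qscale a s"
        "x' = y' + qscale a' s" by blast
      moreover from this have "x + x' = (y + y') + qscale (a + a') s"
        by (simp only: qv.scale_left_distrib ac_simps)
      ultimately show ?case using pos_hull.add by blast
    next
      case (scale x c)
      then obtain y a where "y \<in> pos_hull R" "x = y + qscale a s" by blast
      moreover from this have "qscale c x = qscale c y + qscale (c * a) s"
        by (simp only: qv.scale_right_distrib qv.scale_scale)
      ultimately show ?case using pos_hull.scale[OF _ scale.hyps(2)] by blast
    qed
    assume "0 \<in> pos_hull (pr ` R)"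
    then obtain y a where y: "y \<in> pos_hull R" "0 = y + qscale a s" using * by blast
    have yR: "y \<in> cone_of R" using y(1) pos_hull_subset_cone_of fin by (auto simp: R_def)
    show False
    proof (cases "a \<ge> 0")
      case True
      have "y \<in> cone_of S" using yR RS by blast
      moreover have "- y = qscale a s" using y(2) by (metis add_eq_0_iff add.inverse_inverse)
      moreover have "qscale a s \<in> cone_of S" using True s fin by (intro cone_of_scale cone_of_base)
      ultimately have "y = 0" using sc unfolding strongly_convex_def by metis
      then show False using y(1) pos0 by simp
    next
      case False
      have "qscale (- a) s = y" using y(2) by (metis add_eq_0_iff add.inverse_inverse qv.scale_minus_left)
      then have "qscale (1 / - a) y = qscale (1 / - a) (qscale (- a) s)" by simp
      also have "\<dots> = s" using False by simp
      finally have "s = qscale (1 / - a) y" by simp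
      moreover have "qscale (1 / - a) y \<in> cone_of R" using False yR by (intro cone_of_scale) auto
      ultimately have "s \<in> cone_of R" by simp
      then show False using min s by (simp add: R_def)
    qed
  qed
  moreover have "pr ` R \<subseteq> qspace r"
    using S s by (auto simp: R_def pr_def intro!: qv.subspace_diff[OF subspace_qspace]
        qv.subspace_scale[OF subspace_qspace])
  ultimately obtain u where u: "u \<in> qspace r" "\<And>t. t \<in> R \<Longrightarrow> pairing r u (pr t) > 0"
    using gordan[of "pr ` R" r] fin by (auto simp: R_def)
  \<comment> \<open>Correcting coordinate \<open>i\<close> makes \<open>s\<close> pair to 0 and does
    not affect projected vectors, whose coordinate \<open>i\<close> is 0.\<close>
  define c where "c = pairing r u s / s i"
  define u' where "u' = u(i := u i - c)"
  have pu: "pairing r u' v = pairing r u v - c * v i" for v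
  proof -
    have "pairing r u' v = (\<Sum>j<r. u j * v j - (if j = i then c * v i else 0))"
      unfolding pairing_def u'_def by (intro sum.cong) (auto simp: algebra_simps)
    also have "\<dots> = pairing r u v - c * v i"
      using ir by (simp add: sum_subtractf pairing_def)
    finally show ?thesis .
  qed
  have us: "pairing r u' s = 0" using i by (simp add: pu c_def)
  have uR: "pairing r u' t > 0" if "t \<in> R" for t
  proof -
    have "pairing r u' (pr t) > 0" using u(2)[OF that] by (simp add: pu pri)
    then show ?thesis by (simp add: pr_def pairing_simps us)
  qed
  have split: "\<exists>c. c s \<ge> 0 \<and> (\<forall>t\<in>R. c t \<ge> 0) \<and> v = qscale (c s) s + (\<Sum>t\<in>R. qscale (c t) t)
      \<and> pairing r u' v = (\<Sum>t\<in>R. c t * pairing r u' t)" if "v \<in> cone_of S" for v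
  proof -
    obtain c where c: "v = (\<Sum>t\<in>S. qscale (c t) t)" "\<forall>t\<in>S. c t \<ge> 0"
      using \<open>v \<in> cone_of S\<close> by (auto simp: cone_of_def)
    have v: "v = qscale (c s) s + (\<Sum>t\<in>R. qscale (c t) t)"
      using c(1) fin s by (simp add: R_def sum.remove)
    then have "pairing r u' v = (\<Sum>t\<in>R. c t * pairing r u' t)"
      by (simp add: pairing_simps pairing_sum_right us)
    then show ?thesis using c(2) s v by (auto simp: R_def)
  qed
  show ?thesis unfolding cone_face_def
  proof (intro bexI[of _ u'] conjI ballI)
    show "u' \<in> qspace r" using u(1) ir by (auto simp: qspace_def u'_def)
    show "pairing r u' v \<ge> 0" if v: "v \<in> cone_of S" for v
    proof -
      obtain c where "\<forall>t\<in>R. c t \<ge> 0" "pairing r u' v = (\<Sum>t\<in>R. c t * pairing r u' t)"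
        using split[OF v] by blast
      then show ?thesis using uR by (simp add: sum_nonneg less_imp_le)
    qed
    show "{qscale c s |c. 0 \<le> c} = {v \<in> cone_of S. pairing r u' v = 0}"
    proof (intro set_eqI iffI)
      fix v assume "v \<in> {qscale c s |c. 0 \<le> c}"
      then obtain c where "v = qscale c s" "c \<ge> 0" by blast
      then show "v \<in> {v \<in> cone_of S. pairing r u' v = 0}"
        using cone_of_scale[OF cone_of_base[OF fin s]] by (simp add: pairing_simps us)
    next
      fix v assume "v \<in> {v \<in> cone_of S. pairing r u' v = 0}"
      then have v: "v \<in> cone_of S" "pairing r u' v = 0" by auto
      then obtain c where c: "c s \<ge> 0" "\<forall>t\<in>R. c t \<ge> 0"
        "v = qscale (c s) s + (\<Sum>t\<in>R. qscale (c t) t)" "(\<Sum>t\<in>R. c t * pairing r u' t) = 0"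
        using split[OF v(1)] by auto
      have "finite R" using fin by (simp add: R_def)
      moreover have "c t * pairing r u' t \<ge> 0" if "t \<in> R" for t
        using c(2) uR that by (simp add: less_imp_le)
      ultimately have "\<forall>t\<in>R. c t * pairing r u' t = 0"
        using c(4) by (simp only: sum_nonneg_eq_0_iff)
      then have "\<forall>t\<in>R. c t = 0" using uR by fastforce
      then have "v = qscale (c s) s" using c(3) by simp
      then show "v \<in> {qscale c s |c. 0 \<le> c}" using c(1) by blast
    qed
  qed
qed

text \<open>A lattice point of the ray has an integral coordinate \<open>i\<close>, so it is
  \<open>k / |s i|\<close> times \<open>s\<close> for a natural number \<open>k\<close>. The least
  positive \<open>k\<close> gives the primitive vector, by division with remainder. Uniqueness is
  shown too because \<open>ray_gen\<close> is a definite description.\<close>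

lemma ray_gen_multiple:
  assumes s: "s \<in> lattice_pts r" "s \<noteq> 0"
  shows "\<exists>j::nat. s = qscale (of_nat j) (ray_gen r {qscale c s | c. c \<ge> 0})"
proof -
  define \<tau> where "\<tau> = {qscale c s | c. c \<ge> 0}"
  define Q where "Q = (\<lambda>v. v \<in> lattice_pts r \<and> \<tau> \<inter> lattice_pts r = {qscale (of_nat j) v | j :: nat. True})"
  obtain i where i: "s i \<noteq> 0" using s(2) by (auto simp: fun_eq_iff)
  have int: "s i \<in> \<int>" using s(1) by (simp add: lattice_pts_def)
  define K where "K = {k :: nat. k > 0 \<and> qscale (of_nat k / \<bar>s i\<bar>) s \<in> lattice_pts r}"
  have "\<bar>s i\<bar> \<in> \<int>" using int by simp
  then obtain m where m: "\<bar>s i\<bar> = of_int m" by (auto elim: Ints_cases)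
  then have "m > 0" using i by (metis of_int_0_less_iff zero_less_abs_iff)
  then have "nat m \<in> K" using s(1) m by (simp add: K_def)
  define k where "k = (LEAST k. k \<in> K)"
  have k: "k \<in> K" "\<And>k'. k' \<in> K \<Longrightarrow> k \<le> k'"
    using \<open>nat m \<in> K\<close> by (auto simp: k_def intro: LeastI Least_le)
  define v where "v = qscale (of_nat k / \<bar>s i\<bar>) s"
  have v: "v \<in> lattice_pts r" "k > 0" using k(1) by (auto simp: K_def v_def)
  have lat: "qscale (of_int a) x + qscale (of_int b) y \<in> lattice_pts r"
    if "x \<in> lattice_pts r" "y \<in> lattice_pts r" for x y a b
    using that by (auto simp: lattice_pts_def qspace_def qscale_def)
  have Qv: "Q v"
    unfolding Q_def
  proof (intro conjI v set_eqI iffI)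
    fix x assume "x \<in> \<tau> \<inter> lattice_pts r"
    then obtain c where c: "x = qscale c s" "c \<ge> 0" and x: "x \<in> lattice_pts r" by (auto simp: \<tau>_def)
    have "c * \<bar>s i\<bar> = \<bar>x i\<bar>" using c by (simp add: qscale_def abs_mult)
    also have "\<dots> \<in> \<int>" using x by (auto simp: lattice_pts_def)
    finally obtain n where n: "c * \<bar>s i\<bar> = of_int n" by (auto elim: Ints_cases)
    have n0: "n \<ge> 0" using c(2) n by (metis of_int_0_le_iff abs_ge_zero mult_nonneg_nonneg)
    define q where "q = nat n div k" 
    define t where "t = nat n mod k"
    have nt: "nat n = q * k + t" by (simp add: q_def t_def)
    have cn: "c = of_nat (nat n) / \<bar>s i\<bar>" using n i n0 by (simp add: field_simps)
    have "qscale (of_nat t / \<bar>s i\<bar>) s = qscale (of_int 1) x + qscale (of_int (- int q)) v"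
      unfolding c v_def cn nt by (simp add: fun_eq_iff qscale_def add_divide_distrib algebra_simps)
    then have "qscale (of_nat t / \<bar>s i\<bar>) s \<in> lattice_pts r" using lat[OF x v(1)] by metis
    moreover have "t < k" using v(2) by (simp add: t_def)
    ultimately have "\<not> t > 0" using k(2)[of t] by (auto simp: K_def)
    then have "x = qscale (of_nat q) v"
      unfolding c v_def cn nt by (simp add: fun_eq_iff qscale_def)
    then show "x \<in> {qscale (of_nat j) v | j :: nat. True}" by blast
  next
    fix x assume "x \<in> {qscale (of_nat j) v | j :: nat. True}"
    then obtain j :: nat where j: "x = qscale (of_nat j) v" by blast
    have "x \<in> lattice_pts r" using lat[OF v(1) v(1), of "int j" 0] j by simp
    moreover have "x = qscale (of_nat j * (of_nat k / \<bar>s i\<bar>)) s" by (simp add: j v_def)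
    then have "x \<in> \<tau>" unfolding \<tau>_def by (metis (mono_tags, lifting) mem_Collect_eq
        abs_ge_zero divide_nonneg_nonneg mult_nonneg_nonneg of_nat_0_le_iff)
    ultimately show "x \<in> \<tau> \<inter> lattice_pts r" by blast
  qed
  have sin: "s \<in> \<tau> \<inter> lattice_pts r"
    using s(1) unfolding \<tau>_def by (auto intro!: exI[of _ 1])
  have uniq: "v' = v" if "Q v'" for v'
  proof -
    have v0: "v \<noteq> 0"
    proof
      assume "v = 0"
      then have "\<tau> \<inter> lattice_pts r = {0}" using Qv by (auto simp: Q_def)
      then show False using sin s(2) by auto
    qed
    have "v' = qscale (of_nat 1) v'" "v = qscale (of_nat 1) v" by simp_all
    then have "v' \<in> \<tau> \<inter> lattice_pts r" "v \<in> \<tau> \<inter> lattice_pts r"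
      using that Qv unfolding Q_def by blast+
    then have "v' \<in> {qscale (of_nat j) v | j :: nat. True}" "v \<in> {qscale (of_nat j) v' | j :: nat. True}"
      using that Qv unfolding Q_def by simp_all
    then obtain j j' :: nat where j: "v' = qscale (of_nat j) v" "v = qscale (of_nat j') v'"
      by blast
    have "v = qscale (of_nat (j' * j)) v" using j by (metis of_nat_mult qv.scale_scale)
    then have "qscale (of_nat (j' * j)) v = qscale 1 v" by simp
    then have "(of_nat (j' * j) :: rat) = 1" using v0 by (metis qv.scale_cancel_right)
    then have "j' * j = 1" by (metis of_nat_eq_1_iff)
    then show ?thesis using j by simp
  qed
  have "ray_gen r \<tau> = v"
    unfolding ray_gen_def using Qv uniq by (intro the_equality) (auto simp: Q_def)
  then show ?thesis using Qv sin by (auto simp: Q_def \<tau>_def)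
qed

lemma dim_ray: "s \<noteq> 0 \<Longrightarrow> qv.dim {qscale c s | c. c \<ge> 0} = 1"
proof -
  assume s: "s \<noteq> 0"
  have "qv.dim {qscale c s | c. c \<ge> 0} = card {s}"
  proof (rule qv.basis_card_eq_dim[symmetric])
    have "s = qscale 1 s \<and> (1::rat) \<ge> 0" by simp
    then show "{s} \<subseteq> {qscale c s | c. c \<ge> 0}" by blast
    show "{qscale c s | c. c \<ge> 0} \<subseteq> qv.span {s}" by (auto simp: qv.span_singleton)
    show "qv.independent {s}" using s by simp
  qed
  then show ?thesis by simp
qed

text \<open>The property \<open>D\<close>, a bound linear in \<open>K\<close> and uniform in
  \<open>u\<close>, holds for ray generators and passes to nonnegative combinations. The minimal
  generators of a cone lie on faces of dimension one, which belong to the fan.\<close>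

lemma fan_bound_cone:
  assumes fan: "fan r \<Delta>" and \<sigma>: "\<sigma> \<in> \<Delta>" and x: "x \<in> \<sigma>"
  shows "\<exists>C\<ge>0. \<forall>u K. K \<ge> 0 \<longrightarrow> (\<forall>\<rho>\<in>rays \<Delta>. pairing r u (ray_gen r \<rho>) \<le> K) \<longrightarrow> pairing r u x \<le> K * C"
proof -
  define D where "D = (\<lambda>x. \<exists>C\<ge>0. \<forall>u K. K \<ge> 0 \<longrightarrow>
    (\<forall>\<rho>\<in>rays \<Delta>. pairing r u (ray_gen r \<rho>) \<le> K) \<longrightarrow> pairing r u x \<le> K * C)"
  have "rational_cone r \<sigma>" "strongly_convex \<sigma>" using fan \<sigma> by (auto simp: fan_def)
  then obtain S where S: "finite S" "S \<subseteq> lattice_pts r" "\<sigma> = cone_of S"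
    "\<And>s. s \<in> S \<Longrightarrow> s \<notin> cone_of (S - {s})" using minimal_generators by blast
  have nz: "0 \<notin> S" using S(4)[of 0] cone_of_0 by blast
  have D0: "D 0" by (auto simp: D_def pairing_simps intro!: exI[of _ 0])
  have Dadd: "D (x + y)" if "D x" "D y" for x y
  proof -
    obtain C C' where "C \<ge> 0" "C' \<ge> 0"
      "\<forall>u K. K \<ge> 0 \<longrightarrow> (\<forall>\<rho>\<in>rays \<Delta>. pairing r u (ray_gen r \<rho>) \<le> K) \<longrightarrow> pairing r u x \<le> K * C"
      "\<forall>u K. K \<ge> 0 \<longrightarrow> (\<forall>\<rho>\<in>rays \<Delta>. pairing r u (ray_gen r \<rho>) \<le> K) \<longrightarrow> pairing r u y \<le> K * C'"
      using \<open>D x\<close> \<open>D y\<close> unfolding D_def by blast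
    then show ?thesis unfolding D_def
      by (intro exI[of _ "C + C'"]) (auto simp: pairing_simps distrib_left intro!: add_mono)
  qed
  have Dscale: "D (qscale c x)" if "D x" "c \<ge> 0" for x c
  proof -
    obtain C where "C \<ge> 0"
      "\<forall>u K. K \<ge> 0 \<longrightarrow> (\<forall>\<rho>\<in>rays \<Delta>. pairing r u (ray_gen r \<rho>) \<le> K) \<longrightarrow> pairing r u x \<le> K * C"
      using \<open>D x\<close> unfolding D_def by blast
    then show ?thesis unfolding D_def using \<open>c \<ge> 0\<close>
      by (intro exI[of _ "c * C"]) (auto simp: pairing_simps mult.left_commute[of _ c] intro!: mult_left_mono)
  qed
  have DS: "D s" if s: "s \<in> S" for s
  proof -
    define \<tau> where "\<tau> = {qscale c s | c. c \<ge> 0}"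
    have "S \<subseteq> qspace r" using S(2) lattice_pts_subset_qspace by blast
    then have "cone_face r \<tau> \<sigma>"
      unfolding \<tau>_def S(3) using minimal_generator_face[OF S(1) _ _ s S(4)] \<open>strongly_convex \<sigma>\<close> S(3)
      by blast
    then have "\<tau> \<in> \<Delta>" using fan \<sigma> by (auto simp: fan_def)
    moreover have "s \<noteq> 0" using nz s by auto
    ultimately have \<tau>: "\<tau> \<in> rays \<Delta>" using dim_ray by (auto simp: rays_def \<tau>_def)
    obtain j :: nat where "s = qscale (of_nat j) (ray_gen r \<tau>)"
      using ray_gen_multiple[of s r] \<open>s \<noteq> 0\<close> s S(2) by (auto simp: \<tau>_def)
    moreover have "D (ray_gen r \<tau>)" unfolding D_def using \<tau> by (intro exI[of _ 1]) auto
    ultimately show ?thesis using Dscale[of "ray_gen r \<tau>" "of_nat j"] by simp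
  qed
  obtain c where xc: "x = (\<Sum>s\<in>S. qscale (c s) s)" and c: "\<forall>s\<in>S. c s \<ge> 0"
    using x S(3) by (auto simp: cone_of_def)
  have "D (\<Sum>s\<in>S'. qscale (c s) s)" if "S' \<subseteq> S" for S'
    using that by (induction S' rule: infinite_finite_induct) (use c DS in \<open>auto intro!: D0 Dadd Dscale\<close>)
  then have "D x" using xc by blast
  then show ?thesis unfolding D_def .
qed

text \<open>By completeness every unit vector and its negative lie in cones of the fan, so one-sided
  bounds on the rays bound each coordinate from both sides.\<close>

lemma complete_fan_bound:
  assumes fan: "fan r \<Delta>" and complete: "\<Union>\<Delta> = qspace r"
  shows "\<exists>C\<ge>0. \<forall>u K i. K \<ge> 0 \<longrightarrow> (\<forall>\<rho>\<in>rays \<Delta>. pairing r u (ray_gen r \<rho>) \<le> K) \<longrightarrow> i < r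
    \<longrightarrow> \<bar>u i\<bar> \<le> K * C"
proof -
  define b where "b = (\<lambda>(i :: nat) e j. if j = i then e else 0 :: rat)"
  have pb: "pairing r u (b i e) = u i * e" if "i < r" for u i e
    using that by (simp add: pairing_def b_def if_distrib cong: if_cong)
  have "\<exists>C\<ge>0. \<forall>u K. K \<ge> 0 \<longrightarrow> (\<forall>\<rho>\<in>rays \<Delta>. pairing r u (ray_gen r \<rho>) \<le> K) \<longrightarrow>
      pairing r u (b i e) \<le> K * C" if i: "i < r" for i e
  proof -
    have "b i e \<in> qspace r" using i by (auto simp: b_def qspace_def)
    then obtain \<sigma> where "\<sigma> \<in> \<Delta>" "b i e \<in> \<sigma>" using complete by blast
    then show ?thesis using fan_bound_cone[OF fan] by blast
  qed
  then obtain C where C: "\<And>i e. i < r \<Longrightarrow> C i e \<ge> 0" "\<And>i e u K. i < r \<Longrightarrow> K \<ge> 0 \<Longrightarrow>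
      (\<forall>\<rho>\<in>rays \<Delta>. pairing r u (ray_gen r \<rho>) \<le> K) \<Longrightarrow> pairing r u (b i e) \<le> K * C i e"
    by metis
  define C' where "C' = (\<Sum>i<r. C i 1 + C i (- 1))"
  have le: "C i 1 \<le> C'" "C i (- 1) \<le> C'" if "i < r" for i
  proof -
    have "C i 1 + C i (- 1) \<le> C'"
      unfolding C'_def using that C(1) by (intro member_le_sum) auto
    then show "C i 1 \<le> C'" "C i (- 1) \<le> C'" using C(1)[OF that, of 1] C(1)[OF that, of "-1"] by linarith+
  qed
  have "\<bar>u i\<bar> \<le> K * C'" if "K \<ge> 0" "\<forall>\<rho>\<in>rays \<Delta>. pairing r u (ray_gen r \<rho>) \<le> K" "i < r" for u K i
  proof -
    have "u i \<le> K * C i 1" "- u i \<le> K * C i (- 1)"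
      using C(2)[OF that(3,1,2), of 1] C(2)[OF that(3,1,2), of "-1"] pb[OF that(3)] by auto
    moreover have "K * C i 1 \<le> K * C'" "K * C i (- 1) \<le> K * C'"
      using le that by (auto intro: mult_left_mono)
    ultimately show ?thesis by linarith
  qed
  moreover have "C' \<ge> 0" unfolding C'_def using C(1) by (intro sum_nonneg) auto
  ultimately show ?thesis by blast
qed

section \<open>Sections of symmetric powers\<close>

lemma sscale_mult_left: "sscale c f * g = sscale c (f * g)"
  by (simp add: sscale_def mult_map_scale_conv_mult mult.assoc)

lemma sscale_mult_right: "f * sscale c g = sscale c (f * g)"
  by (simp add: sscale_def mult_map_scale_conv_mult mult.left_commute)

lemma span_mult:
  fixes A B C :: "'k::field symalg set"
  assumes AB: "\<And>a b. a \<in> A \<Longrightarrow> b \<in> B \<Longrightarrow> a * b \<in> sv.span C"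
    and x: "x \<in> sv.span A" and y: "y \<in> sv.span B"
  shows "x * y \<in> sv.span C"
  using x
proof (induction rule: sv.span_induct_alt)
  case (step c a x)
  have "a * y \<in> sv.span C"
    using y
  proof (induction rule: sv.span_induct_alt)
    case (step d b y)
    then show ?case using AB \<open>a \<in> A\<close>
      by (auto simp: distrib_left sscale_mult_right intro!: sv.span_add sv.span_scale)
  qed (simp add: sv.span_zero)
  then show ?case using step
    by (auto simp: distrib_right sscale_mult_left intro!: sv.span_add sv.span_scale)
qed (simp add: sv.span_zero)

lemma sum_lessThan_add: "(\<Sum>i<p + q. h i) = (\<Sum>i<p. h i) + (\<Sum>i<q. h (p + i))"
  for h :: "nat \<Rightarrow> 'a::comm_monoid_add"
  by (induction q) (simp_all add: add.assoc)

lemma prod_lessThan_add: "(\<Prod>i<p + q. h i) = (\<Prod>i<p. h i) * (\<Prod>i<q. h (p + i))"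
  for h :: "nat \<Rightarrow> 'a::comm_monoid_mult"
  by (induction q) (simp_all add: mult.assoc)

text \<open>Concatenating two lists of factors adds both their lengths and their filtration
  steps.\<close>

lemma sym_filt_mult:
  assumes "f \<in> sym_filt F p \<rho> i" "g \<in> sym_filt F q \<rho> j"
  shows "f * g \<in> sym_filt F (p + q) \<rho> (i + j)"
  unfolding sym_filt_def[of F "p + q"]
proof (rule span_mult[OF _ assms[unfolded sym_filt_def]])
  fix a b
  assume "a \<in> {\<Prod>i<p. e i |e js. sum js {..<p} = i \<and> (\<forall>i<p. e i \<in> F \<rho> (js i))}"
    and "b \<in> {\<Prod>i<q. e i |e js. sum js {..<q} = j \<and> (\<forall>i<q. e i \<in> F \<rho> (js i))}"
  then obtain e js e' js' where a: "a = (\<Prod>i<p. e i)" "sum js {..<p} = i" "\<And>i. i < p \<Longrightarrow> e i \<in> F \<rho> (js i)"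
    and b: "b = (\<Prod>i<q. e' i)" "sum js' {..<q} = j" "\<And>i. i < q \<Longrightarrow> e' i \<in> F \<rho> (js' i)"
    by blast
  define h where "h = (\<lambda>i. if i < p then e i else e' (i - p))"
  define k where "k = (\<lambda>i. if i < p then js i else js' (i - p))"
  have "prod h {..<p} = prod e {..<p}" "sum k {..<p} = sum js {..<p}"
    by (auto intro!: prod.cong sum.cong simp: h_def k_def)
  then have "a * b = (\<Prod>i<p + q. h i)" "sum k {..<p + q} = i + j"
    using a b by (simp_all add: prod_lessThan_add sum_lessThan_add h_def k_def)
  moreover have "h l \<in> F \<rho> (k l)" if "l < p + q" for l
    using that a(3)[of l] b(3)[of "l - p"] by (auto simp: h_def k_def)
  ultimately show "a * b \<in> sv.span {\<Prod>i<p + q. e i |e js. sum js {..<p + q} = i + j \<and> (\<forall>i<p + q. e i \<in> F \<rho> (js i))}"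
    by (intro sv.span_base) blast
qed

lemma sym_filt_one: "1 \<in> sym_filt F 0 \<rho> 0"
  unfolding sym_filt_def by (intro sv.span_base) simp

lemma sym_filt_power: "f \<in> sym_filt F p \<rho> j \<Longrightarrow> f ^ N \<in> sym_filt F (p * N) \<rho> (int N * j)"
proof (induction N)
  case 0
  then show ?case by (simp add: sym_filt_one)
next
  case (Suc N)
  then have "f * f ^ N \<in> sym_filt F (p + p * N) \<rho> (j + int N * j)" by (intro sym_filt_mult) auto
  then show ?case by (simp add: algebra_simps)
qed

text \<open>Pigeonhole: among p steps with sum above p J one exceeds J, and the factor at that step
  is 0.\<close>

lemma sym_filt_subset_0:
  assumes "\<And>i. i > int J \<Longrightarrow> F \<rho> i = {0 :: 'k::field symalg}" and j: "j > int (p * J)"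
  shows "sym_filt F p \<rho> j \<subseteq> {0}"
  unfolding sym_filt_def
proof (rule sv.span_minimal[OF _ sv.subspace_single_0], clarsimp)
  fix e :: "nat \<Rightarrow> 'k symalg" and js assume e: "j = sum js {..<p}" "\<forall>i<p. e i \<in> F \<rho> (js i)"
  have "\<exists>i<p. js i > int J"
  proof (rule ccontr)
    assume "\<not> (\<exists>i<p. js i > int J)"
    then have "sum js {..<p} \<le> (\<Sum>i<p. int J)" by (intro sum_mono) (metis lessThan_iff not_less)
    then show False using j e(1) by simp
  qed
  then obtain i where i: "i < p" "js i > int J" by blast
  then have "e i = 0" using e(2) assms(1)[OF i(2)] by auto
  then show "\<exists>i\<in>{..<p}. e i = 0" using i(1) by blast
qed

text \<open>Summing over the fixed range of variables instead of the support makes the degree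
  additive without any bookkeeping of supports.\<close>

definition is_mon :: "nat \<Rightarrow> nat \<Rightarrow> (nat \<Rightarrow>\<^sub>0 nat) \<Rightarrow> bool" where
  "is_mon n p m \<longleftrightarrow> (\<forall>i\<ge>n. Poly_Mapping.lookup m i = 0) \<and> (\<Sum>i<n. Poly_Mapping.lookup m i) = p"

lemma sym_pow_iff: "f \<in> sym_pow n p \<longleftrightarrow> (\<forall>m\<in>Poly_Mapping.keys f. is_mon n p m)"
proof -
  have "Poly_Mapping.keys m \<subseteq> {..<n} \<and> (\<Sum>i\<in>Poly_Mapping.keys m. Poly_Mapping.lookup m i) = p
    \<longleftrightarrow> is_mon n p m" for m
  proof (cases "Poly_Mapping.keys m \<subseteq> {..<n}")
    case True
    then have "(\<Sum>i\<in>Poly_Mapping.keys m. Poly_Mapping.lookup m i) = (\<Sum>i<n. Poly_Mapping.lookup m i)"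
      by (intro sum.mono_neutral_left) (auto simp: in_keys_iff)
    then show ?thesis using True by (auto simp: is_mon_def in_keys_iff subset_iff)
  next
    case False
    then show ?thesis by (auto simp: is_mon_def in_keys_iff subset_iff)
  qed
  then show ?thesis by (simp add: sym_pow_def)
qed

lemma is_mon_add: "is_mon n p m \<Longrightarrow> is_mon n q m' \<Longrightarrow> is_mon n (p + q) (m + m')"
  by (auto simp: is_mon_def lookup_add sum.distrib)

lemma subspace_sym_pow: "sv.subspace (sym_pow n p)"
proof (rule sv.subspaceI)
  show "0 \<in> sym_pow n p" by (simp add: sym_pow_iff)
  show "x + y \<in> sym_pow n p" if "x \<in> sym_pow n p" "y \<in> sym_pow n p" for x y :: "'a symalg"
    using that Poly_Mapping.keys_add[of x y] unfolding sym_pow_iff by blast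
  show "sscale c x \<in> sym_pow n p" if "x \<in> sym_pow n p" for c and x :: "'a symalg"
    using that by (auto simp: sym_pow_iff in_keys_iff lookup_sscale)
qed

lemma sym_pow_mult:
  "f \<in> sym_pow n p \<Longrightarrow> g \<in> sym_pow n q \<Longrightarrow> f * g \<in> sym_pow n (p + q)"
  using keys_mult[of f g] is_mon_add by (fastforce simp: sym_pow_iff)

lemma sym_pow_one: "1 \<in> sym_pow n 0"
  by (simp add: sym_pow_iff is_mon_def)

lemma mon_factors:
  assumes "is_mon n p m"
  shows "\<exists>e. (\<forall>i<p. e i \<in> sym_pow n 1) \<and> (Poly_Mapping.single m 1 :: 'k::field symalg) = (\<Prod>i<p. e i)"
  using assms
proof (induction p arbitrary: m)
  case 0
  then have "Poly_Mapping.lookup m i = 0" for i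
    by (cases "i < n") (auto simp: is_mon_def)
  then have "m = 0" by (intro poly_mapping_eqI) simp
  then show ?case by simp
next
  case (Suc p)
  have "\<not> (\<forall>i\<in>{..<n}. Poly_Mapping.lookup m i = 0)"
  proof
    assume "\<forall>i\<in>{..<n}. Poly_Mapping.lookup m i = 0"
    then have "(\<Sum>i<n. Poly_Mapping.lookup m i) = 0" by (rule sum.neutral)
    then show False using Suc.prems by (simp add: is_mon_def)
  qed
  then obtain i where i: "i < n" "Poly_Mapping.lookup m i \<noteq> 0" by blast
  define m' where "m' = m - Poly_Mapping.single i 1"
  have m: "m = m' + Poly_Mapping.single i 1"
    using i by (intro poly_mapping_eqI) (auto simp: m'_def lookup_add lookup_minus lookup_single when_def)
  have s: "is_mon n 1 (Poly_Mapping.single i 1)"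
    using i by (auto simp: is_mon_def lookup_single when_def)
  have "is_mon n p m'"
    using Suc.prems s by (auto simp: m is_mon_def lookup_add sum.distrib)
  then obtain e where e: "\<forall>i<p. e i \<in> sym_pow n 1"
    "(Poly_Mapping.single m' 1 :: 'k symalg) = (\<Prod>i<p. e i)" using Suc.IH by blast
  define e' where "e' = e(p := Poly_Mapping.single (Poly_Mapping.single i 1) 1)"
  have "(Poly_Mapping.single m 1 :: 'k symalg) =
      Poly_Mapping.single m' 1 * Poly_Mapping.single (Poly_Mapping.single i 1) 1"
    by (simp add: m mult_single)
  also have "\<dots> = (\<Prod>i<Suc p. e' i)" by (simp add: e'_def e(2))
  finally have "(Poly_Mapping.single m 1 :: 'k symalg) = (\<Prod>i<Suc p. e' i)" .
  moreover have "e' k \<in> sym_pow n 1" if "k < Suc p" for k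
  proof (cases "k = p")
    case True
    then show ?thesis using s by (simp add: e'_def sym_pow_iff)
  next
    case False
    then show ?thesis using that e(1) by (simp add: e'_def)
  qed
  ultimately show ?case by blast
qed

text \<open>A monomial of degree p is a product of p variables, all of them in
  \<open>F \<rho> j\<close>. This provides a step at which every form occurs, so that the maximum
  defining \<open>phi\<close> is taken over a nonempty set.\<close>

lemma sym_pow_subset_sym_filt:
  fixes f :: "'k::field symalg"
  assumes F: "F \<rho> j = sym_pow n 1" and f: "f \<in> sym_pow n p"
  shows "f \<in> sym_filt F p \<rho> (int p * j)"
proof -
  have "Poly_Mapping.single m 1 \<in> sym_filt F p \<rho> (int p * j)" if "m \<in> Poly_Mapping.keys f" for m
  proof -
    have "is_mon n p m" using f that by (simp add: sym_pow_iff)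
    then obtain e where "\<forall>i<p. e i \<in> sym_pow n 1" "(Poly_Mapping.single m 1 :: 'k symalg) = (\<Prod>i<p. e i)"
      using mon_factors by blast
    moreover have "(\<Sum>i<p. j) = int p * j" by simp
    ultimately show ?thesis unfolding sym_filt_def F[symmetric]
      by (intro sv.span_base CollectI exI[of _ e] exI[of _ "\<lambda>_. j"]) simp
  qed
  then have "(\<Sum>m\<in>Poly_Mapping.keys f. sscale (Poly_Mapping.lookup f m) (Poly_Mapping.single m 1))
      \<in> sym_filt F p \<rho> (int p * j)"
    unfolding sym_filt_def by (intro sv.span_sum sv.span_scale)
  moreover have "(\<Sum>m\<in>Poly_Mapping.keys f. sscale (Poly_Mapping.lookup f m) (Poly_Mapping.single m 1)) = f"
    by (rule poly_mapping_eqI)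
      (simp add: lookup_sum lookup_sscale lookup_single when_def in_keys_iff if_distrib cong: if_cong)
  ultimately show ?thesis by simp
qed

text \<open>Counting down from the bound \<open>b\<close> turns the greatest integer into a least
  natural number.\<close>

lemma Greatest_int_bounded:
  fixes P :: "int \<Rightarrow> bool"
  assumes "P j0" and bd: "\<And>j. P j \<Longrightarrow> j \<le> b"
  shows "P (GREATEST j. P j)" and "\<And>j. P j \<Longrightarrow> j \<le> (GREATEST j. P j)"
proof -
  define k where "k = (LEAST k::nat. P (b - int k))"
  have "P (b - int (nat (b - j0)))" using assms by simp
  then have k: "P (b - int k)" unfolding k_def by (rule LeastI)
  have le: "j \<le> b - int k" if "P j" for j
  proof -
    have "P (b - int (nat (b - j)))" using that bd by simp
    then have "k \<le> nat (b - j)" unfolding k_def by (rule Least_le)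
    then show ?thesis using bd[OF that] by linarith
  qed
  have "(GREATEST j. P j) = b - int k" using k le by (intro Greatest_equality)
  then show "P (GREATEST j. P j)" "\<And>j. P j \<Longrightarrow> j \<le> (GREATEST j. P j)" using k le by auto
qed

locale toric =
  fixes r n :: nat and \<Delta> :: "qvec set set" and F :: "'k::field filts"
  assumes fan: "fan r \<Delta>" and complete: "\<Union>\<Delta> = qspace r"
    and klyachko: "toric_bundle r \<Delta> (sym_pow n 1) F"
begin

text \<open>\<open>u\<close> may be any rational point of the polytope, since \<open>L\<close> is
  spanned by differences of rational points. For a lattice point it says that \<open>f\<close> at
  the exponent \<open>- u\<close> is a nonzero section.\<close>

definition in_sec :: "nat \<Rightarrow> qvec \<Rightarrow> 'k symalg \<Rightarrow> bool" where
  "in_sec p u f \<longleftrightarrow> f \<in> sym_pow n p \<and> f \<noteq> 0 \<and> u \<in> polytope_of r \<Delta> (sym_filt F p) f"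

text \<open>For a lattice point \<open>u\<close> this is the graded piece of the sections at the
  exponent \<open>- u\<close>. Taking the span spares a proof that such forms are closed under
  addition.\<close>

definition sec :: "nat \<Rightarrow> qvec \<Rightarrow> 'k symalg set" where
  "sec p u = sv.span {f. in_sec p u f}"

definition weights :: "nat \<Rightarrow> (qvec \<times> (nat \<Rightarrow>\<^sub>0 nat)) set" where
  "weights p = {(u, lead_mon g) | u g. u \<in> lattice_pts r \<and> g \<in> sec p u - {0}}"

lemma in_sec_imp_sec:
  assumes "in_sec p u f" shows "f \<in> sec p u"
  unfolding sec_def by (rule sv.span_base) (rule CollectI, rule assms)

lemma finite_rays: "finite (rays \<Delta>)"
  using fan by (auto simp: fan_def rays_def)

lemma filt_bot: "\<rho> \<in> rays \<Delta> \<Longrightarrow> \<exists>j. F \<rho> j = sym_pow n 1"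
proof -
  assume "\<rho> \<in> rays \<Delta>"
  note conjunct1[OF klyachko[unfolded toric_bundle_def], THEN bspec, OF this]
  then have "\<forall>\<^sub>F j in at_bot. F \<rho> j = sym_pow n 1" by (elim conjE)
  then obtain N where "\<forall>j\<le>N. F \<rho> j = sym_pow n 1" unfolding eventually_at_bot_linorder ..
  then show ?thesis by blast
qed

lemma filt_top: "\<exists>J :: nat. \<forall>\<rho>\<in>rays \<Delta>. \<forall>j>int J. F \<rho> j = {0}"
proof -
  have "\<exists>N. \<forall>j\<ge>N. F \<rho> j = {0}" if "\<rho> \<in> rays \<Delta>" for \<rho>
  proof -
    note conjunct1[OF klyachko[unfolded toric_bundle_def], THEN bspec, OF that]
    then have "\<forall>\<^sub>F j in at_top. F \<rho> j = {0}" by (elim conjE)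
    then show ?thesis unfolding eventually_at_top_linorder .
  qed
  then obtain N where N: "\<And>\<rho> j. \<rho> \<in> rays \<Delta> \<Longrightarrow> j \<ge> N \<rho> \<Longrightarrow> F \<rho> j = {0}" by metis
  define J where "J = Max (insert 0 ((\<lambda>\<rho>. nat (N \<rho>)) ` rays \<Delta>))"
  have "nat (N \<rho>) \<le> J" if "\<rho> \<in> rays \<Delta>" for \<rho>
    unfolding J_def using finite_rays that by (intro Max_ge) auto
  then have "F \<rho> j = {0}" if "\<rho> \<in> rays \<Delta>" "j > int J" for \<rho> j
    using that N[of \<rho> j] by fastforce
  then show ?thesis by blast
qed

text \<open>Makes the maximum behind \<open>phi\<close> genuine: the filtration is everything at a
  low step and zero on all high ones.\<close>

lemma phi_props:
  assumes \<rho>: "\<rho> \<in> rays \<Delta>" and f: "f \<in> sym_pow n p" "f \<noteq> 0"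
  shows "f \<in> sym_filt F p \<rho> (phi (sym_filt F p) f \<rho>)"
    and "f \<in> sym_filt F p \<rho> j \<Longrightarrow> j \<le> phi (sym_filt F p) f \<rho>"
proof -
  obtain j0 where "F \<rho> j0 = sym_pow n 1" using filt_bot \<rho> by blast
  then have 0: "f \<in> sym_filt F p \<rho> (int p * j0)" using f sym_pow_subset_sym_filt by blast
  obtain J :: nat where J: "\<And>\<rho> j. \<rho> \<in> rays \<Delta> \<Longrightarrow> j > int J \<Longrightarrow> F \<rho> j = {0}"
    using filt_top by blast
  have 1: "j \<le> int (p * J)" if "f \<in> sym_filt F p \<rho> j" for j
    using sym_filt_subset_0[of J F \<rho> p j] J[OF \<rho>] that f(2) by force
  show "f \<in> sym_filt F p \<rho> (phi (sym_filt F p) f \<rho>)"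
    "f \<in> sym_filt F p \<rho> j \<Longrightarrow> j \<le> phi (sym_filt F p) f \<rho>"
    unfolding phi_def using Greatest_int_bounded[of "\<lambda>j. f \<in> sym_filt F p \<rho> j", OF 0 1] by blast+
qed

text \<open>For a form of degree p the value of \<open>phi\<close> is at most p J, and completeness
  turns this into a bound on \<open>u\<close>. The successor in the choice of \<open>K\<close> keeps
  it positive, so that p K also bounds the exponents of monomials of degree p.\<close>

lemma in_sec_bound:
  "\<exists>K::nat. K \<ge> 1 \<and> (\<forall>p u f i. in_sec p u f \<longrightarrow> i < r \<longrightarrow> \<bar>u i\<bar> \<le> of_nat (p * K))"
proof -
  obtain C where C0: "C \<ge> 0 \<and> (\<forall>u K i. K \<ge> 0 \<longrightarrow>
      (\<forall>\<rho>\<in>rays \<Delta>. pairing r u (ray_gen r \<rho>) \<le> K) \<longrightarrow> i < r \<longrightarrow> \<bar>u i\<bar> \<le> K * C)"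
    using complete_fan_bound[OF fan complete] by (elim exE)
  then have C: "C \<ge> 0" "\<And>u K i. K \<ge> 0 \<Longrightarrow> (\<forall>\<rho>\<in>rays \<Delta>. pairing r u (ray_gen r \<rho>) \<le> K) \<Longrightarrow> i < r
    \<Longrightarrow> \<bar>u i\<bar> \<le> K * C" by simp_all
  obtain J :: nat where J: "\<And>\<rho> j. \<rho> \<in> rays \<Delta> \<Longrightarrow> j > int J \<Longrightarrow> F \<rho> j = {0}"
    using filt_top by blast
  define K where "K = Suc (J * nat \<lceil>C\<rceil>)"
  have "\<bar>u i\<bar> \<le> of_nat (p * K)" if s: "in_sec p u f" and i: "i < r" for p u f i
  proof -
    have "pairing r u (ray_gen r \<rho>) \<le> of_nat (p * J)" if \<rho>: "\<rho> \<in> rays \<Delta>" for \<rho>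
    proof -
      have "f \<in> sym_filt F p \<rho> (phi (sym_filt F p) f \<rho>)"
        using phi_props(1)[OF \<rho>] s by (simp add: in_sec_def)
      then have "phi (sym_filt F p) f \<rho> \<le> int (p * J)"
        using sym_filt_subset_0[of J F \<rho> p "phi (sym_filt F p) f \<rho>"] J[OF \<rho>] s
        by (force simp: in_sec_def)
      then have "of_int (phi (sym_filt F p) f \<rho>) \<le> (of_int (int (p * J)) :: rat)"
        by (simp only: of_int_le_iff)
      moreover have "pairing r u (ray_gen r \<rho>) \<le> of_int (phi (sym_filt F p) f \<rho>)"
        using s \<rho> by (simp add: in_sec_def polytope_of_def)
      ultimately show ?thesis by simp
    qed
    then have "\<bar>u i\<bar> \<le> of_nat (p * J) * C" using C(2)[of "of_nat (p * J)"] i by simp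
    also have "\<dots> \<le> of_nat (p * J) * of_nat (nat \<lceil>C\<rceil>)"
      using C(1) by (intro mult_left_mono) auto
    also have "\<dots> \<le> of_nat (p * K)"
      unfolding K_def of_nat_mult[symmetric] of_nat_le_iff by simp
    finally show ?thesis .
  qed
  moreover have "K \<ge> 1" by (simp add: K_def)
  ultimately show ?thesis by blast
qed

text \<open>The power has \<open>phi\<close> at least N times as large, and for positive N the point
  is N times a point of the segment from \<open>u\<close> to \<open>u'\<close>. Full segments are
  what later make up a box; \<open>t = 0\<close> is plain dilation.\<close>

lemma in_sec_power:
  assumes s: "in_sec p u f" "in_sec p u' f" and t: "0 \<le> t" "t \<le> of_nat N"
  shows "in_sec (p * N) (qscale (of_nat N - t) u + qscale t u') (f ^ N)"
proof -
  have f: "f \<in> sym_pow n p" "f \<noteq> 0" using s by (auto simp: in_sec_def)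
  have fN: "f ^ N \<in> sym_pow n (p * N)"
  proof (induction N)
    case (Suc N)
    then show ?case using sym_pow_mult[OF f(1)] by (fastforce simp: algebra_simps)
  qed (simp add: sym_pow_one)
  have "pairing r (qscale (of_nat N - t) u + qscale t u') (ray_gen r \<rho>)
      \<le> of_int (phi (sym_filt F (p * N)) (f ^ N) \<rho>)" if \<rho>: "\<rho> \<in> rays \<Delta>" for \<rho>
  proof -
    define \<phi> where "\<phi> = phi (sym_filt F p) f \<rho>"
    have "int N * \<phi> \<le> phi (sym_filt F (p * N)) (f ^ N) \<rho>"
      using phi_props(2)[OF \<rho> fN] sym_filt_power[OF phi_props(1)[OF \<rho> f]] f by (simp add: \<phi>_def)
    then have le: "of_int (int N * \<phi>) \<le> (of_int (phi (sym_filt F (p * N)) (f ^ N) \<rho>) :: rat)"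
      by (simp only: of_int_le_iff)
    have "pairing r u (ray_gen r \<rho>) \<le> of_int \<phi>" "pairing r u' (ray_gen r \<rho>) \<le> of_int \<phi>"
      using s \<rho> by (auto simp: in_sec_def polytope_of_def \<phi>_def)
    then have "(of_nat N - t) * pairing r u (ray_gen r \<rho>) + t * pairing r u' (ray_gen r \<rho>)
      \<le> (of_nat N - t) * of_int \<phi> + t * of_int \<phi>"
      using t by (intro add_mono mult_left_mono) auto
    also have "\<dots> = of_int (int N * \<phi>)" by (simp add: algebra_simps)
    finally show ?thesis using le by (simp only: pairing_simps)
  qed
  moreover have "qscale (of_nat N - t) u + qscale t u' \<in> qspace r"
    using s subspace_qspace by (auto simp: in_sec_def polytope_of_def
        intro!: qv.subspace_add[OF subspace_qspace] qv.subspace_scale[OF subspace_qspace])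
  ultimately show ?thesis using fN f(2) by (auto simp: in_sec_def polytope_of_def)
qed

text \<open>As the filtrations multiply, \<open>phi\<close> is superadditive, so the Minkowski sum
  of two polytopes lies in the polytope of the product.\<close>

lemma in_sec_mult:
  assumes s: "in_sec p u f" "in_sec q u' g"
  shows "in_sec (p + q) (u + u') (f * g)"
proof -
  have f: "f \<in> sym_pow n p" "f \<noteq> 0" and g: "g \<in> sym_pow n q" "g \<noteq> 0"
    using s by (auto simp: in_sec_def)
  have fg: "f * g \<in> sym_pow n (p + q)" "f * g \<noteq> 0" using f g sym_pow_mult by auto
  have "pairing r (u + u') (ray_gen r \<rho>) \<le> of_int (phi (sym_filt F (p + q)) (f * g) \<rho>)"
    if \<rho>: "\<rho> \<in> rays \<Delta>" for \<rho>
  proof -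
    have "phi (sym_filt F p) f \<rho> + phi (sym_filt F q) g \<rho> \<le> phi (sym_filt F (p + q)) (f * g) \<rho>"
      using phi_props(2)[OF \<rho> fg] sym_filt_mult phi_props(1)[OF \<rho> f] phi_props(1)[OF \<rho> g] by blast
    then have "of_int (phi (sym_filt F p) f \<rho>) + of_int (phi (sym_filt F q) g \<rho>) \<le>
        (of_int (phi (sym_filt F (p + q)) (f * g) \<rho>) :: rat)"
      by (simp only: of_int_le_iff flip: of_int_add)
    moreover have "pairing r u (ray_gen r \<rho>) \<le> of_int (phi (sym_filt F p) f \<rho>)"
      "pairing r u' (ray_gen r \<rho>) \<le> of_int (phi (sym_filt F q) g \<rho>)"
      using s \<rho> by (auto simp: in_sec_def polytope_of_def)
    ultimately show ?thesis by (simp only: pairing_simps)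
  qed
  moreover have "u + u' \<in> qspace r"
    using s by (intro qv.subspace_add[OF subspace_qspace]) (auto simp: in_sec_def polytope_of_def)
  ultimately show ?thesis using fg by (auto simp: in_sec_def polytope_of_def)
qed

lemma in_sec_one: "in_sec 0 0 1"
proof -
  have "phi (sym_filt F 0) 1 \<rho> \<ge> 0" if "\<rho> \<in> rays \<Delta>" for \<rho>
    using phi_props(2)[OF that sym_pow_one[of n], of 0] sym_filt_one[of F \<rho>] by simp
  then show ?thesis
    by (auto simp: in_sec_def polytope_of_def sym_pow_one pairing_simps qspace_def)
qed

lemma in_sec_scale:
  assumes "in_sec p u f"
  shows "in_sec (p * N) (qscale (of_nat N) u) (f ^ N)"
  using in_sec_power[OF assms assms, of 0 N] by simp

lemma in_sec_prod:
  assumes "finite A" "\<And>a. a \<in> A \<Longrightarrow> in_sec (p a) (u a) (f a)"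
  shows "in_sec (\<Sum>a\<in>A. p a) (\<Sum>a\<in>A. u a) (\<Prod>a\<in>A. f a)"
  using assms
proof (induction A rule: finite_induct)
  case (insert a A)
  then have "in_sec (p a + (\<Sum>a\<in>A. p a)) (u a + (\<Sum>a\<in>A. u a)) (f a * (\<Prod>a\<in>A. f a))"
    by (intro in_sec_mult) auto
  then show ?case by (simp only: sum.insert[OF insert.hyps] prod.insert[OF insert.hyps])
qed (simp only: sum.empty prod.empty in_sec_one)

lemma sec_mult:
  assumes "g \<in> sec p u" "h \<in> sec q u'"
  shows "g * h \<in> sec (p + q) (u + u')"
  unfolding sec_def[of "p + q"]
proof (rule span_mult[OF _ assms[unfolded sec_def]])
  fix a b assume "a \<in> {f. in_sec p u f}" "b \<in> {f. in_sec q u' f}"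
  then have "in_sec p u a" "in_sec q u' b" by (simp_all only: mem_Collect_eq)
  then show "a * b \<in> sv.span {f. in_sec (p + q) (u + u') f}"
    unfolding sec_def[symmetric] by (intro in_sec_imp_sec in_sec_mult)
qed

lemma sec_power:
  assumes "g \<in> sec p u"
  shows "g ^ N \<in> sec (p * N) (qscale (of_nat N) u)"
proof (induction N)
  case 0
  have "1 \<in> sec 0 0" by (rule in_sec_imp_sec[OF in_sec_one])
  then show ?case by (simp only: mult_0_right power_0 of_nat_0 qv.scale_zero_left)
next
  case (Suc N)
  have "g * g ^ N \<in> sec (p + p * N) (u + qscale (of_nat N) u)" using assms Suc by (rule sec_mult)
  moreover have "u + qscale (of_nat N) u = qscale (of_nat (Suc N)) u"
    by (simp add: qscale_def fun_eq_iff algebra_simps)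
  ultimately show ?case by (simp only: power_Suc mult_Suc_right)
qed

lemma sec_subset_sym_pow: "sec p u \<subseteq> sym_pow n p"
proof -
  have "{f. in_sec p u f} \<subseteq> sym_pow n p" by (auto simp: in_sec_def)
  then show ?thesis unfolding sec_def using subspace_sym_pow by (rule sv.span_minimal)
qed

lemma in_sec_if_sec_nonzero: "g \<in> sec p u \<Longrightarrow> g \<noteq> 0 \<Longrightarrow> \<exists>f. in_sec p u f"
proof (rule ccontr)
  assume g: "g \<in> sec p u" "g \<noteq> 0" and "\<not> (\<exists>f. in_sec p u f)"
  then have "{f. in_sec p u f} = {}" by blast
  then have "sec p u = {0}" unfolding sec_def by (simp only: sv.span_empty)
  then show False using g by blast
qed

lemma is_mon_lead_mon: "f \<in> sym_pow n p \<Longrightarrow> f \<noteq> 0 \<Longrightarrow> is_mon n p (lead_mon f)"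
  using lead_mon_in_keys by (auto simp: sym_pow_iff)

lemma global_sections_eq:
  "global_sections r \<Delta> (sym_pow n p) (sym_filt F p)
    = tv.span {Poly_Mapping.single (- u) g | u g. u \<in> lattice_pts r \<and> g \<in> sec p u}"
    (is "_ = tv.span ?R")
proof -
  let ?L = "{Poly_Mapping.single (- u) e | u e.
    e \<in> sym_pow n p - {0} \<and> u \<in> polytope_of r \<Delta> (sym_filt F p) e \<inter> lattice_pts r}"
  have "?L \<subseteq> ?R"
  proof
    fix x assume "x \<in> ?L"
    then obtain u e where "x = Poly_Mapping.single (- u) e" "in_sec p u e" "u \<in> lattice_pts r"
      by (auto simp: in_sec_def)
    moreover from this(2) have "e \<in> sec p u" by (rule in_sec_imp_sec)
    ultimately show "x \<in> ?R" by blast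
  qed
  then have "?L \<subseteq> tv.span ?R" using tv.span_superset by blast
  moreover have "Poly_Mapping.single (- u) g \<in> tv.span ?L" if u: "u \<in> lattice_pts r" and g: "g \<in> sec p u" for u g
    using g unfolding sec_def
  proof (induction rule: sv.span_induct_alt)
    case (step c x y)
    have "Poly_Mapping.single (- u) (sscale c x + y)
        = tscale c (Poly_Mapping.single (- u) x) + Poly_Mapping.single (- u) y"
      by (rule poly_mapping_eqI) (simp add: lookup_add lookup_tscale lookup_single when_def)
    moreover have "Poly_Mapping.single (- u) x \<in> tv.span ?L"
      using step u by (intro tv.span_base) (auto simp: in_sec_def)
    ultimately show ?case using step by (simp only: tv.span_add tv.span_scale)
  qed (simp add: tv.span_zero)
  ultimately show ?thesis unfolding global_sections_def by (subst tv.span_eq) auto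
qed

text \<open>The character comes before the exponents of the monomial. Thus \<open>L\<close>, whose
  elements are supported below \<open>r\<close>, is a subspace of the larger space without
  relabelling.\<close>

definition vec :: "qvec \<times> (nat \<Rightarrow>\<^sub>0 nat) \<Rightarrow> qvec" where
  "vec = (\<lambda>(u, m) i. if i < r then u i else if i < r + n then of_nat (Poly_Mapping.lookup m (i - r)) else 0)"

lemma weightsE:
  assumes "x \<in> weights p"
  obtains u m g f where "x = (u, m)" "u \<in> lattice_pts r" "g \<in> sec p u" "g \<noteq> 0" "m = lead_mon g"
    "is_mon n p m" "in_sec p u f"
proof -
  obtain u g where x: "x = (u, lead_mon g)" "u \<in> lattice_pts r" "g \<in> sec p u" "g \<noteq> 0"
    using assms unfolding weights_def by blast
  moreover obtain f where "in_sec p u f" using in_sec_if_sec_nonzero x by blast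
  moreover have "is_mon n p (lead_mon g)"
    using is_mon_lead_mon sec_subset_sym_pow x by blast
  ultimately show thesis using that by blast
qed

lemma inj_on_vec: "inj_on vec (weights p)"
proof (rule inj_onI)
  fix x y assume xw: "x \<in> weights p" and yw: "y \<in> weights p" and eq: "vec x = vec y"
  obtain u m where x: "x = (u, m)" "u \<in> lattice_pts r" "is_mon n p m"
    by (rule weightsE[OF xw])
  obtain u' m' where y: "y = (u', m')" "u' \<in> lattice_pts r" "is_mon n p m'"
    by (rule weightsE[OF yw])
  have "u i = u' i" for i
    using fun_cong[OF eq, of i] x y by (cases "i < r") (auto simp: vec_def lattice_pts_def qspace_def)
  moreover have "Poly_Mapping.lookup m i = Poly_Mapping.lookup m' i" for i
    using fun_cong[OF eq, of "r + i"] x y by (cases "i < n") (auto simp: vec_def is_mon_def)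
  ultimately show "x = y" using x y by (auto intro: poly_mapping_eqI)
qed

lemma vec_bound:
  "\<exists>K::nat. \<forall>p. \<forall>x\<in>weights p. vec x \<in> lattice_pts (r + n) \<and> (\<forall>i. \<bar>vec x i\<bar> \<le> of_nat (p * K))"
proof -
  obtain K :: nat where K: "K \<ge> 1" "\<And>p u f i. in_sec p u f \<Longrightarrow> i < r \<Longrightarrow> \<bar>u i\<bar> \<le> of_nat (p * K)"
    using in_sec_bound by blast
  have "vec x \<in> lattice_pts (r + n) \<and> (\<forall>i. \<bar>vec x i\<bar> \<le> of_nat (p * K))" if xw: "x \<in> weights p" for x p
  proof -
    obtain u m f where x: "x = (u, m)" "u \<in> lattice_pts r" "is_mon n p m" "in_sec p u f"
      by (rule weightsE[OF xw])
    have "Poly_Mapping.lookup m i \<le> p * K" if "i < n" for i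
    proof -
      have "Poly_Mapping.lookup m i \<le> (\<Sum>i<n. Poly_Mapping.lookup m i)"
        using that by (intro member_le_sum) auto
      also have "\<dots> \<le> p * K" using x(3) K(1) by (simp add: is_mon_def)
      finally show ?thesis .
    qed
    then have "\<bar>vec x i\<bar> \<le> of_nat (p * K)" for i
      using K(2)[OF x(4), of i] by (auto simp: vec_def x(1) simp del: of_nat_mult)
    moreover have "vec x \<in> lattice_pts (r + n)"
      using x(2) by (auto simp: vec_def x(1) lattice_pts_def qspace_def)
    ultimately show ?thesis by blast
  qed
  then show ?thesis by blast
qed

end

text \<open>\<open>I\<close> is a set of coordinates that determines the points. With all
  coordinates this gives finiteness of the weights; with two of them eliminated by linear equations
  it gives the smaller growth.\<close>

lemma box_card:
  assumes X: "\<And>x. x \<in> X \<Longrightarrow> x \<in> lattice_pts N \<and> (\<forall>i. \<bar>x i\<bar> \<le> of_nat B)" and I: "finite I"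
    and inj: "\<And>x y. x \<in> X \<Longrightarrow> y \<in> X \<Longrightarrow> (\<And>i. i \<in> I \<Longrightarrow> x i = y i) \<Longrightarrow> x = y"
  shows "finite X \<and> card X \<le> (2 * B + 1) ^ card I"
proof -
  define h where "h = (\<lambda>x :: qvec. restrict (\<lambda>i. \<lfloor>x i\<rfloor>) I)"
  have fl: "of_int \<lfloor>x i\<rfloor> = x i" if "x \<in> X" for x i
    using X[OF that] by (auto simp: lattice_pts_def elim!: Ints_cases)
  have h: "h ` X \<subseteq> PiE I (\<lambda>_. {- int B..int B})"
  proof (intro image_subsetI PiE_I)
    fix x i assume "x \<in> X" "i \<in> I"
    have "\<bar>x i\<bar> \<le> of_nat B" using X \<open>x \<in> X\<close> by blast
    then have "\<bar>of_int \<lfloor>x i\<rfloor> :: rat\<bar> \<le> of_int (int B)" 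
      unfolding fl[OF \<open>x \<in> X\<close>] by simp
    then have "\<bar>\<lfloor>x i\<rfloor>\<bar> \<le> int B" by (simp only: of_int_le_iff flip: of_int_abs)
    then show "h x i \<in> {- int B..int B}" using \<open>i \<in> I\<close> by (auto simp: h_def)
  qed (auto simp: h_def)
  have inj': "inj_on h X"
  proof (rule inj_onI)
    fix x y assume xy: "x \<in> X" "y \<in> X" "h x = h y"
    show "x = y"
    proof (rule inj[OF xy(1,2)])
      fix i assume "i \<in> I"
      then have "\<lfloor>x i\<rfloor> = \<lfloor>y i\<rfloor>" using fun_cong[OF xy(3), of i] by (simp add: h_def)
      then have "(of_int \<lfloor>x i\<rfloor> :: rat) = of_int \<lfloor>y i\<rfloor>" by (rule arg_cong)
      then show "x i = y i" unfolding fl[OF xy(1)] fl[OF xy(2)] .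
    qed
  qed
  have fin: "finite (PiE I (\<lambda>_. {- int B..int B}))" using I by (intro finite_PiE) auto
  have "card X = card (h ` X)" using card_image[OF inj'] by simp
  also have "\<dots> \<le> card (PiE I (\<lambda>_. {- int B..int B}))" using fin h by (rule card_mono)
  also have "\<dots> = (2 * B + 1) ^ card I" using I by (simp add: card_PiE nat_add_distrib nat_mult_distrib)
  finally show ?thesis using finite_imageD[OF finite_subset[OF h fin] inj'] by blast
qed

context toric
begin

lemma finite_weights: "finite (weights p)"
proof -
  obtain K :: nat where
    K: "\<And>p x. x \<in> weights p \<Longrightarrow> vec x \<in> lattice_pts (r + n) \<and> (\<forall>i. \<bar>vec x i\<bar> \<le> of_nat (p * K))"
    using vec_bound by blast
  have "finite (vec ` weights p) \<and> card (vec ` weights p) \<le> (2 * (p * K) + 1) ^ card {..<r + n}"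
  proof (rule box_card)
    show "x \<in> lattice_pts (r + n) \<and> (\<forall>i. \<bar>x i\<bar> \<le> of_nat (p * K))" if "x \<in> vec ` weights p" for x
      using that K by blast
    show "x = y" if "x \<in> vec ` weights p" "y \<in> vec ` weights p" "\<And>i. i \<in> {..<r + n} \<Longrightarrow> x i = y i" for x y
    proof
      fix i show "x i = y i"
      proof (cases "i < r + n")
        case True
        then show ?thesis using that(3) by blast
      next
        case False
        then show ?thesis using that(1,2) by (auto simp: vec_def)
      qed
    qed
  qed simp
  then show ?thesis using inj_on_vec finite_imageD by blast
qed

lemma dim_global_sections:
  "tv.dim (global_sections r \<Delta> (sym_pow n p) (sym_filt F p)) = card (weights p)"
  unfolding global_sections_eq weights_def
  by (rule tdim_eq_card_lead_mon)
    (use finite_weights[of p] in \<open>auto simp: sec_def weights_def\<close>)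

end

section \<open>Growth of the number of weights\<close>

lemma sum_qvec_apply: "(\<Sum>a\<in>A. f a) i = (\<Sum>a\<in>A. f a i)" for f :: "'a \<Rightarrow> qvec"
proof (induction A rule: infinite_finite_induct)
  case (insert a A)
  then show ?case by (simp only: sum.insert plus_fun_apply simp_thms)
qed (simp_all only: sum.infinite sum.empty zero_fun_apply simp_thms)

definition unit_vec :: "nat \<Rightarrow> qvec" where
  "unit_vec i = (\<lambda>j. if j = i then 1 else 0)"

lemma sum_unit_vec_apply:
  "(\<Sum>i<N. qscale (a i) (unit_vec i)) j = (if j < N then a j else 0)"
  by (simp add: sum_qvec_apply qscale_def unit_vec_def if_distrib cong: if_cong)

lemma qspace_expand: "x \<in> qspace N \<Longrightarrow> x = (\<Sum>i<N. qscale (x i) (unit_vec i))"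
  by (rule ext) (simp only: sum_unit_vec_apply, simp add: qspace_def)

lemma inj_unit_vec: "inj unit_vec"
  by (rule injI) (metis unit_vec_def zero_neq_one)

lemma unit_vec_in_qspace: "i < N \<Longrightarrow> unit_vec i \<in> qspace N"
  by (auto simp: unit_vec_def qspace_def)

lemma qspace_eq_span: "qspace N = qv.span (unit_vec ` {..<N})"
proof
  show "qspace N \<subseteq> qv.span (unit_vec ` {..<N})"
  proof
    fix x assume "x \<in> qspace N"
    then have x: "x = (\<Sum>i<N. qscale (x i) (unit_vec i))" by (rule qspace_expand)
    have "(\<Sum>i<N. qscale (x i) (unit_vec i)) \<in> qv.span (unit_vec ` {..<N})"
      by (rule qv.span_sum, rule qv.span_scale, rule qv.span_base, rule imageI)
    then show "x \<in> qv.span (unit_vec ` {..<N})" using x by (simp only:)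
  qed
  show "qv.span (unit_vec ` {..<N}) \<subseteq> qspace N"
    by (rule qv.span_minimal[OF _ subspace_qspace]) (use unit_vec_in_qspace in blast)
qed

lemma independent_unit_vec: "qv.independent (unit_vec ` {..<N})"
proof (rule qv.independent_if_scalars_zero)
  show "finite (unit_vec ` {..<N})" by simp
  fix f x assume s: "(\<Sum>x\<in>unit_vec ` {..<N}. qscale (f x) x) = 0" and "x \<in> unit_vec ` {..<N}"
  then obtain i where i: "i < N" "x = unit_vec i" by blast
  have "inj_on unit_vec {..<N}" using inj_unit_vec by (rule inj_on_subset) simp
  then have "(\<Sum>i<N. qscale (f (unit_vec i)) (unit_vec i)) = 0"
    using s by (simp only: sum.reindex o_def)
  then have "(\<Sum>i<N. qscale (f (unit_vec i)) (unit_vec i)) i = 0" by (simp only: zero_fun_apply)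
  then show "f x = 0" using i by (simp only: sum_unit_vec_apply if_True)
qed

lemma independent_in_qspace:
  assumes "qv.independent B" "B \<subseteq> qspace N"
  shows "finite B" "card B \<le> N"
proof -
  have "finite B \<and> card B \<le> card (unit_vec ` {..<N})"
    by (rule qv.independent_span_bound) (use assms in \<open>simp_all only: qspace_eq_span finite_imageI finite_lessThan simp_thms\<close>)
  moreover have "card (unit_vec ` {..<N}) = N"
    using card_image[OF inj_on_subset[OF inj_unit_vec], of "{..<N}"] by simp
  ultimately show "finite B" "card B \<le> N" by simp_all
qed

lemma card_spanning_qspace:
  assumes "finite B" "qspace N \<subseteq> qv.span B"
  shows "N \<le> card B"
proof -
  have "unit_vec ` {..<N} \<subseteq> qv.span B" using unit_vec_in_qspace assms(2) by blast
  then have "card (unit_vec ` {..<N}) \<le> card B"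
    using qv.independent_span_bound[OF assms(1) independent_unit_vec] by blast
  moreover have "card (unit_vec ` {..<N}) = N"
    using card_image[OF inj_on_subset[OF inj_unit_vec], of "{..<N}"] by simp
  ultimately show ?thesis by simp
qed

text \<open>The basis is extended to the space of all functions, so the functional is linear
  everywhere and no domain condition has to be carried along.\<close>

lemma coordinate_functional:
  assumes "qv.independent B" "b \<in> B"
  shows "\<exists>g :: qvec \<Rightarrow> rat. (\<forall>x y. g (x + y) = g x + g y) \<and> (\<forall>c x. g (qscale c x) = c * g x) \<and>
    g b = 1 \<and> (\<forall>b'\<in>B. b' \<noteq> b \<longrightarrow> g b' = 0)"
proof -
  define B' where "B' = qv.extend_basis B"
  have B': "B \<subseteq> B'" "qv.independent B'" "qv.span B' = UNIV"
    unfolding B'_def using assms(1)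
    by (rule qv.extend_basis_superset, rule qv.independent_extend_basis, rule qv.span_extend_basis)
  define g where "g = (\<lambda>x. qv.representation B' x b)"
  show ?thesis
  proof (intro exI[of _ g] conjI allI ballI impI)
    show "g (x + y) = g x + g y" for x y
      unfolding g_def by (subst qv.representation_add[OF B'(2)]) (simp_all only: B'(3) UNIV_I)
    show "g (qscale c x) = c * g x" for c x
      unfolding g_def by (subst qv.representation_scale[OF B'(2)]) (simp_all only: B'(3) UNIV_I)
    have "b \<in> B'" using assms(2) B'(1) by blast
    then show "g b = 1" unfolding g_def by (simp only: qv.representation_basis[OF B'(2)] if_True simp_thms)
    show "g b' = 0" if "b' \<in> B" "b' \<noteq> b" for b'
    proof -
      have "b' \<in> B'" using that B'(1) by blast
      then show ?thesis unfolding g_def using that(2) by (simp add: qv.representation_basis[OF B'(2)])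
    qed
  qed
qed

lemma functional_sum:
  fixes g :: "qvec \<Rightarrow> rat"
  assumes "\<And>x y. g (x + y) = g x + g y" "\<And>c x. g (qscale c x) = c * g x"
  shows "g (\<Sum>a\<in>A. f a) = (\<Sum>a\<in>A. g (f a))"
proof -
  have 0: "g 0 = 0" using assms(2)[of 0 0] by (simp only: qv.scale_zero_left mult_zero_left)
  show ?thesis
  proof (induction A rule: infinite_finite_induct)
    case (insert a A)
    then show ?case by (simp only: sum.insert assms(1) simp_thms)
  qed (simp_all only: sum.infinite sum.empty 0 simp_thms)
qed

text \<open>A vector outside \<open>S\<close> is adjoined to a basis of \<open>S\<close>; its
  coordinate functional vanishes on \<open>S\<close>, and the entries of \<nu> are the values of
  this functional on the unit vectors.\<close>

lemma annihilator_exists: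
  assumes S: "qv.subspace S" "S \<subseteq> qspace N" "S \<noteq> qspace N"
  obtains \<nu> where "\<nu> \<in> qspace N" "\<nu> \<noteq> 0" "\<And>x. x \<in> S \<Longrightarrow> pairing N \<nu> x = 0"
proof -
  obtain x0 where x0: "x0 \<in> qspace N" "x0 \<notin> S" using S(2,3) by blast
  obtain B where B: "B \<subseteq> S" "qv.independent B" "S \<subseteq> qv.span B"
    by (rule qv.maximal_independent_subset)
  have SB: "qv.span B = S" using B S(1) by (metis qv.span_minimal subset_antisym)
  have "qv.independent (insert x0 B)"
    using B(2) x0(2) SB by (intro qv.independent_insertI) simp_all
  from coordinate_functional[OF this insertI1]
  obtain g :: "qvec \<Rightarrow> rat" where g0: "(\<forall>x y. g (x + y) = g x + g y) \<and>
    (\<forall>c x. g (qscale c x) = c * g x) \<and> g x0 = 1 \<and> (\<forall>b'\<in>insert x0 B. b' \<noteq> x0 \<longrightarrow> g b' = 0)" ..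
  then have g: "\<And>x y. g (x + y) = g x + g y" "\<And>c x. g (qscale c x) = c * g x"
    "g x0 = 1" "\<And>b'. b' \<in> insert x0 B \<Longrightarrow> b' \<noteq> x0 \<Longrightarrow> g b' = 0" by blast+
  define \<nu> where "\<nu> = (\<lambda>i. if i < N then g (unit_vec i) else 0)"
  have gp: "g x = pairing N \<nu> x" if "x \<in> qspace N" for x
  proof -
    have "g x = g (\<Sum>i<N. qscale (x i) (unit_vec i))" using qspace_expand[OF that] by (rule arg_cong)
    also have "\<dots> = (\<Sum>i<N. x i * g (unit_vec i))" by (simp only: functional_sum[OF g(1,2)] g(2))
    also have "\<dots> = pairing N \<nu> x" unfolding pairing_def by (rule sum.cong) (auto simp: \<nu>_def)
    finally show ?thesis .
  qed
  have gB: "g b = 0" if "b \<in> B" for b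
  proof -
    have "b \<noteq> x0" using that B(1) x0(2) by blast
    then show ?thesis using g(4) that by blast
  qed
  show thesis
  proof (rule that)
    show "\<nu> \<in> qspace N" by (simp add: \<nu>_def qspace_def)
    show "\<nu> \<noteq> 0"
    proof
      assume "\<nu> = 0"
      then have "g x0 = 0" using gp[OF x0(1)] by (simp only: pairing_simps)
      then show False using g(3) by simp
    qed
    show "pairing N \<nu> x = 0" if x: "x \<in> S" for x
    proof -
      have "x \<in> qv.span B" using x SB by simp
      then have "g x = 0"
      proof (induction rule: qv.span_induct_alt)
        case base
        then show ?case using g(2)[of 0 0] by (simp only: qv.scale_zero_left mult_zero_left)
      next
        case (step c x y)
        then show ?case by (simp only: g(1,2) gB mult_zero_right add_0)
      qed
      then show ?thesis using gp x S(2) by (metis subsetD)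
    qed
  qed
qed

text \<open>Turns positivity into an inequality at infinitely many \<open>l\<close>, which can be
  checked along a sequence of multiples.\<close>

lemma limsup_ereal_pos_iff:
  fixes f :: "nat \<Rightarrow> real"
  shows "limsup (\<lambda>l. ereal (f l)) > 0 \<longleftrightarrow> (\<exists>\<epsilon>>0. \<exists>\<^sub>F l in sequentially. f l \<ge> \<epsilon>)"
proof
  assume pos: "limsup (\<lambda>l. ereal (f l)) > 0"
  show "\<exists>\<epsilon>>0. \<exists>\<^sub>F l in sequentially. f l \<ge> \<epsilon>"
  proof (rule ccontr)
    assume neg: "\<not> (\<exists>\<epsilon>>0. \<exists>\<^sub>F l in sequentially. f l \<ge> \<epsilon>)"
    obtain e where e: "0 < ereal e" "ereal e < limsup (\<lambda>l. ereal (f l))"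
      using ereal_dense2[OF pos] by auto
    have "\<forall>\<^sub>F l in sequentially. f l < e"
      using neg e(1) by (auto simp: frequently_def not_le)
    then have "\<forall>\<^sub>F l in sequentially. ereal (f l) \<le> ereal e"
      by (rule eventually_mono) simp
    then show False using Limsup_bounded e(2) by (metis not_le)
  qed
next
  assume "\<exists>\<epsilon>>0. \<exists>\<^sub>F l in sequentially. f l \<ge> \<epsilon>"
  then obtain \<epsilon> where \<epsilon>: "\<epsilon> > 0" "\<exists>\<^sub>F l in sequentially. f l \<ge> \<epsilon>" by blast
  show "limsup (\<lambda>l. ereal (f l)) > 0"
  proof (rule ccontr)
    assume "\<not> limsup (\<lambda>l. ereal (f l)) > 0"
    then have "limsup (\<lambda>l. ereal (f l)) < ereal \<epsilon>" using \<epsilon>(1) by (meson ereal_less(2) le_less_trans not_le)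
    then have "\<forall>\<^sub>F l in sequentially. ereal (f l) < ereal \<epsilon>" by (rule Limsup_lessD)
    then have "\<forall>\<^sub>F l in sequentially. \<not> (f l \<ge> \<epsilon>)" by (rule eventually_mono) simp
    then show False using \<epsilon>(2) by (simp add: frequently_def)
  qed
qed

context toric
begin

lemma vec_in_qspace: "u \<in> qspace r \<Longrightarrow> vec (u, m) \<in> qspace (r + n)"
  by (auto simp: vec_def qspace_def)

lemma pairing_degree:
  assumes "is_mon n p m"
  shows "pairing (r + n) (\<lambda>i. if r \<le> i \<and> i < r + n then 1 else 0) (vec (u, m)) = of_nat p"
proof -
  have "pairing (r + n) (\<lambda>i. if r \<le> i \<and> i < r + n then 1 else 0) (vec (u, m))
      = (\<Sum>i<n. of_nat (Poly_Mapping.lookup m i))"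
    by (simp add: pairing_def sum_lessThan_add vec_def)
  then show ?thesis using assms by (simp add: is_mon_def flip: of_nat_sum)
qed

text \<open>
  If the weights of all degrees do not span, then those of degree \<open>l\<close> satisfy two independent
  linear equations: the one defining their span and the one fixing the degree.
\<close>

lemma weights_growth:
  assumes nspan: "qv.span (vec ` (\<Union>l\<in>{0<..}. weights l)) \<noteq> qspace (r + n)"
  shows "\<exists>C::nat. \<forall>l\<ge>1. weights l \<noteq> {} \<longrightarrow> r + n \<ge> 2 \<and> card (weights l) \<le> (C * l) ^ (r + n - 2)"
proof (cases "\<exists>l>0. weights l \<noteq> {}")
  case True
  then obtain l0 x0 where l0: "l0 > 0" "x0 \<in> weights l0" by blast
  define N where "N = r + n"
  \<comment> \<open>Pairing with \<tau> adds up the exponents of the monomial and so returns the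
    degree.\<close>
  define \<tau> where "\<tau> = (\<lambda>i. if r \<le> i \<and> i < r + n then 1 else 0 :: rat)"
  define V where "V = vec ` (\<Union>l\<in>{0<..}. weights l)"
  have \<tau>: "pairing N \<tau> (vec x) = of_nat l" if xw: "x \<in> weights l" for x l
  proof -
    obtain u m where "x = (u, m)" "is_mon n l m" by (rule weightsE[OF xw])
    then show ?thesis using pairing_degree by (simp add: \<tau>_def N_def)
  qed
  have "V \<subseteq> qspace N"
  proof
    fix v assume "v \<in> V"
    then obtain x l where x: "v = vec x" "x \<in> weights l" unfolding V_def by blast
    obtain u m where "x = (u, m)" "u \<in> lattice_pts r" by (rule weightsE[OF x(2)])
    then show "v \<in> qspace N" using x(1) vec_in_qspace lattice_pts_subset_qspace N_def by blast
  qed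
  then have "qv.span V \<subseteq> qspace N" using subspace_qspace by (rule qv.span_minimal)
  then obtain \<nu> where \<nu>: "\<nu> \<in> qspace N" "\<nu> \<noteq> 0" "\<And>x. x \<in> qv.span V \<Longrightarrow> pairing N \<nu> x = 0"
    using annihilator_exists[OF qv.subspace_span, of V N] nspan unfolding V_def N_def by blast
  have \<nu>V: "pairing N \<nu> (vec x) = 0" if "x \<in> weights l" "l > 0" for x l
    by (rule \<nu>(3), rule qv.span_base) (use that in \<open>auto simp: V_def\<close>)
  \<comment> \<open>A nonzero two-by-two minor. If \<nu> were a multiple of \<tau>, evaluation at a
    weight of positive degree, where \<nu> vanishes and \<tau> does not, would force the factor to
    be 0.\<close>
  have "\<exists>i<N. \<exists>j<N. \<nu> i * \<tau> j \<noteq> \<nu> j * \<tau> i"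
  proof (rule ccontr)
    assume "\<not> ?thesis"
    then have eq: "\<nu> i * \<tau> j = \<nu> j * \<tau> i" if "i < N" "j < N" for i j using that by blast
    have "n > 0"
    proof (rule ccontr)
      assume "\<not> n > 0"
      then have "pairing N \<tau> (vec x0) = 0" by (auto simp: \<tau>_def pairing_def intro!: sum.neutral)
      then show False using \<tau>[OF l0(2)] l0(1) by simp
    qed
    then have r: "r < N" "\<tau> r = 1" by (auto simp: N_def \<tau>_def)
    have lam: "\<nu> i = \<nu> r * \<tau> i" for i
    proof (cases "i < N")
      case True
      then show ?thesis using eq[OF True r(1)] r(2) by simp
    next
      case False
      then show ?thesis using \<nu>(1) by (simp add: qspace_def \<tau>_def N_def)
    qed
    then have "\<nu> = qscale (\<nu> r) \<tau>" unfolding qscale_def by (rule ext)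
    then have "pairing N \<nu> (vec x0) = pairing N (qscale (\<nu> r) \<tau>) (vec x0)" by (rule arg_cong)
    then have "\<nu> r * of_nat l0 = 0" using \<nu>V[OF l0(2,1)] \<tau>[OF l0(2)] by (simp add: pairing_simps)
    then have "\<nu> r = 0" using l0(1) by simp
    then have "\<nu> i = 0" for i using lam[of i] by simp
    then have "\<nu> = 0" by (intro ext) (simp only: zero_fun_apply)
    then show False using \<nu>(2) by blast
  qed
  then obtain i j where ij: "i < N" "j < N" "\<nu> i * \<tau> j \<noteq> \<nu> j * \<tau> i" by blast
  then have "i \<noteq> j" by auto
  define I where "I = {..<N} - {i, j}"
  have cI: "card I = N - 2"
    unfolding I_def using ij \<open>i \<noteq> j\<close> by (subst card_Diff_subset) auto
  \<comment> \<open>With this the truncated subtraction \<open>N - 2\<close> is genuine; the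
    exponents are compared with it later.\<close>
  have N2: "N \<ge> 2" using ij \<open>i \<noteq> j\<close> by linarith
  obtain K :: nat where
    K: "\<And>p x. x \<in> weights p \<Longrightarrow> vec x \<in> lattice_pts (r + n) \<and> (\<forall>i. \<bar>vec x i\<bar> \<le> of_nat (p * K))"
    using vec_bound by blast
  have "card (weights l) \<le> ((2 * K + 1) * l) ^ (N - 2)" if l: "l \<ge> 1" for l
  proof -
    have "finite (vec ` weights l) \<and> card (vec ` weights l) \<le> (2 * (l * K) + 1) ^ card I"
    proof (rule box_card)
      show "x \<in> lattice_pts N \<and> (\<forall>i. \<bar>x i\<bar> \<le> of_nat (l * K))" if "x \<in> vec ` weights l" for x
        using that K unfolding N_def by blast
      fix x y assume "x \<in> vec ` weights l" "y \<in> vec ` weights l" and xy: "\<And>k. k \<in> I \<Longrightarrow> x k = y k"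
      then obtain x' y' where x': "x = vec x'" "x' \<in> weights l" and y': "y = vec y'" "y' \<in> weights l"
        by blast
      define d where "d = (\<lambda>k. x k - y k)"
      have "x k = y k" if "k \<notin> {i, j}" for k
      proof (cases "k < N")
        case True
        then show ?thesis using xy that by (simp add: I_def)
      next
        case False
        then show ?thesis using x' y' by (simp add: vec_def N_def split: prod.split)
      qed
      then have d0: "d k = 0" if "k \<notin> {i, j}" for k using that by (simp add: d_def)
      have pd: "pairing N \<mu> x - pairing N \<mu> y = \<mu> i * d i + \<mu> j * d j" for \<mu>
      proof -
        have "pairing N \<mu> x - pairing N \<mu> y = (\<Sum>k<N. \<mu> k * d k)"
          by (simp add: pairing_def d_def algebra_simps sum_subtractf)
        also have "\<dots> = (\<Sum>k\<in>{i, j}. \<mu> k * d k)"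
          using ij d0 by (intro sum.mono_neutral_right) auto
        also have "\<dots> = \<mu> i * d i + \<mu> j * d j" using \<open>i \<noteq> j\<close> by simp
        finally show ?thesis .
      qed
      have "\<nu> i * d i + \<nu> j * d j = 0"
        using pd[of \<nu>] \<nu>V[OF x'(2)] \<nu>V[OF y'(2)] l x'(1) y'(1) by simp
      moreover have "\<tau> i * d i + \<tau> j * d j = 0"
        using pd[of \<tau>] \<tau>[OF x'(2)] \<tau>[OF y'(2)] x'(1) y'(1) by simp
      ultimately have e: "\<nu> i * d i = - (\<nu> j * d j)" "\<tau> i * d i = - (\<tau> j * d j)" by linarith+
      \<comment> \<open>Cramer's rule for the two remaining differences, the chosen minor being the
        determinant.\<close>
      have "(\<nu> i * \<tau> j - \<nu> j * \<tau> i) * d i = \<tau> j * (\<nu> i * d i) - \<nu> j * (\<tau> i * d i)"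
        by (simp add: algebra_simps)
      also have "\<dots> = 0" unfolding e by (simp add: algebra_simps)
      finally have di: "d i = 0" using ij(3) by simp
      have "(\<nu> i * \<tau> j - \<nu> j * \<tau> i) * d j = \<nu> i * (\<tau> j * d j) - \<tau> i * (\<nu> j * d j)"
        by (simp add: algebra_simps)
      also have "\<dots> = 0" using e di by auto
      finally have dj: "d j = 0" using ij(3) by simp
      have "d k = 0" for k using d0[of k] di dj by blast
      then show "x = y" by (intro ext) (simp add: d_def)
    qed (simp add: I_def)
    then have "card (weights l) \<le> (2 * (l * K) + 1) ^ (N - 2)"
      using card_image[OF inj_on_vec] by (simp add: cI)
    also have "\<dots> \<le> ((2 * K + 1) * l) ^ (N - 2)"
      using l by (intro power_mono) (auto simp: algebra_simps)
    finally show ?thesis .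
  qed
  then show ?thesis using N2 unfolding N_def by blast
next
  case False
  have "weights l = {}" if "l \<ge> 1" for l
  proof -
    have "l > 0" using that by simp
    then show ?thesis using False by blast
  qed
  then show ?thesis by simp
qed

lemma big_imp_span:
  assumes big: "big r n \<Delta> F"
  shows "qv.span (vec ` (\<Union>l\<in>{0<..}. weights l)) = qspace (r + n)"
proof (rule ccontr)
  assume "\<not> ?thesis"
  then obtain C :: nat where C: "\<And>l. l \<ge> 1 \<Longrightarrow> weights l \<noteq> {} \<Longrightarrow>
      r + n \<ge> 2 \<and> card (weights l) \<le> (C * l) ^ (r + n - 2)"
    using weights_growth by blast
  define f where "f = (\<lambda>l. real (card (weights l)) / real l powi (int r + int n - 1))"
  obtain \<epsilon> where \<epsilon>: "\<epsilon> > 0" "\<exists>\<^sub>F l in sequentially. f l \<ge> \<epsilon>"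
    using big unfolding big_def dim_global_sections limsup_ereal_pos_iff f_def by blast
  have bd: "f l \<le> real C ^ (r + n - 2) / real l" if l: "l \<ge> 1" for l
  proof (cases "weights l = {}")
    case True
    then show ?thesis by (simp add: f_def)
  next
    case False
    then have c: "r + n \<ge> 2" "card (weights l) \<le> (C * l) ^ (r + n - 2)" using C l by blast+
    have "int r + int n - 1 = int (Suc (r + n - 2))" using c(1) by linarith
    then have p: "real l powi (int r + int n - 1) = real l ^ (r + n - 2) * real l"
      by (simp only: power_int_of_nat power_Suc2)
    have "real (card (weights l)) \<le> real ((C * l) ^ (r + n - 2))" using c(2) by (simp only: of_nat_le_iff)
    then have "f l \<le> real C ^ (r + n - 2) * real l ^ (r + n - 2) / (real l ^ (r + n - 2) * real l)"
      unfolding f_def p by (intro divide_right_mono) (auto simp: power_mult_distrib)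
    then show ?thesis using l by simp
  qed
  define l0 where "l0 = nat \<lceil>real C ^ (r + n - 2) / \<epsilon>\<rceil> + 1"
  have "f l < \<epsilon>" if l: "l \<ge> l0" for l
  proof -
    have "real C ^ (r + n - 2) / \<epsilon> < real l" using l unfolding l0_def by linarith
    then have "real C ^ (r + n - 2) / real l < \<epsilon>"
      using \<epsilon>(1) l by (simp add: l0_def field_simps)
    then show ?thesis using bd[of l] l by (simp add: l0_def)
  qed
  then have "\<forall>\<^sub>F l in sequentially. \<not> f l \<ge> \<epsilon>"
    unfolding eventually_sequentially not_le by blast
  then show False using \<epsilon>(2) by (simp add: frequently_def)
qed

end

section \<open>Bigness implies positivity of \<open>\<alpha>\<close>\<close>

lemma finite_is_mon: "finite {m. is_mon n p m}"
proof -
  define h where "h = (\<lambda>m :: nat \<Rightarrow>\<^sub>0 nat. restrict (Poly_Mapping.lookup m) {..<n})"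
  have "h ` {m. is_mon n p m} \<subseteq> PiE {..<n} (\<lambda>_. {..p})"
  proof (intro image_subsetI PiE_I)
    fix m i assume "m \<in> {m. is_mon n p m}" "i \<in> {..<n}"
    then have "(\<Sum>i<n. Poly_Mapping.lookup m i) = p" "i < n" by (auto simp: is_mon_def)
    then have "Poly_Mapping.lookup m i \<le> p"
      using member_le_sum[of i "{..<n}" "Poly_Mapping.lookup m"] by simp
    then show "h m i \<in> {..p}" using \<open>i < n\<close> by (simp add: h_def)
  qed (simp add: h_def)
  then have fin: "finite (h ` {m. is_mon n p m})"
    by (rule finite_subset) (auto intro: finite_PiE)
  have "inj_on h {m. is_mon n p m}"
  proof (rule inj_onI)
    fix m m' assume m: "m \<in> {m. is_mon n p m}" "m' \<in> {m. is_mon n p m}" "h m = h m'"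
    show "m = m'"
    proof (rule poly_mapping_eqI)
      fix i
      show "Poly_Mapping.lookup m i = Poly_Mapping.lookup m' i"
      proof (cases "i < n")
        case True
        then show ?thesis using fun_cong[OF m(3), of i] by (simp add: h_def)
      next
        case False
        then show ?thesis using m(1,2) by (simp add: is_mon_def)
      qed
    qed
  qed
  then show ?thesis using fin by (rule finite_imageD[rotated])
qed

section \<open>Arithmetic of cosets\<close>

lemma coset_eq_iff:
  fixes L :: "qvec set"
  assumes L: "qv.subspace L"
  shows "u +o L = u' +o L \<longleftrightarrow> u - u' \<in> L"
proof
  assume "u +o L = u' +o L"
  moreover have "u + 0 \<in> u +o L" using qv.subspace_0[OF L] by (rule set_plus_intro2)
  ultimately have "u \<in> u' +o L" by simp
  then show "u - u' \<in> L" by (rule set_plus_imp_minus)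
next
  assume d: "u - u' \<in> L"
  have sub: "a +o L \<subseteq> b +o L" if "a - b \<in> L" for a b
  proof
    fix x assume "x \<in> a +o L"
    then have "x - a \<in> L" by (rule set_plus_imp_minus)
    then have "(x - a) + (a - b) \<in> L" using that by (rule qv.subspace_add[OF L])
    then have "x - b \<in> L" by simp
    then show "x \<in> b +o L" by (rule set_minus_imp_plus)
  qed
  have "- (u - u') \<in> L" using d by (rule qv.subspace_neg[OF L])
  then have "u' - u \<in> L" by simp
  then show "u +o L = u' +o L" using sub d by blast
qed

lemma subspace_plus_self: "qv.subspace L \<Longrightarrow> L + L = L"
proof
  assume L: "qv.subspace L"
  show "L + L \<subseteq> L" using qv.subspace_add[OF L] by (auto elim!: set_plus_elim)
  show "L \<subseteq> L + L" using qv.subspace_0[OF L] by (rule set_zero_plus2)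
qed

lemma coset_add: "qv.subspace L \<Longrightarrow> (u +o L) + (u' +o L) = (u + u') +o L"
  using set_plus_rearrange[of u L u' L] subspace_plus_self[of L] by metis

lemma coset_sum_const:
  assumes L: "qv.subspace L"
  shows "L + (\<Sum>i<(c::nat). u +o L) = qscale (of_nat c) u +o L"
proof (induction c)
  case 0
  have "L + 0 = 0 +o L" by (simp only: add_0_right set_zero_plus)
  then show ?case by (simp only: lessThan_0 sum.empty of_nat_0 qv.scale_zero_left)
next
  case (Suc c)
  have "L + (\<Sum>i<Suc c. u +o L) = (qscale (of_nat c) u +o L) + (u +o L)"
    unfolding sum.lessThan_Suc Suc.IH[symmetric] by (simp only: add.assoc)
  also have "\<dots> = (qscale (of_nat c) u + u) +o L" by (rule coset_add[OF L])
  also have "qscale (of_nat c) u + u = qscale (of_nat (Suc c)) u"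
    by (simp add: qscale_def fun_eq_iff algebra_simps)
  finally show ?case .
qed

text \<open>Since \<open>L + L = L\<close>, the leading copy of \<open>L\<close> can be doubled and
  handed to both parts of the sum.\<close>

lemma coset_sum:
  assumes L: "qv.subspace L" and "finite E"
  shows "L + (\<Sum>f\<in>E. \<Sum>i<(c f::nat). u f +o L) = (\<Sum>f\<in>E. qscale (of_nat (c f)) (u f)) +o L"
  using assms(2)
proof (induction E rule: finite_induct)
  case empty
  have "L + 0 = 0 +o L" by (simp only: add_0_right set_zero_plus)
  then show ?case by (simp only: sum.empty)
next
  case (insert f E)
  have "L + (\<Sum>f\<in>insert f E. \<Sum>i<c f. u f +o L)
    = L + L + ((\<Sum>i<c f. u f +o L) + (\<Sum>f\<in>E. \<Sum>i<c f. u f +o L))"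
    by (simp only: subspace_plus_self[OF L] sum.insert[OF insert.hyps])
  also have "\<dots> = (L + (\<Sum>i<c f. u f +o L)) + (L + (\<Sum>f\<in>E. \<Sum>i<c f. u f +o L))"
    by (simp only: ac_simps)
  also have "\<dots> = (qscale (of_nat (c f)) (u f) + (\<Sum>f\<in>E. qscale (of_nat (c f)) (u f))) +o L"
    by (simp only: insert.IH coset_sum_const[OF L] coset_add[OF L])
  finally show ?case by (simp only: sum.insert[OF insert.hyps])
qed

text \<open>All parts but one can be chosen freely up to \<open>l / |D|\<close>.\<close>

lemma card_compositions_ge:
  fixes D :: "'i set"
  assumes D: "finite D" "D \<noteq> {}"
  shows "\<exists>Cs. finite Cs \<and> (\<forall>c\<in>Cs. (\<Sum>d\<in>D. c d) = l \<and> (\<forall>d. d \<notin> D \<longrightarrow> c d = 0)) \<and>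
    (real l / real (card D)) ^ (card D - 1) \<le> real (card Cs)"
proof -
  obtain d0 where d0: "d0 \<in> D" using D(2) by blast
  define D' where "D' = D - {d0}"
  define a where "a = l div card D"
  \<comment> \<open>The part \<open>d0\<close> absorbs what the others leave over. The value 0
    outside \<open>D\<close> makes these functions depend on \<open>D\<close> alone.\<close>
  define h where "h = (\<lambda>c d. if d = d0 then l - (\<Sum>d\<in>D'. c d) else if d \<in> D' then c d else 0 :: nat)"
  define P where "P = PiE D' (\<lambda>_. {..a})"
  have cD: "card D > 0" using D by (simp add: card_gt_0_iff)
  have cD': "card D' = card D - 1" "finite D'" using D d0 by (simp_all add: D'_def)
  have le: "(\<Sum>d\<in>D'. c d) \<le> l" if "c \<in> P" for c
  proof -
    have "(\<Sum>d\<in>D'. c d) \<le> (\<Sum>d\<in>D'. a)" using that by (intro sum_mono) (auto simp: P_def)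
    also have "\<dots> \<le> card D * a" by (simp add: cD')
    also have "\<dots> \<le> l" by (simp add: a_def)
    finally show ?thesis .
  qed
  have inj: "inj_on h P"
  proof (rule inj_onI)
    fix c c' assume c: "c \<in> P" "c' \<in> P" "h c = h c'"
    show "c = c'"
    proof (rule PiE_ext[OF c(1,2)[unfolded P_def]])
      fix d assume "d \<in> D'"
      then show "c d = c' d" using fun_cong[OF c(3), of d] by (auto simp: h_def D'_def)
    qed
  qed
  have hs: "(\<Sum>d\<in>D. h c d) = l" if "c \<in> P" for c
  proof -
    have "(\<Sum>d\<in>D. h c d) = h c d0 + (\<Sum>d\<in>D'. h c d)" using D d0 by (simp add: D'_def sum.remove)
    also have "(\<Sum>d\<in>D'. h c d) = (\<Sum>d\<in>D'. c d)" by (rule sum.cong) (auto simp: h_def D'_def)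
    finally show ?thesis using le[OF that] by (simp add: h_def)
  qed
  have "(real l / real (card D)) ^ (card D - 1) \<le> real (a + 1) ^ (card D - 1)"
  proof (rule power_mono)
    have "l < (a + 1) * card D" using cD by (simp add: a_def dividend_less_div_times)
    then have "real l \<le> real (a + 1) * real (card D)" by (metis less_imp_le of_nat_le_iff of_nat_mult)
    then show "real l / real (card D) \<le> real (a + 1)" using cD by (simp add: divide_le_eq)
  qed simp
  also have "\<dots> = real (card P)" using cD' by (simp add: P_def card_PiE)
  also have "card P = card (h ` P)" using card_image[OF inj] by simp
  finally have card: "(real l / real (card D)) ^ (card D - 1) \<le> real (card (h ` P))" .
  have "finite (h ` P)" unfolding P_def using cD'(2) by (intro finite_imageI finite_PiE) auto
  moreover have "\<forall>c\<in>h ` P. (\<Sum>d\<in>D. c d) = l \<and> (\<forall>d. d \<notin> D \<longrightarrow> c d = 0)"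
    using hs d0 by (auto simp: h_def D'_def)
  ultimately show ?thesis using card by blast
qed

section \<open>The space \<open>L\<close> and the points of the quotient by it\<close>

context toric
begin

abbreviation L :: "qvec set" where "L \<equiv> Lspace r n \<Delta> F"

lemma subspace_L: "qv.subspace L"
  unfolding Lspace_def by (rule qv.subspace_span)

lemma L_generators:
  "L = qv.span {a - b | a b. \<exists>f p. p > 0 \<and> in_sec p a f \<and> in_sec p b f}"
  unfolding Lspace_def in_sec_def by (rule arg_cong[where f = qv.span]) blast

lemma in_sec_qspace: "in_sec p u f \<Longrightarrow> u \<in> qspace r"
  by (simp add: in_sec_def polytope_of_def)

lemma L_subset_qspace: "L \<subseteq> qspace r"
  unfolding L_generators
proof (rule qv.span_minimal[OF _ subspace_qspace], rule subsetI)
  fix x assume "x \<in> {a - b |a b. \<exists>f p. 0 < p \<and> in_sec p a f \<and> in_sec p b f}"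
  then obtain a b p f where x: "x = a - b" "in_sec p a f" "in_sec p b f" by blast
  show "x \<in> qspace r" unfolding x(1)
    by (rule qv.subspace_diff[OF subspace_qspace in_sec_qspace[OF x(2)] in_sec_qspace[OF x(3)]])
qed

lemma in_sec_diff:
  assumes "p > 0" "in_sec p a f" "in_sec p b f"
  shows "a - b \<in> L"
  unfolding L_generators by (rule qv.span_base) (use assms in blast)

text \<open>Two points of one polytope differ by an element of \<open>L\<close>, so the image is a
  singleton and any point, rational or integral, represents it.\<close>

lemma wpt_eq:
  assumes p: "p > 0" and s: "in_sec p u f"
  shows "wpt r n \<Delta> F p f = u +o L"
proof -
  have "(\<lambda>u. u +o L) ` polytope_of r \<Delta> (sym_filt F p) f = {u +o L}"
  proof (intro equalityI subsetI)
    fix w assume "w \<in> (\<lambda>u. u +o L) ` polytope_of r \<Delta> (sym_filt F p) f"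
    then obtain u' where w: "w = u' +o L" "u' \<in> polytope_of r \<Delta> (sym_filt F p) f" by blast
    then have "in_sec p u' f" using s by (simp add: in_sec_def)
    then have "u' - u \<in> L" using in_sec_diff p s by blast
    then show "w \<in> {u +o L}" using w(1) coset_eq_iff[OF subspace_L] by blast
  next
    fix w assume "w \<in> {u +o L}"
    then show "w \<in> (\<lambda>u. u +o L) ` polytope_of r \<Delta> (sym_filt F p) f"
      using s by (auto simp: in_sec_def)
  qed
  then show ?thesis unfolding wpt_def by simp
qed

lemma Lam_memI: "p > 0 \<Longrightarrow> in_sec p u f \<Longrightarrow> u +o L \<in> Lam r n \<Delta> F"
  unfolding Lam_def using wpt_eq[of p u f] by (force simp: in_sec_def)

end

locale toric_family = toric +
  fixes eps :: "nat \<Rightarrow> 'a symalg set"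
  assumes admissible: "admissible_family r n \<Delta> F eps"
begin

lemmas eps_props = conjunct1[OF admissible[unfolded admissible_family_def], THEN spec, THEN mp]

lemma eps_finite: "p > 0 \<Longrightarrow> finite (eps p)"
  using eps_props by (rule conjunct1)

lemma eps_sym_pow: "p > 0 \<Longrightarrow> f \<in> eps p \<Longrightarrow> f \<in> sym_pow n p \<and> f \<noteq> 0"
  using eps_props[of p, THEN conjunct2, THEN conjunct1] by blast

text \<open>Compare coefficients at the exponent \<open>- u\<close>: of an expansion over the
  generators from \<open>eps p\<close> only the terms with the same \<open>u\<close> remain.\<close>

lemma sec_subset_span_eps:
  assumes p: "p > 0" and u: "u \<in> lattice_pts r"
  shows "sec p u \<subseteq> sv.span {f \<in> eps p. in_sec p u f}"
proof
  fix g assume g: "g \<in> sec p u"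
  let ?G = "{Poly_Mapping.single (- u) f | u f.
    f \<in> eps p \<and> u \<in> polytope_of r \<Delta> (sym_filt F p) f \<inter> lattice_pts r}"
  have "Poly_Mapping.single (- u) g \<in> global_sections r \<Delta> (sym_pow n p) (sym_filt F p)"
    unfolding global_sections_eq by (rule tv.span_base) (use u g in blast)
  moreover have "global_sections r \<Delta> (sym_pow n p) (sym_filt F p) = tv.span ?G"
    using eps_props[OF p] by (elim conjE)
  ultimately have "Poly_Mapping.single (- u) g \<in> tv.span ?G" by (simp only:)
  then have "Poly_Mapping.lookup (Poly_Mapping.single (- u) g) (- u) \<in> sv.span {f \<in> eps p. in_sec p u f}"
  proof (induction rule: tv.span_induct_alt)
    case base
    then show ?case by (simp add: sv.span_zero)
  next
    case (step c x y)
    then obtain u' f where x: "x = Poly_Mapping.single (- u') f" "f \<in> eps p"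
      "u' \<in> polytope_of r \<Delta> (sym_filt F p) f" by blast
    have "Poly_Mapping.lookup x (- u) \<in> sv.span {f \<in> eps p. in_sec p u f}"
    proof (cases "u' = u")
      case True
      then have "f \<in> {f \<in> eps p. in_sec p u f}"
        using x eps_sym_pow[OF p] by (simp add: in_sec_def)
      then show ?thesis unfolding x(1) True lookup_single_eq by (rule sv.span_base)
    next
      case False
      then have "- u' \<noteq> - u" by simp
      then have "Poly_Mapping.lookup x (- u) = 0" unfolding x(1) by (rule lookup_single_not_eq)
      then show ?thesis by (simp add: sv.span_zero)
    qed
    then show ?case unfolding lookup_add lookup_tscale using step.IH
      by (intro sv.span_add sv.span_scale)
  qed
  then show "g \<in> sv.span {f \<in> eps p. in_sec p u f}" by (simp only: lookup_single_eq)
qed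

section \<open>The pieces \<open>A_piece\<close> and the semigroup \<open>Lam_p\<close> for a fixed
  p\<close>

context
  fixes p :: nat
  assumes p: "p > 0"
begin

abbreviation E :: "'a symalg set" where "E \<equiv> eps_bar r \<Delta> F eps p"

abbreviation A :: "qvec \<Rightarrow> nat \<Rightarrow> 'a symalg set" where
  "A u l \<equiv> A_piece r n \<Delta> F eps p (u +o L) (int l)"

lemma finite_E: "finite E"
  unfolding eps_bar_def using eps_finite[OF p] by simp

lemma E_memI: "f \<in> eps p \<Longrightarrow> in_sec p u f \<Longrightarrow> u \<in> lattice_pts r \<Longrightarrow> f \<in> E"
  by (auto simp: eps_bar_def in_sec_def)

lemma E_point:
  obtains \<beta> where "\<And>f. f \<in> E \<Longrightarrow> in_sec p (\<beta> f) f \<and> \<beta> f \<in> lattice_pts r"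
proof -
  have "\<forall>f\<in>E. \<exists>u. in_sec p u f \<and> u \<in> lattice_pts r"
    using eps_sym_pow[OF p] by (auto simp: eps_bar_def in_sec_def)
  then show thesis using that by metis
qed

text \<open>Replaces the sums of sets in the definition of the pieces by the coset of an explicit
  point. Any choice of one point per polytope will do.\<close>

lemma wpt_sum:
  assumes "\<And>f. f \<in> E \<Longrightarrow> in_sec p (\<beta> f) f"
  shows "L + (\<Sum>f\<in>E. \<Sum>i<c f. wpt r n \<Delta> F p f) = (\<Sum>f\<in>E. qscale (of_nat (c f)) (\<beta> f)) +o L"
proof -
  have "(\<Sum>f\<in>E. \<Sum>i<c f. wpt r n \<Delta> F p f) = (\<Sum>f\<in>E. \<Sum>i<c f. \<beta> f +o L)"
  proof (rule sum.cong[OF refl])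
    fix f assume "f \<in> E"
    then have "wpt r n \<Delta> F p f = \<beta> f +o L" using wpt_eq[OF p] assms by blast
    then show "(\<Sum>i<c f. wpt r n \<Delta> F p f) = (\<Sum>i<c f. \<beta> f +o L)" by (simp only:)
  qed
  then show ?thesis by (simp only: coset_sum[OF subspace_L finite_E])
qed

lemma A_mult:
  assumes "g \<in> A u l" "h \<in> A u' l'"
  shows "g * h \<in> A (u + u') (l + l')"
  unfolding A_piece_def[of r n \<Delta> F eps p "(u + u') +o L"]
proof (rule span_mult[OF _ assms[unfolded A_piece_def]])
  fix a b
  assume "a \<in> {\<Prod>f\<in>E. f ^ c f |c. L + (\<Sum>f\<in>E. \<Sum>i<c f. wpt r n \<Delta> F p f) = u +o L \<and> int (\<Sum>f\<in>E. c f) = int l}"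
    and "b \<in> {\<Prod>f\<in>E. f ^ c f |c. L + (\<Sum>f\<in>E. \<Sum>i<c f. wpt r n \<Delta> F p f) = u' +o L \<and> int (\<Sum>f\<in>E. c f) = int l'}"
  then obtain c c' :: "'a symalg \<Rightarrow> nat" where a: "a = (\<Prod>f\<in>E. f ^ c f)"
      "L + (\<Sum>f\<in>E. \<Sum>i<c f. wpt r n \<Delta> F p f) = u +o L" "int (\<Sum>f\<in>E. c f) = int l"
    and b: "b = (\<Prod>f\<in>E. f ^ c' f)"
      "L + (\<Sum>f\<in>E. \<Sum>i<c' f. wpt r n \<Delta> F p f) = u' +o L" "int (\<Sum>f\<in>E. c' f) = int l'"
    by blast
  obtain \<beta> where \<beta>: "\<And>f. f \<in> E \<Longrightarrow> in_sec p (\<beta> f) f \<and> \<beta> f \<in> lattice_pts r"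
    using E_point by blast
  then have \<beta>': "\<And>f. f \<in> E \<Longrightarrow> in_sec p (\<beta> f) f" by blast
  define c2 where "c2 = (\<lambda>f. c f + c' f)"
  have "L + (\<Sum>f\<in>E. \<Sum>i<c2 f. wpt r n \<Delta> F p f) = (\<Sum>f\<in>E. qscale (of_nat (c2 f)) (\<beta> f)) +o L"
    by (rule wpt_sum[OF \<beta>'])
  also have "(\<Sum>f\<in>E. qscale (of_nat (c2 f)) (\<beta> f))
      = (\<Sum>f\<in>E. qscale (of_nat (c f)) (\<beta> f)) + (\<Sum>f\<in>E. qscale (of_nat (c' f)) (\<beta> f))"
    by (simp only: c2_def of_nat_add qv.scale_left_distrib sum.distrib)
  also have "\<dots> +o L = (u +o L) + (u' +o L)"
    by (simp only: coset_add[OF subspace_L, symmetric] wpt_sum[OF \<beta>', symmetric] a(2) b(2))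
  also have "\<dots> = (u + u') +o L" by (rule coset_add[OF subspace_L])
  finally have "L + (\<Sum>f\<in>E. \<Sum>i<c2 f. wpt r n \<Delta> F p f) = (u + u') +o L" .
  moreover have "a * b = (\<Prod>f\<in>E. f ^ c2 f)"
    by (simp only: a(1) b(1) c2_def power_add prod.distrib)
  moreover have "int (\<Sum>f\<in>E. c2 f) = int (l + l')"
    using a(3) b(3) by (simp add: c2_def sum.distrib)
  ultimately show "a * b \<in> sv.span {\<Prod>f\<in>E. f ^ c f |c.
      L + (\<Sum>f\<in>E. \<Sum>i<c f. wpt r n \<Delta> F p f) = (u + u') +o L \<and> int (\<Sum>f\<in>E. c f) = int (l + l')}"
    by (intro sv.span_base) blast
qed

lemma A_one: "1 \<in> A 0 0"
  unfolding A_piece_def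
proof (rule sv.span_base, rule CollectI, intro exI[of _ "\<lambda>_. 0"] conjI)
  show "L + (\<Sum>f\<in>E. \<Sum>i<0::nat. wpt r n \<Delta> F p f) = 0 +o L"
    unfolding lessThan_0 sum.empty sum.neutral_const by (simp only: add_0_right set_zero_plus)
qed (simp_all only: power_0 prod.neutral_const sum.neutral_const)

text \<open>A section at \<open>u\<close> is a combination of members of \<open>eps p\<close> with
  the lattice point \<open>u\<close> in their polytopes, and each of these is a product with a
  single factor.\<close>

lemma sec_subset_A:
  assumes u: "u \<in> lattice_pts r"
  shows "sec p u \<subseteq> A u 1"
proof -
  have sub: "sv.subspace (A u 1)" unfolding A_piece_def by (rule sv.subspace_span)
  have "{f \<in> eps p. in_sec p u f} \<subseteq> A u 1"
  proof
    fix f assume "f \<in> {f \<in> eps p. in_sec p u f}"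
    then have f: "f \<in> eps p" "in_sec p u f" by blast+
    have fE: "f \<in> E" by (rule E_memI[OF f u])
    define c where "c = (\<lambda>g. if g = f then 1 else 0 :: nat)"
    obtain \<beta>0 where \<beta>0: "\<And>f. f \<in> E \<Longrightarrow> in_sec p (\<beta>0 f) f \<and> \<beta>0 f \<in> lattice_pts r"
      using E_point by blast
    \<comment> \<open>Only cosets matter, so the point chosen for \<open>f\<close> may be replaced
      by \<open>u\<close>; the sum is then \<open>u\<close> itself.\<close>
    define \<beta> where "\<beta> = \<beta>0(f := u)"
    have \<beta>: "in_sec p (\<beta> g) g" if "g \<in> E" for g using \<beta>0[OF that] f(2) by (simp add: \<beta>_def)
    have pr: "(\<Prod>g\<in>E. g ^ c g) = f"
    proof -
      have "(\<Prod>g\<in>E. g ^ c g) = (\<Prod>g\<in>E. if g = f then f else 1)" by (rule prod.cong) (simp_all add: c_def)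
      then show ?thesis using fE finite_E by simp
    qed
    have "(\<Sum>g\<in>E. qscale (of_nat (c g)) (\<beta> g)) = (\<Sum>g\<in>{f}. qscale (of_nat (c g)) (\<beta> g))"
    proof (rule sum.mono_neutral_right[OF finite_E])
      show "{f} \<subseteq> E" using fE by blast
      show "\<forall>g\<in>E - {f}. qscale (of_nat (c g)) (\<beta> g) = 0"
      proof
        fix g assume "g \<in> E - {f}"
        then have "c g = 0" by (simp add: c_def)
        then show "qscale (of_nat (c g)) (\<beta> g) = 0" by (simp only: of_nat_0 qv.scale_zero_left)
      qed
    qed
    also have "\<dots> = u" by (simp add: c_def \<beta>_def)
    finally have "L + (\<Sum>g\<in>E. \<Sum>i<c g. wpt r n \<Delta> F p g) = u +o L"
      by (simp only: wpt_sum[OF \<beta>])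
    moreover have "int (\<Sum>g\<in>E. c g) = int 1" using fE finite_E by (simp add: c_def)
    ultimately show "f \<in> A u 1"
      unfolding A_piece_def using pr by (intro sv.span_base CollectI exI[of _ c] conjI) simp_all
  qed
  then have "sv.span {f \<in> eps p. in_sec p u f} \<subseteq> A u 1" using sub by (rule sv.span_minimal)
  then show ?thesis using sec_subset_span_eps[OF p u] by blast
qed

lemma A_power: "g \<in> A u 1 \<Longrightarrow> g ^ c \<in> A (qscale (of_nat c) u) c"
proof (induction c)
  case 0
  show ?case using A_one by (simp only: power_0 of_nat_0 qv.scale_zero_left)
next
  case (Suc c)
  then have "g * g ^ c \<in> A (u + qscale (of_nat c) u) (1 + c)" by (intro A_mult)
  moreover have "u + qscale (of_nat c) u = qscale (of_nat (Suc c)) u"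
    by (simp add: qscale_def fun_eq_iff algebra_simps)
  ultimately show ?case by (simp only: power_Suc plus_1_eq_Suc)
qed

lemma A_prod:
  assumes "finite D" "\<And>d. d \<in> D \<Longrightarrow> g d \<in> A (u d) 1"
  shows "(\<Prod>d\<in>D. g d ^ c d) \<in> A (\<Sum>d\<in>D. qscale (of_nat (c d)) (u d)) (\<Sum>d\<in>D. c d)"
  using assms
proof (induction D rule: finite_induct)
  case empty
  show ?case unfolding sum.empty prod.empty by (rule A_one)
next
  case (insert d D)
  have "g d ^ c d \<in> A (qscale (of_nat (c d)) (u d)) (c d)"
    by (rule A_power) (rule insert.prems, rule insertI1)
  moreover have "(\<Prod>d\<in>D. g d ^ c d) \<in> A (\<Sum>d\<in>D. qscale (of_nat (c d)) (u d)) (\<Sum>d\<in>D. c d)"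
    by (rule insert.IH) (rule insert.prems, erule insertI2)
  ultimately show ?case unfolding sum.insert[OF insert.hyps] prod.insert[OF insert.hyps]
    by (rule A_mult)
qed

lemma A_subset_sym_pow: "A_piece r n \<Delta> F eps p w (int l) \<subseteq> sym_pow n (p * l)"
  unfolding A_piece_def
proof (rule sv.span_minimal[OF _ subspace_sym_pow], rule subsetI)
  fix x
  assume "x \<in> {\<Prod>f\<in>E. f ^ c f |c. L + (\<Sum>f\<in>E. \<Sum>i<c f. wpt r n \<Delta> F p f) = w \<and> int (\<Sum>f\<in>E. c f) = int l}"
  then obtain c :: "'a symalg \<Rightarrow> nat" where c: "x = (\<Prod>f\<in>E. f ^ c f)" "int (\<Sum>f\<in>E. c f) = int l" by blast
  obtain \<beta> where \<beta>: "\<And>f. f \<in> E \<Longrightarrow> in_sec p (\<beta> f) f \<and> \<beta> f \<in> lattice_pts r"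
    using E_point by blast
  have "in_sec (\<Sum>f\<in>E. p * c f) (\<Sum>f\<in>E. qscale (of_nat (c f)) (\<beta> f)) (\<Prod>f\<in>E. f ^ c f)"
    by (rule in_sec_prod[OF finite_E], rule in_sec_scale) (use \<beta> in blast)
  moreover have "(\<Sum>f\<in>E. p * c f) = p * l" using c(2) by (simp only: sum_distrib_left[symmetric] of_nat_eq_iff)
  ultimately show "x \<in> sym_pow n (p * l)" using c(1) by (simp add: in_sec_def)
qed

lemma A_lead_mons_finite: "finite (lead_mon ` (A_piece r n \<Delta> F eps p w (int l) - {0}))"
proof (rule finite_subset[OF _ finite_is_mon[of n "p * l"]])
  show "lead_mon ` (A_piece r n \<Delta> F eps p w (int l) - {0}) \<subseteq> {m. is_mon n (p * l) m}"
    using A_subset_sym_pow is_mon_lead_mon by blast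
qed

lemma dim_A: "sv.dim (A_piece r n \<Delta> F eps p w (int l)) = card (lead_mon ` (A_piece r n \<Delta> F eps p w (int l) - {0}))"
proof (rule dim_eq_card_lead_mon[OF _ A_lead_mons_finite])
  show "sv.subspace (A_piece r n \<Delta> F eps p w (int l))" unfolding A_piece_def by (rule sv.subspace_span)
qed

text \<open>The elements are sums of words of length \<open>l\<close> over a finite alphabet.
  Finiteness matters because a sum over an infinite set is 0 by convention.\<close>

lemma finite_Lam_p_slice: "finite {w. (w, int l) \<in> Lam_p r n \<Delta> F eps p}"
proof -
  define W where "W = wpt r n \<Delta> F p ` E"
  have "\<exists>ws. set ws \<subseteq> W \<and> int (length ws) = snd x \<and> fst x = sum_list ws"
    if "x \<in> semigroup_gen (W \<times> {1})" for x
    using that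
  proof induction
    case (base x)
    then show ?case by (intro exI[of _ "[fst x]"]) auto
  next
    case (plus x y)
    then obtain ws vs where "set ws \<subseteq> W" "int (length ws) = snd x" "fst x = sum_list ws"
      "set vs \<subseteq> W" "int (length vs) = snd y" "fst y = sum_list vs" by blast
    then show ?case by (intro exI[of _ "ws @ vs"]) (simp add: fst_add snd_add)
  qed
  then have "{w. (w, int l) \<in> Lam_p r n \<Delta> F eps p} \<subseteq> sum_list ` {ws. set ws \<subseteq> W \<and> length ws = l}"
    unfolding Lam_p_def W_def[symmetric] by fastforce
  moreover have "finite {ws. set ws \<subseteq> W \<and> length ws = l}"
    using finite_E by (intro finite_lists_length_eq) (simp add: W_def)
  ultimately show ?thesis by (meson finite_imageI finite_subset)
qed

lemma Lam_p_sum: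
  assumes "finite D" "\<And>d. d \<in> D \<Longrightarrow> (u d +o L, 1) \<in> Lam_p r n \<Delta> F eps p"
    and l: "(\<Sum>d\<in>D. c d) > (0::nat)"
  shows "((\<Sum>d\<in>D. qscale (of_nat (c d)) (u d)) +o L, int (\<Sum>d\<in>D. c d)) \<in> Lam_p r n \<Delta> F eps p"
proof -
  \<comment> \<open>\<open>Lam_p\<close> comes without a neutral element. \<open>Q\<close> adjoins
    one, so that single exponents may be 0; the positive total excludes it in the end.\<close>
  define Q where "Q = (\<lambda>u l. (l = 0 \<and> u = 0) \<or> (u +o L, int l) \<in> Lam_p r n \<Delta> F eps p)"
  have Q_add: "Q (u + u') (l + l')" if q: "Q u l" "Q u' l'" for u u' l l'
  proof -
    consider "l = 0 \<and> u = 0" | "l' = 0 \<and> u' = 0"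
      | "(u +o L, int l) \<in> Lam_p r n \<Delta> F eps p" "(u' +o L, int l') \<in> Lam_p r n \<Delta> F eps p"
      using q unfolding Q_def by blast
    then show ?thesis
    proof cases
      case 1
      then show ?thesis using q(2) by (simp only: add_0_left)
    next
      case 2
      then show ?thesis using q(1) by (simp only: add_0_right)
    next
      case 3
      then have "(u +o L, int l) + (u' +o L, int l') \<in> Lam_p r n \<Delta> F eps p"
        unfolding Lam_p_def by (rule semigroup_gen.plus)
      then show ?thesis unfolding Q_def plus_prod_def fst_conv snd_conv coset_add[OF subspace_L]
        by (simp only: of_nat_add simp_thms)
    qed
  qed
  have Q0: "Q 0 0" unfolding Q_def by blast
  have Q_scale: "Q (qscale (of_nat c) v) c" if "(v +o L, 1) \<in> Lam_p r n \<Delta> F eps p" for v c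
  proof (induction c)
    case 0
    show ?case using Q0 by (simp only: of_nat_0 qv.scale_zero_left)
  next
    case (Suc c)
    have "Q v 1" using that unfolding Q_def by (simp only: of_nat_1 simp_thms)
    then have "Q (v + qscale (of_nat c) v) (1 + c)" using Suc by (rule Q_add)
    moreover have "v + qscale (of_nat c) v = qscale (of_nat (Suc c)) v"
      by (simp add: qscale_def fun_eq_iff algebra_simps)
    ultimately show ?case by (simp only: plus_1_eq_Suc)
  qed
  have "Q (\<Sum>d\<in>D'. qscale (of_nat (c d)) (u d)) (\<Sum>d\<in>D'. c d)" if "D' \<subseteq> D" for D'
    using finite_subset[OF that assms(1)] that
  proof (induction D' rule: finite_induct)
    case empty
    show ?case using Q0 by (simp only: sum.empty)
  next
    case (insert d D')
    have "Q (qscale (of_nat (c d)) (u d)) (c d)" by (rule Q_scale) (use insert.prems assms(2) in blast)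
    moreover have "Q (\<Sum>d\<in>D'. qscale (of_nat (c d)) (u d)) (\<Sum>d\<in>D'. c d)"
      by (rule insert.IH) (use insert.prems in blast)
    ultimately show ?case unfolding sum.insert[OF insert.hyps] by (rule Q_add)
  qed
  then have "Q (\<Sum>d\<in>D. qscale (of_nat (c d)) (u d)) (\<Sum>d\<in>D. c d)" by blast
  then show ?thesis using l unfolding Q_def by auto
qed

end

end

section \<open>Weights independent modulo \<open>L\<close>\<close>

lemma lookup_lead_mon_power:
  "f \<noteq> 0 \<Longrightarrow> Poly_Mapping.lookup (lead_mon (f ^ c)) i = c * Poly_Mapping.lookup (lead_mon f) i"
  by (induction c) (simp_all add: lead_mon_one lead_mon_mult lookup_add)

lemma lookup_lead_mon_prod:
  assumes "finite D" "\<And>d. d \<in> D \<Longrightarrow> g d \<noteq> 0"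
  shows "Poly_Mapping.lookup (lead_mon (\<Prod>d\<in>D. g d ^ c d)) i
    = (\<Sum>d\<in>D. c d * Poly_Mapping.lookup (lead_mon (g d)) i)"
  using assms by (subst lead_mon_prod) (simp_all add: lookup_sum lookup_lead_mon_power)

context toric
begin

text \<open>A basis of \<open>L\<close> is completed by weights to a basis \<open>B\<close> of the
  whole space, and \<open>D\<close> consists of the added weights. Passing to powers multiplies each
  of them by a positive number, which preserves independence modulo \<open>L\<close>.\<close>

lemma independent_sections:
  assumes span: "qv.span (vec ` (\<Union>l\<in>{0<..}. weights l)) = qspace (r + n)"
  shows "\<exists>p>0. \<exists>(D :: qvec set) U g. finite D \<and> r + n \<le> card D + qv.dim L \<and>
    (\<forall>d\<in>D. U d \<in> lattice_pts r \<and> g d \<in> sec p (U d) \<and> g d \<noteq> 0) \<and>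
    (\<forall>a. (\<Sum>d\<in>D. qscale (a d) (vec (U d, lead_mon (g d)))) \<in> L \<longrightarrow> (\<forall>d\<in>D. a d = 0))"
proof -
  define V where "V = vec ` (\<Union>l\<in>{0<..}. weights l)"
  obtain BL where BL: "BL \<subseteq> L" "qv.independent BL" "L \<subseteq> qv.span BL"
    by (rule qv.maximal_independent_subset)
  have spBL: "qv.span BL = L" using qv.span_minimal[OF BL(1) subspace_L] BL(3) by blast
  have cBL: "card BL = qv.dim L" by (rule qv.basis_card_eq_dim[OF BL(1,3,2)])
  have "BL \<subseteq> BL \<union> V" by blast
  then obtain B where B: "BL \<subseteq> B" "B \<subseteq> BL \<union> V" "qv.independent B" "BL \<union> V \<subseteq> qv.span B"
    by (rule qv.maximal_independent_subset_extend[OF _ BL(2)])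
  have "V \<subseteq> qspace (r + n)" using qv.span_superset[of V] span unfolding V_def by simp
  moreover have "L \<subseteq> qspace (r + n)" using L_subset_qspace by (auto simp: qspace_def)
  ultimately have "B \<subseteq> qspace (r + n)" using B(2) BL(1) by blast
  then have finB: "finite B" using independent_in_qspace(1) B(3) by blast
  have "qv.span V \<subseteq> qv.span B" by (rule qv.span_minimal[OF _ qv.subspace_span]) (use B(4) in blast)
  then have cB: "r + n \<le> card B"
    using card_spanning_qspace[OF finB] span unfolding V_def by simp
  define D where "D = B - BL"
  have finD: "finite D" and finBL: "finite BL" using finB B(1) finite_subset by (auto simp: D_def)
  have "card D = card B - card BL" unfolding D_def using finBL B(1) by (rule card_Diff_subset)
  then have cD: "r + n \<le> card D + qv.dim L" using cB cBL by linarith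
  have "\<forall>d\<in>D. \<exists>l u g. l > 0 \<and> u \<in> lattice_pts r \<and> g \<in> sec l u \<and> g \<noteq> 0 \<and> d = vec (u, lead_mon g)"
  proof
    fix d assume "d \<in> D"
    then have "d \<in> V" using B(2) by (auto simp: D_def)
    then obtain l x where x: "l > 0" "x \<in> weights l" "d = vec x" unfolding V_def by auto
    obtain u g m where g: "x = (u, m)" "u \<in> lattice_pts r" "g \<in> sec l u" "g \<noteq> 0" "m = lead_mon g"
      by (rule weightsE[OF x(2)])
    show "\<exists>l u g. l > 0 \<and> u \<in> lattice_pts r \<and> g \<in> sec l u \<and> g \<noteq> 0 \<and> d = vec (u, lead_mon g)"
      using x(1,3) g by blast
  qed
  from bchoice[OF this] obtain l where
    "\<forall>d\<in>D. \<exists>u g. l d > 0 \<and> u \<in> lattice_pts r \<and> g \<in> sec (l d) u \<and> g \<noteq> 0 \<and> d = vec (u, lead_mon g)" ..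
  from bchoice[OF this] obtain u where
    "\<forall>d\<in>D. \<exists>g. l d > 0 \<and> u d \<in> lattice_pts r \<and> g \<in> sec (l d) (u d) \<and> g \<noteq> 0 \<and> d = vec (u d, lead_mon g)" ..
  from bchoice[OF this] obtain g where
    g: "\<forall>d\<in>D. l d > 0 \<and> u d \<in> lattice_pts r \<and> g d \<in> sec (l d) (u d) \<and> g d \<noteq> 0 \<and> d = vec (u d, lead_mon (g d))" ..
  \<comment> \<open>A common multiple of the degrees: the power of \<open>g d\<close> with exponent
    \<open>q d\<close> has degree p.\<close>
  define p where "p = (\<Prod>d\<in>D. l d)"
  define q where "q = (\<lambda>d. p div l d)"
  have p: "p > 0" unfolding p_def using g by (intro prod_pos) blast
  have lq: "l d * q d = p" if "d \<in> D" for d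
    unfolding q_def by (rule dvd_mult_div_cancel) (unfold p_def, rule dvd_prodI[OF finD that])
  have q: "q d > 0" if "d \<in> D" for d using lq[OF that] p by (metis gr0I mult_0_right)
  define U where "U = (\<lambda>d. qscale (of_nat (q d)) (u d))"
  define h where "h = (\<lambda>d. g d ^ q d)"
  have h: "U d \<in> lattice_pts r \<and> h d \<in> sec p (U d) \<and> h d \<noteq> 0" if "d \<in> D" for d
  proof (intro conjI)
    show "U d \<in> lattice_pts r" using g that by (auto simp: U_def lattice_pts_def qspace_def qscale_def)
    have "g d \<in> sec (l d) (u d)" using g that by blast
    then show "h d \<in> sec p (U d)" unfolding U_def h_def lq[OF that, symmetric] by (rule sec_power)
    show "h d \<noteq> 0" using g that by (simp add: h_def)
  qed
  have vh: "vec (U d, lead_mon (h d)) = qscale (of_nat (q d)) d" if "d \<in> D" for d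
  proof -
    have d: "d = vec (u d, lead_mon (g d))" "g d \<noteq> 0" using g that by blast+
    have "vec (U d, lead_mon (h d)) = qscale (of_nat (q d)) (vec (u d, lead_mon (g d)))"
      by (rule ext) (simp add: vec_def qscale_def U_def h_def lookup_lead_mon_power[OF d(2)])
    then show ?thesis using d(1) by simp
  qed
  have ind: "\<forall>d\<in>D. a d = 0" if s: "(\<Sum>d\<in>D. qscale (a d) (vec (U d, lead_mon (h d)))) \<in> L" for a
  proof
    fix d assume d: "d \<in> D"
    have "(\<Sum>d\<in>D. qscale (a d) (vec (U d, lead_mon (h d)))) \<in> qv.span BL" using s spBL by simp
    then obtain t where t: "(\<Sum>d\<in>D. qscale (a d) (vec (U d, lead_mon (h d)))) = (\<Sum>b\<in>BL. qscale (t b) b)"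
      unfolding qv.span_finite[OF finBL] by blast
    \<comment> \<open>The coefficients of a single vanishing combination of \<open>B\<close>,
      obtained by moving the element of \<open>L\<close> to the other side.\<close>
    define z where "z = (\<lambda>b. if b \<in> D then a b * of_nat (q b) else - t b)"
    have "(\<Sum>b\<in>D. qscale (z b) b) = (\<Sum>d\<in>D. qscale (a d) (vec (U d, lead_mon (h d))))"
      by (rule sum.cong[OF refl]) (simp add: z_def vh)
    moreover have "(\<Sum>b\<in>BL. qscale (z b) b) = - (\<Sum>b\<in>BL. qscale (t b) b)"
      unfolding sum_negf[symmetric] by (rule sum.cong[OF refl]) (simp add: z_def D_def)
    moreover have "(\<Sum>b\<in>B. qscale (z b) b) = (\<Sum>b\<in>D. qscale (z b) b) + (\<Sum>b\<in>BL. qscale (z b) b)"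
      unfolding D_def by (rule sum.subset_diff[OF B(1) finB])
    ultimately have "(\<Sum>b\<in>B. qscale (z b) b) = 0" using t by simp
    moreover have "d \<in> B" using d by (simp add: D_def)
    ultimately have "z d = 0" using qv.independentD[OF B(3) finB order.refl] by blast
    then show "a d = 0" using d q[OF d] by (simp add: z_def)
  qed
  show ?thesis
    using p finD cD h ind by (intro exI[of _ p] conjI exI[of _ D] exI[of _ U] exI[of _ h]) auto
qed

text \<open>Without variables there are no nonzero forms of positive degree. For positive rank, at
  least one weight outside \<open>L\<close> is available, as \<open>dim L\<close> is at most
  r.\<close>

lemma not_big_rank_0:
  assumes "n = 0"
  shows "\<not> big r n \<Delta> F"
proof
  assume "big r n \<Delta> F"
  then obtain \<epsilon> :: real where \<epsilon>: "\<epsilon> > 0" "\<exists>\<^sub>F l in sequentially.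
      real (card (weights l)) / real l powi (int r + int n - 1) \<ge> \<epsilon>"
    unfolding big_def dim_global_sections limsup_ereal_pos_iff by blast
  have "weights l = {}" if "l \<ge> 1" for l
  proof (rule ccontr)
    assume "weights l \<noteq> {}"
    then obtain x where x: "x \<in> weights l" by blast
    obtain m where "is_mon n l m" by (rule weightsE[OF x])
    then show False using assms that by (simp add: is_mon_def)
  qed
  then have "\<forall>\<^sub>F l in sequentially. \<not> real (card (weights l)) / real l powi (int r + int n - 1) \<ge> \<epsilon>"
    unfolding eventually_sequentially using \<epsilon>(1) by (intro exI[of _ 1]) simp
  then show False using \<epsilon>(2) by (simp add: frequently_def)
qed

end

context toric_family
begin

definition alpha_sum :: "nat \<Rightarrow> nat \<Rightarrow> real" where
  "alpha_sum p l = (\<Sum>w\<in>{w \<in> Lam r n \<Delta> F. (w, int l) \<in> Lam_p r n \<Delta> F eps p}.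
    real (sv.dim (A_piece r n \<Delta> F eps p w (int l))))"

lemma alpha_pos_iff:
  "alpha r n \<Delta> F eps p > 0 \<longleftrightarrow> (\<exists>\<epsilon>>0. \<exists>\<^sub>F l in sequentially.
    alpha_sum p l / real l powi (int r - int (qv.dim L) + int n - 1) \<ge> \<epsilon>)"
  unfolding alpha_def alpha_sum_def[symmetric] by (rule limsup_ereal_pos_iff)

text \<open>Counting pairs of a point w and a leading monomial in its piece lets injections of
  finite sets prove inequalities for \<open>alpha\<close>, in both directions.\<close>

lemma alpha_sum_eq_card:
  assumes p: "p > 0"
  shows "alpha_sum p l = real (card (SIGMA w:{w \<in> Lam r n \<Delta> F. (w, int l) \<in> Lam_p r n \<Delta> F eps p}.
    lead_mon ` (A_piece r n \<Delta> F eps p w (int l) - {0})))"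
proof -
  have "finite {w \<in> Lam r n \<Delta> F. (w, int l) \<in> Lam_p r n \<Delta> F eps p}"
    by (rule finite_subset[OF _ finite_Lam_p_slice[OF p, of l]]) blast
  then show ?thesis
    unfolding alpha_sum_def dim_A[OF p] using A_lead_mons_finite[OF p] by simp
qed

lemma big_imp_alpha:
  assumes big: "big r n \<Delta> F"
  shows "\<exists>p>0. alpha r n \<Delta> F eps p > 0"
proof -
  have n: "n > 0" using not_big_rank_0 big by blast
  obtain p and D :: "qvec set" and U g where p: "p > 0" and D: "finite D" "r + n \<le> card D + qv.dim L"
    and g: "\<forall>d\<in>D. U d \<in> lattice_pts r \<and> g d \<in> sec p (U d) \<and> g d \<noteq> 0"
    and ind: "\<forall>a. (\<Sum>d\<in>D. qscale (a d) (vec (U d, lead_mon (g d)))) \<in> L \<longrightarrow> (\<forall>d\<in>D. a d = 0)"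
    using independent_sections[OF big_imp_span[OF big]] by (elim exE conjE)
  have "qv.dim L \<le> r"
  proof -
    obtain BL where BL: "BL \<subseteq> L" "qv.independent BL" "L \<subseteq> qv.span BL" "card BL = qv.dim L"
      by (rule qv.basis_exists)
    have "BL \<subseteq> qspace r" using BL(1) L_subset_qspace by blast
    then show ?thesis using independent_in_qspace(2)[OF BL(2)] BL(4) by simp
  qed
  then have D0: "D \<noteq> {}" using D(2) n by auto
  have gA: "g d \<in> A p (U d) 1" "g d \<noteq> 0" if "d \<in> D" for d
    using g that sec_subset_A[OF p, of "U d"] by blast+
  \<comment> \<open>\<open>g d\<close> is only a combination of members of \<open>eps p\<close>. One
    member with \<open>U d\<close> in its polytope is enough for the coset of \<open>U d\<close> to
    be a generator of \<open>Lam_p\<close>.\<close>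
  have base: "\<exists>f. f \<in> E p \<and> in_sec p (U d) f" if d: "d \<in> D" for d
  proof -
    have "g d \<in> sv.span {f \<in> eps p. in_sec p (U d) f}"
      using sec_subset_span_eps[OF p, of "U d"] g d by blast
    then have "{f \<in> eps p. in_sec p (U d) f} \<noteq> {}"
      using gA(2)[OF d] sv.span_empty by (metis singletonD)
    then obtain f where "f \<in> eps p" "in_sec p (U d) f" by blast
    then show ?thesis using E_memI[OF p] g d by blast
  qed
  define W where "W = (\<lambda>l. {w \<in> Lam r n \<Delta> F. (w, int l) \<in> Lam_p r n \<Delta> F eps p})"
  define T where "T = (\<lambda>l. SIGMA w:W l. lead_mon ` (A_piece r n \<Delta> F eps p w (int l) - {0}))"
  define u where "u = (\<lambda>c :: qvec \<Rightarrow> nat. \<Sum>d\<in>D. qscale (of_nat (c d)) (U d))"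
  define G where "G = (\<lambda>c. \<Prod>d\<in>D. g d ^ c d)"
  have T_mem: "(u c +o L, lead_mon (G c)) \<in> T l" if c: "(\<Sum>d\<in>D. c d) = l" and l: "l \<ge> 1" for c l
  proof -
    have pos: "(\<Sum>d\<in>D. c d) > 0" using c l by linarith
    have "(U d +o L, 1) \<in> Lam_p r n \<Delta> F eps p" if d: "d \<in> D" for d
    proof -
      obtain f where f: "f \<in> E p" "in_sec p (U d) f" using base[OF d] by blast
      have "U d +o L = wpt r n \<Delta> F p f" by (rule wpt_eq[OF p f(2), symmetric])
      then show ?thesis unfolding Lam_p_def using f(1) by (intro semigroup_gen.base) blast
    qed
    then have "(u c +o L, int l) \<in> Lam_p r n \<Delta> F eps p"
      unfolding u_def c[symmetric] by (rule Lam_p_sum[OF p D(1) _ pos])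
    moreover have "u c +o L \<in> Lam r n \<Delta> F"
    proof -
      obtain f where f: "\<And>d. d \<in> D \<Longrightarrow> in_sec p (U d) (f d)" using base by metis
      have "in_sec (\<Sum>d\<in>D. p * c d) (\<Sum>d\<in>D. qscale (of_nat (c d)) (U d)) (\<Prod>d\<in>D. f d ^ c d)"
        by (rule in_sec_prod[OF D(1)], rule in_sec_scale, rule f)
      moreover have "(\<Sum>d\<in>D. p * c d) > 0" using p c l by (simp add: sum_distrib_left[symmetric])
      ultimately show ?thesis unfolding u_def by (intro Lam_memI)
    qed
    moreover have "G c \<in> A p (u c) l"
      unfolding G_def u_def c[symmetric] by (rule A_prod[OF p D(1) gA(1)])
    moreover have "G c \<noteq> 0" unfolding G_def using gA(2) D(1) by simp
    ultimately show ?thesis unfolding T_def W_def by blast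
  qed
  \<comment> \<open>Equal cosets put the difference of the characters into \<open>L\<close>; equal
    leading monomials make its exponent coordinates vanish. So the weights satisfy a relation modulo
    \<open>L\<close> with coefficients \<open>c d - c' d\<close>.\<close>
  have inj: "c = c'" if cc': "(u c +o L, lead_mon (G c)) = (u c' +o L, lead_mon (G c'))"
    "\<forall>d. d \<notin> D \<longrightarrow> c d = 0" "\<forall>d. d \<notin> D \<longrightarrow> c' d = 0" for c c'
  proof -
    define a where "a = (\<lambda>d. of_nat (c d) - of_nat (c' d) :: rat)"
    have "u c +o L = u c' +o L" using cc'(1) by (rule Pair_inject)
    then have uL: "u c - u c' \<in> L" by (simp only: coset_eq_iff[OF subspace_L])
    have Geq: "lead_mon (G c) = lead_mon (G c')" using cc'(1) by (rule Pair_inject)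
    have m: "(\<Sum>d\<in>D. c d * Poly_Mapping.lookup (lead_mon (g d)) i)
      = (\<Sum>d\<in>D. c' d * Poly_Mapping.lookup (lead_mon (g d)) i)" for i
    proof -
      have G_lookup: "Poly_Mapping.lookup (lead_mon (G c)) i = (\<Sum>d\<in>D. c d * Poly_Mapping.lookup (lead_mon (g d)) i)" for c
        unfolding G_def by (rule lookup_lead_mon_prod[OF D(1) gA(2)])
      show ?thesis unfolding G_lookup[symmetric] Geq by (rule refl)
    qed
    have "(\<Sum>d\<in>D. qscale (a d) (vec (U d, lead_mon (g d)))) = u c - u c'"
    proof (rule ext)
      fix i
      have Ui: "U d i = 0" if "d \<in> D" "i \<ge> r" for d
      proof -
        have "U d \<in> lattice_pts r" using bspec[OF g that(1)] by (rule conjunct1)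
        then show ?thesis using that(2) by (simp add: lattice_pts_def qspace_def)
      qed
      have rhs: "(u c - u c') i = (\<Sum>d\<in>D. a d * U d i)"
        by (simp add: u_def sum_qvec_apply qscale_def a_def algebra_simps sum_subtractf)
      have lhs: "(\<Sum>d\<in>D. qscale (a d) (vec (U d, lead_mon (g d)))) i
          = (\<Sum>d\<in>D. a d * vec (U d, lead_mon (g d)) i)"
        by (simp add: sum_qvec_apply qscale_def)
      consider "i < r" | "r \<le> i" "i < r + n" | "r + n \<le> i" by linarith
      then show "(\<Sum>d\<in>D. qscale (a d) (vec (U d, lead_mon (g d)))) i = (u c - u c') i"
      proof cases
        case 1
        then show ?thesis unfolding lhs rhs by (simp add: vec_def)
      next
        case 2
        have "(\<Sum>d\<in>D. a d * of_nat (Poly_Mapping.lookup (lead_mon (g d)) (i - r)))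
          = of_nat (\<Sum>d\<in>D. c d * Poly_Mapping.lookup (lead_mon (g d)) (i - r))
            - of_nat (\<Sum>d\<in>D. c' d * Poly_Mapping.lookup (lead_mon (g d)) (i - r))"
          by (simp add: a_def algebra_simps sum_subtractf)
        also have "\<dots> = 0" unfolding m by simp
        finally show ?thesis unfolding lhs rhs using 2 Ui by (simp add: vec_def)
      next
        case 3
        then show ?thesis unfolding lhs rhs using Ui by (simp add: vec_def)
      qed
    qed
    then have "(\<Sum>d\<in>D. qscale (a d) (vec (U d, lead_mon (g d)))) \<in> L" using uL by simp
    then have "\<forall>d\<in>D. a d = 0" using ind by blast
    then have "c d = c' d" if "d \<in> D" for d using that by (simp add: a_def)
    then show "c = c'" using cc'(2,3) by (intro ext) metis
  qed
  have num: "(real l / real (card D)) ^ (card D - 1) \<le> alpha_sum p l" if l: "l \<ge> 1" for l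
  proof -
    obtain Cs where Cs: "finite Cs" "\<forall>c\<in>Cs. (\<Sum>d\<in>D. c d) = l \<and> (\<forall>d. d \<notin> D \<longrightarrow> c d = 0)"
      "(real l / real (card D)) ^ (card D - 1) \<le> real (card Cs)"
      using card_compositions_ge[OF D(1) D0, of l] by blast
    have "inj_on (\<lambda>c. (u c +o L, lead_mon (G c))) Cs"
      by (rule inj_onI) (rule inj, use Cs(2) in auto)
    then have "card Cs = card ((\<lambda>c. (u c +o L, lead_mon (G c))) ` Cs)" by (simp only: card_image)
    also have "\<dots> \<le> card (T l)"
    proof (rule card_mono)
      have "finite (W l)" unfolding W_def
        by (rule finite_subset[OF _ finite_Lam_p_slice[OF p, of l]]) blast
      then show "finite (T l)" unfolding T_def using A_lead_mons_finite[OF p] by blast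
      show "(\<lambda>c. (u c +o L, lead_mon (G c))) ` Cs \<subseteq> T l"
        by (rule image_subsetI, rule T_mem) (use Cs(2) l in auto)
    qed
    finally have "card Cs \<le> card (T l)" .
    then show ?thesis using Cs(3) alpha_sum_eq_card[OF p, of l] unfolding T_def W_def by linarith
  qed
  define k where "k = card D"
  have k: "k \<ge> 1" using D(1) D0 by (simp add: k_def Suc_le_eq card_gt_0_iff)
  define \<epsilon> where "\<epsilon> = (1 / real k) ^ (k - 1)"
  have "\<epsilon> > 0" using k by (simp add: \<epsilon>_def)
  moreover have "\<epsilon> \<le> alpha_sum p l / real l powi (int r - int (qv.dim L) + int n - 1)" if l: "l \<ge> 1" for l
  proof -
    have pos: "real l powi (int r - int (qv.dim L) + int n - 1) > 0" using l by (simp add: zero_less_power_int)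
    \<comment> \<open>There may be more weights than the exponent asks for; for \<open>l\<close> at
      least 1 this only helps.\<close>
    have "real l powi (int r - int (qv.dim L) + int n - 1) \<le> real l powi (int (k - 1))"
      using l D(2) k by (intro power_int_increasing) (auto simp: k_def)
    then have "\<epsilon> * real l powi (int r - int (qv.dim L) + int n - 1) \<le> \<epsilon> * real l ^ (k - 1)"
      using \<open>\<epsilon> > 0\<close> by (simp only: power_int_of_nat mult_le_cancel_left_pos)
    also have "\<dots> = (real l / real k) ^ (k - 1)"
      by (simp add: \<epsilon>_def power_mult_distrib[symmetric])
    also have "\<dots> \<le> alpha_sum p l" using num[OF l] by (simp add: k_def)
    finally show ?thesis using pos by (simp add: pos_le_divide_eq)
  qed
  then have "\<forall>\<^sub>F l in sequentially. alpha_sum p l / real l powi (int r - int (qv.dim L) + int n - 1) \<ge> \<epsilon>"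
    unfolding eventually_sequentially by blast
  then have "\<exists>\<^sub>F l in sequentially. alpha_sum p l / real l powi (int r - int (qv.dim L) + int n - 1) \<ge> \<epsilon>"
    by (rule eventually_frequently[rotated]) simp
  ultimately show ?thesis using p alpha_pos_iff by blast
qed

end

section \<open>Positivity of \<open>\<alpha>\<close> implies bigness\<close>

lemma diff_eq_diff_if_add_eq_add: "a + b = c + d \<Longrightarrow> a - c = d - b" for a :: "'a::ab_group_add"
  by (simp add: algebra_simps)

lemma common_denominator:
  assumes "finite V" "V \<subseteq> qspace r"
  shows "\<exists>N::nat. N > 0 \<and> (\<forall>v\<in>V. qscale (of_nat N) v \<in> lattice_pts r)"
proof -
  define den where "den = (\<lambda>x :: rat. nat (snd (quotient_of x)))"
  have den: "den x > 0 \<and> of_nat (den x) * x \<in> \<int>" for x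
  proof -
    obtain a b where q: "quotient_of x = (a, b)" by (cases "quotient_of x")
    have b: "b > 0" using quotient_of_denom_pos[OF q] .
    have "x = of_int a / of_int b" by (rule quotient_of_div[OF q])
    then have "of_nat (den x) * x = of_int a" using b q by (simp add: den_def)
    then show ?thesis using b q by (simp add: den_def)
  qed
  define N where "N = (\<Prod>v\<in>V. \<Prod>i<r. den (v i))"
  have "N > 0" unfolding N_def using den by (intro prod_pos) blast
  moreover have "qscale (of_nat N) v \<in> lattice_pts r" if v: "v \<in> V" for v
  proof -
    have "of_nat N * v i \<in> \<int>" for i
    proof (cases "i < r")
      case True
      have "den (v i) dvd (\<Prod>i<r. den (v i))" using True by (intro dvd_prodI) auto
      also have "\<dots> dvd N" unfolding N_def by (rule dvd_prodI[OF assms(1) v])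
      finally obtain k where k: "N = den (v i) * k" by (rule dvdE)
      have "of_nat N * v i = of_nat k * (of_nat (den (v i)) * v i)" by (simp add: k)
      also have "\<dots> \<in> \<int>" by (rule Ints_mult[OF Ints_of_nat conjunct2[OF den]])
      finally show ?thesis .
    next
      case False
      then have "v i = 0" using v assms(2) by (auto simp: qspace_def)
      then show ?thesis by simp
    qed
    moreover have "\<forall>i\<ge>r. v i = 0" using v assms(2) by (auto simp: qspace_def)
    ultimately show ?thesis by (simp add: lattice_pts_def qspace_def qscale_def)
  qed
  ultimately show ?thesis by blast
qed

context toric
begin

text \<open>
  The \<open>\<delta> b\<close> form a basis of \<open>L\<close> with coordinate functions \<open>\<tau> b\<close>, each realised as a segment in
  the polytope of the form \<open>G b\<close>.  They consist of lattice vectors but need not span \<open>L \<inter> M\<close>.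
\<close>

lemma L_frame:
  "\<exists>(B :: qvec set) P G \<alpha> \<delta> \<tau>. finite B \<and> card B = qv.dim L \<and>
    (\<forall>b\<in>B. in_sec (P b) (\<alpha> b) (G b) \<and> in_sec (P b) (\<alpha> b + \<delta> b) (G b) \<and>
      \<alpha> b \<in> lattice_pts r \<and> \<delta> b \<in> lattice_pts r \<and> \<delta> b \<in> L) \<and>
    (\<forall>b x y. \<tau> b (x + y) = \<tau> b x + \<tau> b y) \<and> (\<forall>b c x. \<tau> b (qscale c x) = c * \<tau> b x) \<and>
    (\<forall>b\<in>B. \<forall>b'\<in>B. \<tau> b (\<delta> b') = (if b' = b then 1 else 0 :: rat)) \<and>
    (\<forall>x\<in>L. x = (\<Sum>b\<in>B. qscale (\<tau> b x) (\<delta> b)))"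
proof -
  define Gen where "Gen = {a - b | a b. \<exists>f p. p > 0 \<and> in_sec p a f \<and> in_sec p b f}"
  obtain B where B: "B \<subseteq> Gen" "qv.independent B" "Gen \<subseteq> qv.span B"
    by (rule qv.maximal_independent_subset)
  have "qv.span Gen = L" unfolding Gen_def by (rule L_generators[symmetric])
  moreover have "qv.span B = qv.span Gen"
    using B(1,3) by (metis qv.span_eq qv.span_superset subset_trans)
  ultimately have spB: "qv.span B = L" by simp
  have BL: "B \<subseteq> L" using qv.span_superset[of B] spB by simp
  have finB: "finite B"
    by (rule independent_in_qspace(1)[OF B(2)]) (use BL L_subset_qspace in blast)
  have cB: "card B = qv.dim L" unfolding spB[symmetric] by (rule qv.dim_span_eq_card_independent[OF B(2), symmetric])
  have "\<forall>b\<in>B. \<exists>x y f p. in_sec p x f \<and> in_sec p y f \<and> b = y - x" using B(1) unfolding Gen_def by blast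
  from bchoice[OF this] obtain x where "\<forall>b\<in>B. \<exists>y f p. in_sec p (x b) f \<and> in_sec p y f \<and> b = y - x b" ..
  from bchoice[OF this] obtain y where "\<forall>b\<in>B. \<exists>f p. in_sec p (x b) f \<and> in_sec p (y b) f \<and> b = y b - x b" ..
  from bchoice[OF this] obtain f where "\<forall>b\<in>B. \<exists>p. in_sec p (x b) (f b) \<and> in_sec p (y b) (f b) \<and> b = y b - x b" ..
  from bchoice[OF this] obtain p where f: "\<forall>b\<in>B. in_sec (p b) (x b) (f b) \<and> in_sec (p b) (y b) (f b) \<and> b = y b - x b" ..
  have "x ` B \<union> B \<subseteq> qspace r" using f in_sec_qspace BL L_subset_qspace by blast
  \<comment> \<open>\<open>N\<close> clears the denominators of the basis of \<open>L\<close> and of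
    the base points \<open>x b\<close>, at the price of passing to the powers
    \<open>f b ^ N\<close>. The coordinate functions are divided by \<open>N\<close> to
    match.\<close>
  then obtain N :: nat where N: "N > 0" "\<forall>v\<in>x ` B \<union> B. qscale (of_nat N) v \<in> lattice_pts r"
    using common_denominator[of "x ` B \<union> B" r] finB by blast
  have "\<forall>b\<in>B. \<exists>g :: qvec \<Rightarrow> rat. (\<forall>x y. g (x + y) = g x + g y) \<and> (\<forall>c x. g (qscale c x) = c * g x) \<and>
    g b = 1 \<and> (\<forall>b'\<in>B. b' \<noteq> b \<longrightarrow> g b' = 0)"
    using coordinate_functional[OF B(2)] by blast
  from bchoice[OF this] obtain g :: "qvec \<Rightarrow> qvec \<Rightarrow> rat" where
    g: "\<forall>b\<in>B. (\<forall>x y. g b (x + y) = g b x + g b y) \<and> (\<forall>c x. g b (qscale c x) = c * g b x) \<and>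
    g b b = 1 \<and> (\<forall>b'\<in>B. b' \<noteq> b \<longrightarrow> g b b' = 0)" ..
  \<comment> \<open>The value 0 for indices outside \<open>B\<close> makes linearity hold for every
    index.\<close>
  define \<tau> where "\<tau> = (\<lambda>b x. if b \<in> B then g b x / of_nat N else 0)"
  define \<delta> where "\<delta> = (\<lambda>b :: qvec. qscale (of_nat N) b)"
  define \<alpha> where "\<alpha> = (\<lambda>b. qscale (of_nat N) (x b))"
  have gadd: "g b (v + w) = g b v + g b w" and gscale: "g b (qscale c v) = c * g b v" if "b \<in> B" for b v w c
    using g that by blast+
  have gb: "g b b' = (if b' = b then 1 else 0)" if "b \<in> B" "b' \<in> B" for b b'
    using g that by simp
  show ?thesis
  proof (rule exI[of _ B], rule exI[of _ "\<lambda>b. p b * N"], rule exI[of _ "\<lambda>b. f b ^ N"],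
      rule exI[of _ \<alpha>], rule exI[of _ \<delta>], rule exI[of _ \<tau>], intro conjI ballI allI)
    show "finite B" by (rule finB)
    show "card B = qv.dim L" by (rule cB)
    fix b assume b: "b \<in> B"
    then have fb: "in_sec (p b) (x b) (f b)" "in_sec (p b) (y b) (f b)" "b = y b - x b" using f by blast+
    show "in_sec (p b * N) (\<alpha> b) (f b ^ N)" unfolding \<alpha>_def by (rule in_sec_scale[OF fb(1)])
    have "\<alpha> b + \<delta> b = qscale (of_nat N) (x b + (y b - x b))"
      unfolding \<alpha>_def \<delta>_def qv.scale_right_distrib[symmetric] using fb(3) by (simp only:)
    then have "\<alpha> b + \<delta> b = qscale (of_nat N) (y b)" by simp
    then show "in_sec (p b * N) (\<alpha> b + \<delta> b) (f b ^ N)" using in_sec_scale[OF fb(2)] by (simp only:)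
    show "\<alpha> b \<in> lattice_pts r" unfolding \<alpha>_def using N(2) b by blast
    show "\<delta> b \<in> lattice_pts r" unfolding \<delta>_def using N(2) b by blast
    show "\<delta> b \<in> L" unfolding \<delta>_def using BL b qv.subspace_scale[OF subspace_L] by blast
  next
    show "\<tau> b (v + w) = \<tau> b v + \<tau> b w" for b v w
      by (cases "b \<in> B") (simp_all only: \<tau>_def gadd add_divide_distrib add_0_right if_True if_False)
  next
    show "\<tau> b (qscale c v) = c * \<tau> b v" for b c v
      by (cases "b \<in> B") (simp_all only: \<tau>_def gscale times_divide_eq_right mult_zero_right if_True if_False)
  next
    fix b b' assume "b \<in> B" "b' \<in> B"
    then show "\<tau> b (\<delta> b') = (if b' = b then 1 else 0)"
      using N(1) by (simp add: \<tau>_def \<delta>_def gscale gb)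
  next
    fix v assume "v \<in> L"
    then have "v \<in> qv.span B" using spB by simp
    then obtain c where c: "v = (\<Sum>b\<in>B. qscale (c b) b)" unfolding qv.span_finite[OF finB] by blast
    have "qscale (c b) b = qscale (\<tau> b v) (\<delta> b)" if b: "b \<in> B" for b
    proof -
      have "g b v = (\<Sum>b'\<in>B. g b (qscale (c b') b'))"
        unfolding c using b by (intro functional_sum gadd gscale)
      also have "\<dots> = (\<Sum>b'\<in>B. if b' = b then c b' else 0)"
        by (rule sum.cong[OF refl]) (simp add: gscale[OF b] gb[OF b])
      also have "\<dots> = c b" using finB b by simp
      finally have "\<tau> b v = c b / of_nat N" using b by (simp add: \<tau>_def)
      then show ?thesis using N(1) unfolding \<delta>_def by simp
    qed
    then have "(\<Sum>b\<in>B. qscale (c b) b) = (\<Sum>b\<in>B. qscale (\<tau> b v) (\<delta> b))" by (rule sum.cong[OF refl])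
    then show "v = (\<Sum>b\<in>B. qscale (\<tau> b v) (\<delta> b))" using c by (simp only:)
  qed
qed

end

context toric_family
begin

text \<open>
  The products of degree \<open>l\<close> in \<open>A_piece\<close> with a common \<open>w\<close> are sections of weights that differ by
  \<open>O(l)\<close> along \<open>L\<close>.  After multiplication by a form with a large polytope in the direction
  of \<open>L\<close>, they share about \<open>l\<^bsup>dim L\<^esup>\<close> weights.
\<close>

lemma weights_ge_alpha_sum:
  assumes p: "p > 0"
  shows "\<exists>Q\<ge>1. \<forall>l\<ge>1. real l ^ qv.dim L * alpha_sum p l \<le> real (card (weights (Q * l)))"
proof -
  obtain B :: "qvec set" and P G \<alpha> \<delta> and \<tau> :: "qvec \<Rightarrow> qvec \<Rightarrow> rat" where
    finB: "finite B" and cB: "card B = qv.dim L" and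
    frame: "\<forall>b\<in>B. in_sec (P b) (\<alpha> b) (G b) \<and> in_sec (P b) (\<alpha> b + \<delta> b) (G b) \<and>
      \<alpha> b \<in> lattice_pts r \<and> \<delta> b \<in> lattice_pts r \<and> \<delta> b \<in> L" and
    \<tau>0: "(\<forall>b x y. \<tau> b (x + y) = \<tau> b x + \<tau> b y)" "(\<forall>b c x. \<tau> b (qscale c x) = c * \<tau> b x)" and
    \<tau>\<delta>0: "\<forall>b\<in>B. \<forall>b'\<in>B. \<tau> b (\<delta> b') = (if b' = b then 1 else 0 :: rat)" and
    \<tau>L: "\<forall>x\<in>L. x = (\<Sum>b\<in>B. qscale (\<tau> b x) (\<delta> b))"
    using L_frame by (elim exE conjE)
  have \<tau>: "\<tau> b (x + y) = \<tau> b x + \<tau> b y" "\<tau> b (qscale c x) = c * \<tau> b x" for b x y c using \<tau>0 by blast+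
  note \<tau>_sum = functional_sum[of "\<tau> b" for b, OF \<tau>]
  have \<tau>\<delta>: "\<tau> b (\<delta> b') = (if b' = b then 1 else 0)" if "b \<in> B" "b' \<in> B" for b b' using \<tau>\<delta>0 that by blast
  have \<tau>_diff: "\<tau> b (x - y) = \<tau> b x - \<tau> b y" for b x y
    using \<tau>(1)[of b "x - y" y] by simp
  obtain \<beta> where \<beta>: "\<And>f. f \<in> E p \<Longrightarrow> in_sec p (\<beta> f) f \<and> \<beta> f \<in> lattice_pts r"
    using E_point[OF p] by blast
  \<comment> \<open>Bounds all coordinate functions at the points chosen for the generators. The
    added 1 makes the box have at least \<open>l\<close> lattice points per direction.\<close>
  define C where "C = nat \<lceil>\<Sum>b\<in>B. \<Sum>f\<in>E p. \<bar>\<tau> b (\<beta> f)\<bar>\<rceil> + 1"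
  have C: "\<bar>\<tau> b (\<beta> f)\<bar> \<le> of_nat C" if "b \<in> B" "f \<in> E p" for b f
  proof -
    have "\<bar>\<tau> b (\<beta> f)\<bar> \<le> (\<Sum>f\<in>E p. \<bar>\<tau> b (\<beta> f)\<bar>)"
      using that finite_E[OF p] by (intro member_le_sum) auto
    also have "\<dots> \<le> (\<Sum>b\<in>B. \<Sum>f\<in>E p. \<bar>\<tau> b (\<beta> f)\<bar>)"
      using that finB by (intro member_le_sum[of b B "\<lambda>b. \<Sum>f\<in>E p. \<bar>\<tau> b (\<beta> f)\<bar>"]) (auto intro: sum_nonneg)
    also have "\<dots> \<le> of_nat C" unfolding C_def by linarith
    finally show ?thesis .
  qed
  define u where "u = (\<lambda>c :: 'a symalg \<Rightarrow> nat. \<Sum>f\<in>E p. qscale (of_nat (c f)) (\<beta> f))"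
  have u_lat: "u c \<in> lattice_pts r" for c
  proof -
    have "u c i \<in> \<int>" for i
      unfolding u_def sum_qvec_apply using \<beta> by (intro Ints_sum) (auto simp: qscale_def lattice_pts_def)
    moreover have "u c i = 0" if "i \<ge> r" for i
      unfolding u_def sum_qvec_apply using \<beta> that
      by (intro sum.neutral) (auto simp: qscale_def lattice_pts_def qspace_def)
    ultimately show ?thesis by (simp add: lattice_pts_def qspace_def)
  qed
  have \<tau>u: "\<bar>\<tau> b (u c)\<bar> \<le> of_nat (C * (\<Sum>f\<in>E p. c f))" if b: "b \<in> B" for b c
  proof -
    have "\<tau> b (u c) = (\<Sum>f\<in>E p. of_nat (c f) * \<tau> b (\<beta> f))" unfolding u_def by (simp only: \<tau>_sum \<tau>(2))
    also have "\<bar>\<dots>\<bar> \<le> (\<Sum>f\<in>E p. \<bar>of_nat (c f) * \<tau> b (\<beta> f)\<bar>)" by (rule sum_abs)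
    also have "\<dots> \<le> (\<Sum>f\<in>E p. of_nat (c f) * of_nat C)"
      using C[OF b] by (intro sum_mono) (auto simp: abs_mult intro: mult_left_mono)
    also have "\<dots> = of_nat (C * (\<Sum>f\<in>E p. c f))"
      by (simp only: of_nat_mult of_nat_sum sum_distrib_left mult.commute)
    finally show ?thesis .
  qed
  \<comment> \<open>Two points that arise in degree \<open>l\<close> differ by at most
    \<open>2 * C * l\<close> in each coordinate.\<close>
  define M where "M = 2 * C"
  \<comment> \<open>A product contributes degree \<open>p * l\<close> and each factor of
    \<open>H\<close> contributes \<open>P b * N\<close> with \<open>N = 3 * M * l\<close>;
    \<open>Q\<close> is the total divided by \<open>l\<close>.\<close>
  define Q where "Q = p + (\<Sum>b\<in>B. P b) * (3 * M)"
  have "real l ^ qv.dim L * alpha_sum p l \<le> real (card (weights (Q * l)))" if l: "l \<ge> 1" for l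
  proof -
    \<comment> \<open>The side of the box is three times the maximal shift: parameters in the middle
      third remain in the box after a shift by at most \<open>M * l\<close> in either
      direction.\<close>
    define N where "N = 3 * M * l"
    define H where "H = (\<Prod>b\<in>B. G b ^ N)"
    define W where "W = {w \<in> Lam r n \<Delta> F. (w, int l) \<in> Lam_p r n \<Delta> F eps p}"
    define A' where "A' = (\<lambda>w. A_piece r n \<Delta> F eps p w (int l))"
    define LM where "LM = (\<lambda>w. lead_mon ` (A' w - {0}))"
    define R where "R = (\<lambda>w c. u c +o L = w \<and> (\<Sum>f\<in>E p. c f) = l)"
    \<comment> \<open>A reference lattice point over \<open>w\<close>; the choice is meaningful as
      soon as the piece of \<open>w\<close> is nonzero.\<close>
    define uw where "uw = (\<lambda>w. u (SOME c. R w c))"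
    define S where "S = PiE B (\<lambda>_. {int (M * l)..int (2 * M * l)})"
    define y where "y = (\<lambda>w s. uw w + (\<Sum>b\<in>B. qscale (of_nat N) (\<alpha> b) + qscale (of_int (s b)) (\<delta> b)))"
    have H: "in_sec (\<Sum>b\<in>B. P b * N) (\<Sum>b\<in>B. qscale (of_nat N) (\<alpha> b) + qscale (t b) (\<delta> b)) H"
      if t: "\<And>b. b \<in> B \<Longrightarrow> 0 \<le> t b \<and> t b \<le> of_nat N" for t
      unfolding H_def
    proof (rule in_sec_prod[OF finB])
      fix b assume b: "b \<in> B"
      have "in_sec (P b * N) (qscale (of_nat N - t b) (\<alpha> b) + qscale (t b) (\<alpha> b + \<delta> b)) (G b ^ N)"
        using frame b t[OF b] by (intro in_sec_power) blast+
      moreover have "qscale (of_nat N - t b) (\<alpha> b) + qscale (t b) (\<alpha> b + \<delta> b)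
          = qscale (of_nat N) (\<alpha> b) + qscale (t b) (\<delta> b)"
        by (simp add: qscale_def fun_eq_iff algebra_simps)
      ultimately show "in_sec (P b * N) (qscale (of_nat N) (\<alpha> b) + qscale (t b) (\<delta> b)) (G b ^ N)"
        by (simp only:)
    qed
    have H0: "H \<noteq> 0" using H[of "\<lambda>_. 0"] by (simp add: in_sec_def)
    have deg: "p * l + (\<Sum>b\<in>B. P b * N) = Q * l"
      unfolding Q_def N_def sum_distrib_right[symmetric] by (simp add: algebra_simps)
    have A'_eq: "A' w = sv.span {\<Prod>f\<in>E p. f ^ c f | c. R w c}" for w
    proof -
      have \<beta>': "in_sec p (\<beta> f) f" if "f \<in> E p" for f using \<beta>[OF that] by blast
      have ws: "L + (\<Sum>f\<in>E p. \<Sum>i<c f. wpt r n \<Delta> F p f) = u c +o L" for c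
        unfolding u_def by (rule wpt_sum[OF p]) (rule \<beta>')
      have "R w c \<longleftrightarrow> L + (\<Sum>f\<in>E p. \<Sum>i<c f. wpt r n \<Delta> F p f) = w \<and> int (\<Sum>f\<in>E p. c f) = int l" for c
        unfolding R_def ws of_nat_eq_iff by (rule refl)
      then show ?thesis unfolding A'_def A_piece_def by (simp only:)
    qed
    have R_some: "R w (SOME c. R w c)" if w: "LM w \<noteq> {}" for w
    proof (rule ccontr)
      assume "\<not> R w (SOME c. R w c)"
      then have "\<not> (\<exists>c. R w c)" using someI_ex[of "R w"] by blast
      then have "{\<Prod>f\<in>E p. f ^ c f | c. R w c} = {}" by blast
      then have "A' w = {0}" unfolding A'_eq by (simp only: sv.span_empty)
      then have "LM w = {}" by (simp add: LM_def)
      then show False using w by simp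
    qed
    \<comment> \<open>A product at \<open>u c\<close> is off the reference point by the coordinates
      \<open>t\<close> along \<open>L\<close>, and the point \<open>s - t\<close> in the box of
      \<open>H\<close> compensates for this. So all generators of the piece, and hence their
      combinations, reach the same \<open>y w s\<close>.\<close>
    have mult: "a * H \<in> sec (Q * l) (y w s)"
      if a: "a \<in> A' w" and w: "LM w \<noteq> {}" and s: "s \<in> S" for a w s
    proof -
      have "a * H \<in> sv.span {f. in_sec (Q * l) (y w s) f}"
      proof (rule span_mult[OF _ a[unfolded A'_eq] sv.span_base[of H "{H}"]])
        fix x h assume "x \<in> {\<Prod>f\<in>E p. f ^ c f | c. R w c}" "h \<in> {H}"
        then obtain c where c: "x = (\<Prod>f\<in>E p. f ^ c f)" "R w c" and h: "h = H" by blast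
        define c0 where "c0 = (SOME c. R w c)"
        have c0: "R w c0" using R_some[OF w] by (simp only: c0_def)
        have "u c +o L = u c0 +o L" using c(2) c0 by (simp add: R_def)
        then have uL: "u c - u c0 \<in> L" by (simp only: coset_eq_iff[OF subspace_L])
        define t where "t = (\<lambda>b. \<tau> b (u c - u c0))"
        have eq: "u c - u c0 = (\<Sum>b\<in>B. qscale (t b) (\<delta> b))" using bspec[OF \<tau>L uL] by (simp only: t_def)
        have t: "\<bar>t b\<bar> \<le> of_nat (M * l)" if b: "b \<in> B" for b
        proof -
          have "\<bar>\<tau> b (u c)\<bar> \<le> of_nat (C * l)" "\<bar>\<tau> b (u c0)\<bar> \<le> of_nat (C * l)"
            using \<tau>u[OF b, of c] \<tau>u[OF b, of c0] c(2) c0 unfolding R_def by simp_all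
          moreover have "(of_nat (M * l) :: rat) = of_nat (C * l) + of_nat (C * l)" by (simp add: M_def)
          ultimately show ?thesis unfolding t_def \<tau>_diff by linarith
        qed
        have "in_sec (\<Sum>f\<in>E p. p * c f) (u c) x"
          unfolding u_def c(1) by (rule in_sec_prod[OF finite_E[OF p]], rule in_sec_scale) (use \<beta> in blast)
        moreover have "(\<Sum>f\<in>E p. p * c f) = p * l" using c(2) unfolding R_def sum_distrib_left[symmetric] by simp
        ultimately have x: "in_sec (p * l) (u c) x" by simp
        have "0 \<le> of_int (s b) - t b \<and> of_int (s b) - t b \<le> of_nat N" if b: "b \<in> B" for b
        proof -
          have "int (M * l) \<le> s b" "s b \<le> int (2 * M * l)" using s b by (auto simp: S_def PiE_iff)
          then have "(of_int (int (M * l)) :: rat) \<le> of_int (s b)" "of_int (s b) \<le> (of_int (int (2 * M * l)) :: rat)"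
            by (simp_all only: of_int_le_iff)
          moreover define K :: rat where "K = of_nat (M * l)"
          moreover have "of_int (int (M * l)) = K" "of_int (int (2 * M * l)) = 2 * K" "of_nat N = 3 * K"
            by (simp_all add: K_def N_def)
          moreover have "\<bar>t b\<bar> \<le> K" using t[OF b] by (simp only: K_def)
          ultimately show ?thesis by linarith
        qed
        then have "in_sec (p * l + (\<Sum>b\<in>B. P b * N))
          (u c + (\<Sum>b\<in>B. qscale (of_nat N) (\<alpha> b) + qscale (of_int (s b) - t b) (\<delta> b))) (x * H)"
          by (rule in_sec_mult[OF x H])
        moreover have "u c + (\<Sum>b\<in>B. qscale (of_nat N) (\<alpha> b) + qscale (of_int (s b) - t b) (\<delta> b)) = y w s"
        proof -
          have "(\<Sum>b\<in>B. qscale (of_nat N) (\<alpha> b) + qscale (of_int (s b) - t b) (\<delta> b))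
            = (\<Sum>b\<in>B. (qscale (of_nat N) (\<alpha> b) + qscale (of_int (s b)) (\<delta> b)) - qscale (t b) (\<delta> b))"
            by (rule sum.cong[OF refl]) (simp only: qv.scale_left_diff_distrib add_diff_eq)
          also have "\<dots> = (\<Sum>b\<in>B. qscale (of_nat N) (\<alpha> b) + qscale (of_int (s b)) (\<delta> b)) - (u c - u c0)"
            by (simp only: sum_subtractf eq)
          finally show ?thesis unfolding y_def uw_def c0_def[symmetric] by simp
        qed
        ultimately have "in_sec (Q * l) (y w s) (x * h)" unfolding deg h by (simp only:)
        then show "x * h \<in> sv.span {f. in_sec (Q * l) (y w s) f}"
          unfolding sec_def[symmetric] by (rule in_sec_imp_sec)
      qed simp
      then show ?thesis by (simp only: sec_def)
    qed
    have y_lat: "y w s \<in> lattice_pts r" for w s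
    proof -
      have "y w s i \<in> \<int>" for i
        unfolding y_def uw_def plus_fun_apply sum_qvec_apply using u_lat frame
        by (intro Ints_add Ints_sum) (auto simp: qscale_def lattice_pts_def)
      moreover have "y w s i = 0" if "i \<ge> r" for i
      proof -
        have "\<alpha> b i = 0" "\<delta> b i = 0" if "b \<in> B" for b
          using bspec[OF frame that] \<open>i \<ge> r\<close> by (auto simp: lattice_pts_def qspace_def)
        then have "(\<Sum>b\<in>B. (qscale (of_nat N) (\<alpha> b) + qscale (of_int (s b)) (\<delta> b)) i) = 0"
          by (intro sum.neutral) (simp add: qscale_def)
        moreover have "uw w i = 0" using u_lat that by (simp add: uw_def lattice_pts_def qspace_def)
        ultimately show ?thesis unfolding y_def plus_fun_apply sum_qvec_apply by simp
      qed
      ultimately show ?thesis by (simp add: lattice_pts_def qspace_def)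
    qed
    \<comment> \<open>The \<alpha> contribute a common constant and the \<delta> lie in
      \<open>L\<close>, so the coset of the remaining part recovers \<open>w\<close>. Then \<tau>
      recovers \<open>s\<close>.\<close>
    have y_inj: "w = w' \<and> s = s'" if w: "LM w \<noteq> {}" "LM w' \<noteq> {}" and s: "s \<in> S" "s' \<in> S"
      and eq: "y w s = y w' s'" for w w' s s'
    proof -
      define \<Sigma> where "\<Sigma> = (\<lambda>s :: qvec \<Rightarrow> int. \<Sum>b\<in>B. qscale (of_int (s b)) (\<delta> b))"
      have yS: "y w s = (\<Sum>b\<in>B. qscale (of_nat N) (\<alpha> b)) + (uw w + \<Sigma> s)" for w s
        unfolding y_def \<Sigma>_def sum.distrib by (rule add.left_commute)
      have \<Sigma>L: "\<Sigma> s \<in> L" for s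
        unfolding \<Sigma>_def using frame by (intro qv.subspace_sum[OF subspace_L] qv.subspace_scale[OF subspace_L]) blast
      have e: "uw w + \<Sigma> s = uw w' + \<Sigma> s'"
        using eq unfolding yS by (simp only: add_left_cancel)
      then have "uw w - uw w' = \<Sigma> s' - \<Sigma> s" by (rule diff_eq_diff_if_add_eq_add)
      also have "\<dots> \<in> L" by (rule qv.subspace_diff[OF subspace_L \<Sigma>L \<Sigma>L])
      finally have "uw w +o L = uw w' +o L" by (simp only: coset_eq_iff[OF subspace_L])
      moreover have "u c +o L = w" if "R w c" for w c using that by (simp only: R_def)
      then have "uw w +o L = w" "uw w' +o L = w'"
        unfolding uw_def using R_some[OF w(1)] R_some[OF w(2)] by blast+
      ultimately have ww': "w = w'" by simp
      then have \<Sigma>eq: "\<Sigma> s = \<Sigma> s'" using e by (simp only: add_left_cancel)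
      have \<tau>\<Sigma>: "\<tau> b (\<Sigma> s) = of_int (s b)" if b: "b \<in> B" for b s
      proof -
        have "\<tau> b (\<Sigma> s) = (\<Sum>b'\<in>B. of_int (s b') * \<tau> b (\<delta> b'))" unfolding \<Sigma>_def by (simp only: \<tau>_sum \<tau>(2))
        also have "\<dots> = (\<Sum>b'\<in>B. if b' = b then of_int (s b') else 0)"
          by (rule sum.cong[OF refl]) (simp add: \<tau>\<delta>[OF b])
        also have "\<dots> = of_int (s b)" using finB b by simp
        finally show ?thesis .
      qed
      have "s = s'"
      proof (rule PiE_ext[OF s[unfolded S_def]])
        fix b assume b: "b \<in> B"
        have "(of_int (s b) :: rat) = of_int (s' b)"
          unfolding \<tau>\<Sigma>[OF b, symmetric] \<Sigma>eq by (rule refl)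
        then show "s b = s' b" by (simp only: of_int_eq_iff)
      qed
      then show ?thesis using ww' by blast
    qed
    define T where "T = (SIGMA w:W. LM w)"
    \<comment> \<open>Multiplication by \<open>H\<close> shifts every leading monomial by the same
      amount, so \<open>m\<close> can be recovered as well.\<close>
    define \<Psi> where "\<Psi> = (\<lambda>((w, m), s). (y w s, m + lead_mon H))"
    have "inj_on \<Psi> (T \<times> S)"
    proof (rule inj_onI)
      fix a a' assume a: "a \<in> T \<times> S" "a' \<in> T \<times> S" "\<Psi> a = \<Psi> a'"
      obtain w m s where 1: "a = ((w, m), s)" by (metis surj_pair)
      obtain w' m' s' where 2: "a' = ((w', m'), s')" by (metis surj_pair)
      have "LM w \<noteq> {}" "LM w' \<noteq> {}" "s \<in> S" "s' \<in> S" using a(1,2) unfolding 1 2 T_def by auto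
      moreover have "y w s = y w' s'" "m + lead_mon H = m' + lead_mon H"
        using a(3) unfolding 1 2 \<Psi>_def by simp_all
      ultimately have "w = w' \<and> s = s'" "m = m'" using y_inj by simp_all
      then show "a = a'" unfolding 1 2 by simp
    qed
    moreover have "\<Psi> ` (T \<times> S) \<subseteq> weights (Q * l)"
    proof (rule image_subsetI)
      fix a assume a: "a \<in> T \<times> S"
      obtain w m s where 1: "a = ((w, m), s)" by (metis surj_pair)
      have m: "m \<in> LM w" "s \<in> S" using a unfolding 1 T_def by auto
      then obtain x where x: "x \<in> A' w" "x \<noteq> 0" "m = lead_mon x" unfolding LM_def by blast
      have "x * H \<in> sec (Q * l) (y w s)" by (rule mult[OF x(1) _ m(2)]) (use m(1) in blast)
      moreover have "x * H \<noteq> 0" using x(2) H0 by simp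
      moreover have "m + lead_mon H = lead_mon (x * H)" using x(2,3) H0 by (simp add: lead_mon_mult)
      ultimately show "\<Psi> a \<in> weights (Q * l)"
        unfolding 1 \<Psi>_def weights_def prod.case using y_lat by blast
    qed
    ultimately have le: "card (T \<times> S) \<le> card (weights (Q * l))"
      using finite_weights by (rule card_inj_on_le)
    have "int (2 * M * l) = int (M * l) + int (M * l)" by simp
    then have "card {int (M * l)..int (2 * M * l)} = M * l + 1"
      unfolding card_atLeastAtMost_int by linarith
    then have "card S = (M * l + 1) ^ card B"
      unfolding S_def card_PiE[OF finB] by (simp only: prod_constant)
    moreover have "l \<le> M * l + 1" by (simp add: M_def C_def)
    ultimately have "l ^ card B \<le> card S" by (simp add: power_mono)
    then have cS: "real l ^ qv.dim L \<le> real (card S)"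
      unfolding cB[symmetric] of_nat_power[symmetric] of_nat_le_iff .
    have "real l ^ qv.dim L * alpha_sum p l = real l ^ qv.dim L * real (card T)"
      unfolding alpha_sum_eq_card[OF p] T_def W_def LM_def A'_def by (rule refl)
    also have "\<dots> \<le> real (card S) * real (card T)" using cS by (intro mult_right_mono) auto
    also have "\<dots> = real (card (T \<times> S))" by (simp add: card_cartesian_product mult.commute)
    also have "\<dots> \<le> real (card (weights (Q * l)))" using le by (simp only: of_nat_le_iff)
    finally show ?thesis .
  qed
  moreover have "Q \<ge> 1" using p by (simp add: Q_def)
  ultimately show ?thesis by blast
qed

text \<open>The counts are compared in degrees divisible by \<open>Q\<close> only, and infinitely
  many of these are enough. The fixed factor \<open>Q powi d\<close> goes into the constant.\<close>

lemma alpha_imp_big: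
  assumes p: "p > 0" and \<alpha>: "alpha r n \<Delta> F eps p > 0"
  shows "big r n \<Delta> F"
proof -
  obtain Q :: nat where Q: "Q \<ge> 1"
    "\<forall>l\<ge>1. real l ^ qv.dim L * alpha_sum p l \<le> real (card (weights (Q * l)))"
    using weights_ge_alpha_sum[OF p] by blast
  define e where "e = int r - int (qv.dim L) + int n - 1"
  define d where "d = int r + int n - 1"
  \<comment> \<open>The \<open>l ^ dim L\<close> common characters fill exactly the gap between the
    exponents in \<open>alpha\<close> and \<open>big\<close>.\<close>
  have de: "d = int (qv.dim L) + e" by (simp add: d_def e_def)
  obtain \<epsilon> where \<epsilon>: "\<epsilon> > 0" "\<exists>\<^sub>F l in sequentially. alpha_sum p l / real l powi e \<ge> \<epsilon>"
    using \<alpha> unfolding alpha_pos_iff e_def by blast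
  define \<epsilon>' where "\<epsilon>' = \<epsilon> / real Q powi d"
  have Qd: "real Q powi d > 0" using Q(1) by (simp add: zero_less_power_int)
  have ratio: "real (card (weights (Q * l))) / real (Q * l) powi d \<ge> \<epsilon>'"
    if l: "l \<ge> 1" and a: "alpha_sum p l / real l powi e \<ge> \<epsilon>" for l
  proof -
    have pos: "real l powi e > 0" "real l powi d > 0" using l by (simp_all add: zero_less_power_int)
    have "\<epsilon> * real l powi e \<le> alpha_sum p l" using a pos(1) by (simp add: pos_le_divide_eq)
    then have "real l ^ qv.dim L * (\<epsilon> * real l powi e) \<le> real l ^ qv.dim L * alpha_sum p l"
      by (intro mult_left_mono) auto
    also have "\<dots> \<le> real (card (weights (Q * l)))" using Q(2) l by blast
    also have "real l ^ qv.dim L * (\<epsilon> * real l powi e) = \<epsilon> * real l powi d"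
      unfolding de using l by (subst power_int_add) (simp_all add: power_int_of_nat)
    finally have "\<epsilon> * real l powi d \<le> real (card (weights (Q * l)))" .
    moreover have "real (Q * l) powi d = real Q powi d * real l powi d"
      by (simp add: power_int_mult_distrib)
    moreover have "\<epsilon>' = \<epsilon> * real l powi d / (real Q powi d * real l powi d)"
      unfolding \<epsilon>'_def by (rule mult_divide_mult_cancel_right[symmetric]) (use pos(2) in linarith)
    ultimately show ?thesis using Qd pos(2)
      by (simp only: divide_right_mono mult_nonneg_nonneg less_imp_le)
  qed
  have "\<exists>\<^sub>F l in sequentially. real (card (weights l)) / real l powi d \<ge> \<epsilon>'"
    unfolding frequently_sequentially
  proof
    fix m
    obtain l where l: "l \<ge> max 1 m" "alpha_sum p l / real l powi e \<ge> \<epsilon>"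
      using \<epsilon>(2) unfolding frequently_sequentially by blast
    have "Q * l \<ge> m" using l(1) Q(1) by (metis max.boundedE mult_le_mono1 nat_mult_1 order_trans)
    moreover have "real (card (weights (Q * l))) / real (Q * l) powi d \<ge> \<epsilon>'" using l by (intro ratio) auto
    ultimately show "\<exists>l\<ge>m. \<epsilon>' \<le> real (card (weights l)) / real l powi d" by blast
  qed
  moreover have "\<epsilon>' > 0" using \<epsilon>(1) Qd by (simp add: \<epsilon>'_def)
  ultimately show ?thesis
    unfolding big_def dim_global_sections limsup_ereal_pos_iff d_def by blast
qed

end

theorem theorem2p1:
  fixes r n :: nat
    and \<Delta> :: "qvec set set"
    and F :: "'k::{alg_closed_field, field_char_0} filts"
    and eps :: "nat \<Rightarrow> 'k symalg set"
  assumes "projective_fan r \<Delta>"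
    and "toric_bundle r \<Delta> (sym_pow n 1) F"
    and "admissible_family r n \<Delta> F eps"
  shows "big r n \<Delta> F \<longleftrightarrow> (\<exists>p>0. alpha r n \<Delta> F eps p > 0)"
proof -
  interpret toric_family r n \<Delta> F eps
    using assms by unfold_locales (auto simp: projective_fan_def)
  show ?thesis using big_imp_alpha alpha_imp_big by blast
qed

end
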